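(* For every integer $n\ge1$, the Wang shift $\Omega_n$ is minimal (it contains no nonempty proper closed shift-invariant subset) and is equal to the substitutive subshift $\mathcal X_{\omega_n}$.
   Context: Fix an integer $n\ge1$; write $\bar m=m+1$. Let $V_n=\{(v_0,v_1,v_2)\in\mathbb{Z}^3: 0\le v_0\le v_1\le 1,\ v_1\le v_2\le n+1\}$; write $(v_0,v_1,v_2)$ as the word $v_0v_1v_2$. A Wang tile is $t=(a,b,c,d)$ with $\mathrm{RIGHT}(t)=a$, $\mathrm{TOP}(t)=b$, $\mathrm{LEFT}(t)=c$, $\mathrm{BOTTOM}(t)=d$; $\hat t=(b,a,d,c)$, $\hat S=\{\hat t:t\in S\}$. Define (as (right, top, left, bottom)): $W_n=\{(11(i+1),11(j+1),11i,11j):1\le i,j\le n\}$; $b_n^i=(00(i+1),111,00i,11n)$, $B_n=\{b_n^i:0\le i\le n-1\}$; $g_n^i=(01(i+1),111,00i,11(n+1))$, $G_n=\{g_n^i:0\le i\le n\}$; $y_n^i=(01(i+1),112,01i,11(n+1))$, $Y_n=\{y_n^i:1\le i\le n\}$; $j_n^{k,l,r,s}=((0,k,l),(0,r,s),(0,s,r+n),(0,l,k+n))$ for $(k,l),(r,s)\in\{(0,0),(0,1),(1,1)\}$; $J_n$ = these 9 tiles minus $j_n^{0,0,1,1},j_n^{1,1,0,0}$. $\mathcal{T}_n=W_n\cup B_n\cup G_n\cup Y_n\cup\hat B_n\cup\hat G_n\cup\hat Y_n\cup J_n$; $\Omega_n$ is the set of configurations $x:\mathbb{Z}^2\to\mathcal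 T_n$ with $\mathrm{RIGHT}(x(\mathbf m))=\mathrm{LEFT}(x(\mathbf m+\mathbf e_1))$, $\mathrm{TOP}(x(\mathbf m))=\mathrm{BOTTOM}(x(\mathbf m+\mathbf e_2))$, with the shift action $(\sigma^{\mathbf k}x)_{\mathbf m}=x_{\mathbf m+\mathbf k}$. Labels of a valid rectangular pattern: bottom/top labels read left to right along bottom/top row, left/right labels read bottom to top along left/right column. Define $\tau_n:V_n\to V_n^*$ by $\tau_n(xyz)=(0,x-y+1,n)\cdot(11n)^{z-x-1}\cdot(11\bar n)^{n+1-z}$ if $x\ne z$, and $\tau_n(xyz)=(0,x-y+1,n+1)\cdot(11\bar n)^{n-z}$ if $x=z$. For $t=(\alpha,\beta,u,v)\in\mathcal T_n$, $\omega_n(t)$ is the unique valid rectangular pattern over $\mathcal T_n$ with right, top, left, bottom labels $\tau_n(\alpha),\tau_n(\beta),\tau_n(u),\tau_n(v)$; $\omega_n$ extends to a 2-dimensional morphism on rectangular words (images of adjacent letters are concatenated). $\mathcal X_{\omega_n}$ is the set of configurations $x:\mathbb Z^2\to\mathcal T_n$ every finite rectangular subpattern of which occurs in $\omega_n^m(a)$ for some tile $a\in\mathcal T_n$ and some $m\ge0$. *)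

theory Defs
  imports "HOL-Analysis.Analysis"
begin

type_synonym label = "int \<times> int \<times> int"
type_synonym tile = "label \<times> label \<times> label \<times> label"

definition V :: "nat \<Rightarrow> label set" where
  "V n = {(v0, v1, v2). 0 \<le> v0 \<and> v0 \<le> v1 \<and> v1 \<le> 1 \<and> v1 \<le> v2 \<and> v2 \<le> int n + 1}"

definition RIGHT :: "tile \<Rightarrow> label" where "RIGHT t = fst t"
definition TOP :: "tile \<Rightarrow> label" where "TOP t = fst (snd t)"
definition LEFT :: "tile \<Rightarrow> label" where "LEFT t = fst (snd (snd t))"
definition BOTTOM :: "tile \<Rightarrow> label" where "BOTTOM t = snd (snd (snd t))"

definition hat :: "tile \<Rightarrow> tile" where
  "hat t = (case t of (a, b, c, d) \<Rightarrow> (b, a, d, c))"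

definition Wt :: "nat \<Rightarrow> tile set" where
  "Wt n = {((1,1,i+1), (1,1,j+1), (1,1,i), (1,1,j)) | i j. 1 \<le> i \<and> i \<le> int n \<and> 1 \<le> j \<and> j \<le> int n}"

definition Bt :: "nat \<Rightarrow> tile set" where
  "Bt n = {((0,0,i+1), (1,1,1), (0,0,i), (1,1,int n)) | i. 0 \<le> i \<and> i \<le> int n - 1}"

definition Gt :: "nat \<Rightarrow> tile set" where
  "Gt n = {((0,1,i+1), (1,1,1), (0,0,i), (1,1,int n + 1)) | i. 0 \<le> i \<and> i \<le> int n}"

definition Yt :: "nat \<Rightarrow> tile set" where
  "Yt n = {((0,1,i+1), (1,1,2), (0,1,i), (1,1,int n + 1)) | i. 1 \<le> i \<and> i \<le> int n}"

definition Jt :: "nat \<Rightarrow> tile set" where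
  "Jt n = {((0,k,l), (0,r,s), (0,s,r + int n), (0,l,k + int n)) | k l r s.
             (k, l) \<in> {(0,0), (0,1), (1,1)} \<and> (r, s) \<in> {(0,0), (0,1), (1,1)} \<and>
             (k, l, r, s) \<noteq> (0,0,1,1) \<and> (k, l, r, s) \<noteq> (1,1,0,0)}"

definition T :: "nat \<Rightarrow> tile set" where
  "T n = Wt n \<union> Bt n \<union> Gt n \<union> Yt n \<union> hat ` Bt n \<union> hat ` Gt n \<union> hat ` Yt n \<union> Jt n"

type_synonym config = "int \<times> int \<Rightarrow> tile"

definition Omega :: "nat \<Rightarrow> config set" where
  "Omega n = {x. \<forall>a b. x (a, b) \<in> T n \<and>
                  RIGHT (x (a, b)) = LEFT (x (a + 1, b)) \<and>
                  TOP (x (a, b)) = BOTTOM (x (a, b + 1))}"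

definition shift :: "int \<times> int \<Rightarrow> config \<Rightarrow> config" where
  "shift k x = (\<lambda>m. x (fst m + fst k, snd m + snd k))"

text \<open>Closedness refers to the product topology on configurations
  (tiles carry the discrete topology), i.e. HOL-Analysis' Function_Topology.\<close>

definition minimal_shift :: "config set \<Rightarrow> bool" where
  "minimal_shift X \<longleftrightarrow>
     (\<forall>Y. Y \<subseteq> X \<and> Y \<noteq> {} \<and> closed Y \<and> (\<forall>k. \<forall>y\<in>Y. shift k y \<in> Y) \<longrightarrow> Y = X)"

text \<open>A rectangular pattern is a list of columns (left to right), each column a
  list of tiles (bottom to top). P ! i ! j is the tile at position (i, j).\<close>

type_synonym pattern = "tile list list"

definition valid_pat :: "nat \<Rightarrow> pattern \<Rightarrow> bool" where
  "valid_pat n P \<longleftrightarrow> P \<noteq> [] \<and> hd P \<noteq> [] \<and>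
     (\<forall>c\<in>set P. length c = length (hd P)) \<and>
     (\<forall>c\<in>set P. set c \<subseteq> T n) \<and>
     (\<forall>i<length P. \<forall>j. Suc j < length (P ! i) \<longrightarrow> TOP (P ! i ! j) = BOTTOM (P ! i ! Suc j)) \<and>
     (\<forall>i. Suc i < length P \<longrightarrow> (\<forall>j<length (P ! i). RIGHT (P ! i ! j) = LEFT (P ! Suc i ! j)))"

definition bottom_labels :: "pattern \<Rightarrow> label list" where
  "bottom_labels P = map (\<lambda>c. BOTTOM (hd c)) P"
definition top_labels :: "pattern \<Rightarrow> label list" where
  "top_labels P = map (\<lambda>c. TOP (last c)) P"
definition left_labels :: "pattern \<Rightarrow> label list" where
  "left_labels P = map LEFT (hd P)"
definition right_labels :: "pattern \<Rightarrow> label list" where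
  "right_labels P = map RIGHT (last P)"

definition tau :: "nat \<Rightarrow> label \<Rightarrow> label list" where
  "tau n v = (case v of (x, y, z) \<Rightarrow>
     if x \<noteq> z then (0, x - y + 1, int n) # replicate (nat (z - x - 1)) (1, 1, int n)
                     @ replicate (nat (int n + 1 - z)) (1, 1, int n + 1)
     else (0, x - y + 1, int n + 1) # replicate (nat (int n - z)) (1, 1, int n + 1))"

definition omega :: "nat \<Rightarrow> tile \<Rightarrow> pattern" where
  "omega n t = (THE P. valid_pat n P \<and>
      right_labels P = tau n (RIGHT t) \<and> top_labels P = tau n (TOP t) \<and>
      left_labels P = tau n (LEFT t) \<and> bottom_labels P = tau n (BOTTOM t))"

definition vstack :: "pattern list \<Rightarrow> pattern" where
  "vstack Qs = map (\<lambda>k. concat (map (\<lambda>Q. Q ! k) Qs)) [0..<length (hd Qs)]"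

definition omega_pat :: "nat \<Rightarrow> pattern \<Rightarrow> pattern" where
  "omega_pat n P = concat (map (\<lambda>c. vstack (map (omega n) c)) P)"

definition subpattern :: "config \<Rightarrow> int \<times> int \<Rightarrow> nat \<Rightarrow> nat \<Rightarrow> pattern" where
  "subpattern x p w h = map (\<lambda>i. map (\<lambda>j. x (fst p + int i, snd p + int j)) [0..<h]) [0..<w]"

definition occurs_in :: "pattern \<Rightarrow> pattern \<Rightarrow> bool" where
  "occurs_in Q P \<longleftrightarrow> (\<exists>a b. a + length Q \<le> length P \<and>
      (\<forall>i<length Q. \<forall>j<length (Q ! i). b + j < length (P ! (a + i)) \<and>
                                         Q ! i ! j = P ! (a + i) ! (b + j)))"

definition X_omega :: "nat \<Rightarrow> config set" where
  "X_omega n = {x. (\<forall>m. x m \<in> T n) \<and>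
      (\<forall>p w h. \<exists>a\<in>T n. \<exists>m. occurs_in (subpattern x p w h) ((omega_pat n ^^ m) [[a]]))}"

end

theory Submission
  imports Defs
begin

text \<open>Labels with first entry 0 mark junction rows and junction columns. Along a row the last entry of
  the labels is a counter, which forces consecutive junction columns to be \<open>n\<close> or \<open>n + 1\<close> apart. Hence
  the junction rows and columns cut every configuration into blocks, and by determinism towards the
  north-east a block is given by its left and bottom words, which turn out to be of the form \<open>tau n u\<close>
  and \<open>tau n v\<close>. Contracting the blocks to single tiles yields a configuration over \<open>T n\<close> and a few
  extra tiles, and comparing counters excludes the latter. So every configuration of \<open>Omega n\<close> is an
  image of another one, and this can be iterated.

  At a deep level every finite window meets at most two by two images, so for minimality it is enough
  that each two by two window occurs in every configuration. Single tiles do, as the images of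
  junction tiles contain all interior tiles, from which all others are generated. A window that is
  not inside an image of a single tile sits on a boundary between images; there the
  tiles depend on few parameters of the window one level higher. After a few levels finitely
  many classes of parameters remain, and each is realised by a window that occurs everywhere.
  The case \<open>n = 1\<close>, where images may have width one, is a finite check.

  Finally \<open>X_omega n\<close> is contained in \<open>Omega n\<close>, because the substitution preserves validity, and is
  nonempty by compactness; as all windows of \<open>Omega n\<close> occur in any of its elements, both are equal.\<close>

text \<open>The contraction only yields equations between opposite sides of the blocks, and tiles of
  \<open>extra\<close> satisfy them too. Membership of the quotient in \<open>Omega n\<close> can
  therefore not be checked block by block. The remedy is to study tilings by \<open>ext_tile\<close>
  and to show that a tiling of the whole plane contains no \<open>extra\<close> tile: a global fact,
  valid for the original configuration and for its quotient alike. The two bounds for the distance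
  of junction columns come from different rows: at least \<open>n\<close> from a junction row, at
  most \<open>n + 1\<close> from an interior row. So the existence of an interior row has to be
  shown beforehand. Boundary windows depend on few parameters because \<open>T n\<close> is
  deterministic in two opposite diagonal directions: left and bottom labels fix a tile, and so do
  right and top labels. A tile touching a boundary is thus fixed by the label on that boundary and
  one further label. Reflection in the diagonal is a symmetry of tiles, tilings and images;
  statements about rows, top sides and horizontal boundaries are obtained from it.\<close>

abbreviation c1 :: "label \<Rightarrow> int" where "c1 v \<equiv> fst (snd v)"
abbreviation c2 :: "label \<Rightarrow> int" where "c2 v \<equiv> snd (snd v)"

section \<open>Shapes of tiles, and \<open>T n\<close> as a subset of them\<close>

definition interior_tile :: "int \<Rightarrow> label \<Rightarrow> label \<Rightarrow> label \<Rightarrow> label \<Rightarrow> bool" where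
  "interior_tile n a b u v \<longleftrightarrow> (\<exists>i j. 1 \<le> i \<and> i \<le> n \<and> 1 \<le> j \<and> j \<le> n \<and>
     a = (1,1,i+1) \<and> b = (1,1,j+1) \<and> u = (1,1,i) \<and> v = (1,1,j))"

text \<open>The bits \<open>(c,m)\<close> merge four families: \<open>(0,0)\<close> is
  \<open>Bt\<close>, \<open>(0,1)\<close> is \<open>Gt\<close>, \<open>(1,1)\<close> is
  \<open>Yt\<close>, and \<open>(1,0)\<close> is an extra one.\<close>

definition strip_tile :: "int \<Rightarrow> label \<Rightarrow> label \<Rightarrow> label \<Rightarrow> label \<Rightarrow> bool" where
  "strip_tile n a b u v \<longleftrightarrow> (\<exists>c i m. (c = 0 \<or> c = 1) \<and> (m = 0 \<or> m = 1) \<and> c \<le> i \<and> i \<le> n - 1 + m \<and>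
     a = (0,m,i+1) \<and> b = (1,1,1+c) \<and> u = (0,c,i) \<and> v = (1,1,n+m))"

definition junction_tile :: "int \<Rightarrow> label \<Rightarrow> label \<Rightarrow> label \<Rightarrow> label \<Rightarrow> bool" where
  "junction_tile n a b u v \<longleftrightarrow> (\<exists>k l r s. 0 \<le> k \<and> k \<le> l \<and> l \<le> 1 \<and> 0 \<le> r \<and> r \<le> s \<and> s \<le> 1 \<and>
     a = (0,k,l) \<and> b = (0,r,s) \<and> u = (0,s,r+n) \<and> v = (0,l,k+n))"

definition ext_tile :: "int \<Rightarrow> label \<Rightarrow> label \<Rightarrow> label \<Rightarrow> label \<Rightarrow> bool" where
  "ext_tile n a b u v \<longleftrightarrow> interior_tile n a b u v \<or> strip_tile n a b u v \<or> strip_tile n b a v u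
     \<or> junction_tile n a b u v"

text \<open>The left and bottom labels of the tiles that \<open>ext_tile\<close> admits in addition to \<open>T n\<close>. These tiles
  have consistent images as well, so the block structure alone does not rule them out.\<close>

definition extra :: "int \<Rightarrow> label \<Rightarrow> label \<Rightarrow> bool" where
  "extra n u v \<longleftrightarrow> fst u = 0 \<and> c1 u = 1 \<and> v = (1,1,n) \<or> fst v = 0 \<and> c1 v = 1 \<and> u = (1,1,n) \<or>
     u = (0,1,n+1) \<and> v = (0,0,n) \<or> v = (0,1,n+1) \<and> u = (0,0,n)"

lemma bit_le_cases:
  fixes k l :: int
  assumes "0 \<le> k" "k \<le> l" "l \<le> 1"
  obtains "k = 0" "l = 0" | "k = 0" "l = 1" | "k = 1" "l = 1"
  using assms by fastforce

lemma Wt_iff: "(a,b,u,v) \<in> Wt n \<longleftrightarrow> interior_tile (int n) a b u v"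
  unfolding Wt_def interior_tile_def by blast

lemma strip_iff:
  assumes "n \<ge> 1"
  shows "(a,b,u,v) \<in> Bt n \<union> Gt n \<union> Yt n \<longleftrightarrow>
     strip_tile (int n) a b u v \<and> \<not> (c1 u = 1 \<and> v = (1,1,int n))"
  unfolding Bt_def Gt_def Yt_def strip_tile_def using assms by auto

lemma Jt_iff:
  "(a,b,u,v) \<in> Jt n \<longleftrightarrow> junction_tile (int n) a b u v \<and>
     \<not> (u = (0,1,int n+1) \<and> v = (0,0,int n)) \<and> \<not> (v = (0,1,int n+1) \<and> u = (0,0,int n))"
proof
  assume "(a,b,u,v) \<in> Jt n"
  then show "junction_tile (int n) a b u v \<and>
     \<not> (u = (0,1,int n+1) \<and> v = (0,0,int n)) \<and> \<not> (v = (0,1,int n+1) \<and> u = (0,0,int n))"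
    unfolding Jt_def junction_tile_def by auto
next
  assume *: "junction_tile (int n) a b u v \<and>
     \<not> (u = (0,1,int n+1) \<and> v = (0,0,int n)) \<and> \<not> (v = (0,1,int n+1) \<and> u = (0,0,int n))"
  then obtain k l r s where kl: "0 \<le> k" "k \<le> l" "l \<le> 1" and rs: "0 \<le> r" "r \<le> s" "s \<le> 1"
    and e: "a = (0,k,l)" "b = (0,r,s)" "u = (0,s,r+int n)" "v = (0,l,k+int n)"
    unfolding junction_tile_def by blast
  have "(k,l,r,s) \<noteq> (0,0,1,1)" "(k,l,r,s) \<noteq> (1,1,0,0)"
    using * unfolding e by auto
  moreover have "(k,l) \<in> {(0,0),(0,1),(1,1)}" using kl by (rule bit_le_cases) simp_all
  moreover have "(r,s) \<in> {(0,0),(0,1),(1,1)}" using rs by (rule bit_le_cases) simp_all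
  ultimately show "(a,b,u,v) \<in> Jt n" unfolding Jt_def e by blast
qed

lemma hat_image: "(a,b,u,v) \<in> hat ` S \<longleftrightarrow> (b,a,v,u) \<in> S"
proof -
  have inv: "hat (hat t) = t" for t by (cases t) (simp add: hat_def)
  have "(a,b,u,v) \<in> hat ` S \<longleftrightarrow> hat (a,b,u,v) \<in> S"
    by (metis (no_types) image_iff inv)
  then show ?thesis by (simp add: hat_def)
qed

lemma interior_not_extra: "interior_tile n a b u v \<Longrightarrow> \<not> extra n u v"
  unfolding interior_tile_def extra_def by auto

lemma strip_extra: "strip_tile n a b u v \<Longrightarrow> extra n u v \<longleftrightarrow> c1 u = 1 \<and> v = (1,1,n)"
  unfolding strip_tile_def extra_def by (elim exE conjE disjE) simp_all

lemma extra_sym: "extra n u v \<longleftrightarrow> extra n v u"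
  unfolding extra_def by blast

lemma junction_extra: "junction_tile n a b u v \<Longrightarrow>
    extra n u v \<longleftrightarrow> u = (0,1,n+1) \<and> v = (0,0,n) \<or> v = (0,1,n+1) \<and> u = (0,0,n)"
  unfolding junction_tile_def extra_def by auto

text \<open>What separates \<open>T n\<close> from \<open>ext_tile\<close> is visible on the left
  and bottom labels alone, so extra tiles can be excluded without looking at the other two
  sides.\<close>

lemma T_iff:
  assumes "n \<ge> 1"
  shows "(a,b,u,v) \<in> T n \<longleftrightarrow> ext_tile (int n) a b u v \<and> \<not> extra (int n) u v"
proof -
  have 1: "(a,b,u,v) \<in> T n \<longleftrightarrow> (a,b,u,v) \<in> Wt n \<or> (a,b,u,v) \<in> Bt n \<union> Gt n \<union> Yt n \<or>
     (b,a,v,u) \<in> Bt n \<union> Gt n \<union> Yt n \<or> (a,b,u,v) \<in> Jt n"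
    unfolding T_def by (simp add: hat_image disj_ac)
  show ?thesis
    unfolding 1 strip_iff[OF assms] Wt_iff Jt_iff ext_tile_def
    using interior_not_extra[of "int n" a b u v] strip_extra[of "int n" a b u v]
      strip_extra[of "int n" b a v u] extra_sym[of "int n" u v] junction_extra[of "int n" a b u v]
    by argo
qed

lemma ext_tile_sym: "ext_tile n a b u v \<longleftrightarrow> ext_tile n b a v u"
  unfolding ext_tile_def interior_tile_def junction_tile_def by blast

lemma tile_fst:
  "interior_tile n a b u v \<Longrightarrow> fst a = 1 \<and> fst b = 1 \<and> fst u = 1 \<and> fst v = 1"
  "strip_tile n a b u v \<Longrightarrow> fst a = 0 \<and> fst b = 1 \<and> fst u = 0 \<and> fst v = 1"
  "junction_tile n a b u v \<Longrightarrow> fst a = 0 \<and> fst b = 0 \<and> fst u = 0 \<and> fst v = 0"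
  unfolding interior_tile_def strip_tile_def junction_tile_def by auto

lemma ext_tile_fst:
  assumes "ext_tile n a b u v"
  shows "fst a = fst u" and "fst b = fst v"
  using assms unfolding ext_tile_def by (auto dest!: tile_fst)

lemma hat_in_T: "n \<ge> 1 \<Longrightarrow> t \<in> T n \<Longrightarrow> hat t \<in> T n"
  by (cases t) (use ext_tile_sym extra_sym in \<open>auto simp: hat_def T_iff\<close>)

subsection \<open>Tilings by edge labels\<close>

text \<open>Only edge labels are stored: neighbouring tiles then match by construction, and
  reflection in the diagonal exchanges \<open>lf\<close> and \<open>bt\<close> with swapped
  arguments.\<close>

locale tiling =
  fixes n :: int and lf bt :: "int \<Rightarrow> int \<Rightarrow> label"
  assumes n1: "n \<ge> 1"
    and tile: "\<And>a b. ext_tile n (lf (a+1) b) (bt a (b+1)) (lf a b) (bt a b)"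

lemma tiling_transpose: "tiling n lf bt \<Longrightarrow> tiling n (\<lambda>a b. bt b a) (\<lambda>a b. lf b a)"
  unfolding tiling_def using ext_tile_sym by blast

lemma int_const:
  assumes "\<And>a::int. f (a+1) = f a"
  shows "f a = f b"
proof (induction a rule: int_induct[where k = b])
  case (step2 i)
  then show ?case using assms[of "i-1"] by simp
qed (simp_all add: assms)

context tiling
begin

definition "rtype b = fst (lf 0 b)"
definition "ctype a = fst (bt a 0)"

lemma fst_lf [simp]: "fst (lf a b) = rtype b"
proof -
  have "fst (lf (a+1) b) = fst (lf a b)" for a
    using tile[of a b] by (rule ext_tile_fst(1))
  then show ?thesis unfolding rtype_def by (rule int_const[where f = "\<lambda>a. fst (lf a b)"])
qed

lemma fst_bt [simp]: "fst (bt a b) = ctype a"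
proof -
  have "fst (bt a (b+1)) = fst (bt a b)" for b
    using tile[of a b] by (rule ext_tile_fst(2))
  then show ?thesis unfolding ctype_def by (rule int_const[where f = "\<lambda>b. fst (bt a b)"])
qed

lemma tile_cases:
  obtains "rtype b = 1" "ctype a = 1" "interior_tile n (lf (a+1) b) (bt a (b+1)) (lf a b) (bt a b)"
  | "rtype b = 0" "ctype a = 1" "strip_tile n (lf (a+1) b) (bt a (b+1)) (lf a b) (bt a b)"
  | "rtype b = 1" "ctype a = 0" "strip_tile n (bt a (b+1)) (lf (a+1) b) (bt a b) (lf a b)"
  | "rtype b = 0" "ctype a = 0" "junction_tile n (lf (a+1) b) (bt a (b+1)) (lf a b) (bt a b)"
proof -
  show ?thesis using tile[of a b] unfolding ext_tile_def
  proof (elim disjE)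
    assume "interior_tile n (lf (a+1) b) (bt a (b+1)) (lf a b) (bt a b)"
    with tile_fst(1)[OF this] show ?thesis using that(1) by simp
  next
    assume "strip_tile n (lf (a+1) b) (bt a (b+1)) (lf a b) (bt a b)"
    with tile_fst(2)[OF this] show ?thesis using that(2) by simp
  next
    assume "strip_tile n (bt a (b+1)) (lf (a+1) b) (bt a b) (lf a b)"
    with tile_fst(2)[OF this] show ?thesis using that(3) by simp
  next
    assume "junction_tile n (lf (a+1) b) (bt a (b+1)) (lf a b) (bt a b)"
    with tile_fst(3)[OF this] show ?thesis using that(4) by simp
  qed
qed

lemma rtype_01: "rtype b = 0 \<or> rtype b = 1" by (rule tile_cases[of b 0]) auto
lemma ctype_01: "ctype a = 0 \<or> ctype a = 1" by (rule tile_cases[of 0 a]) auto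

lemma interior: "rtype b = 1 \<Longrightarrow> ctype a = 1 \<Longrightarrow> interior_tile n (lf (a+1) b) (bt a (b+1)) (lf a b) (bt a b)"
  by (rule tile_cases[of b a]) auto
lemma strip: "rtype b = 0 \<Longrightarrow> ctype a = 1 \<Longrightarrow> strip_tile n (lf (a+1) b) (bt a (b+1)) (lf a b) (bt a b)"
  by (rule tile_cases[of b a]) auto
lemma strip': "rtype b = 1 \<Longrightarrow> ctype a = 0 \<Longrightarrow> strip_tile n (bt a (b+1)) (lf (a+1) b) (bt a b) (lf a b)"
  by (rule tile_cases[of b a]) auto
lemma junction: "rtype b = 0 \<Longrightarrow> ctype a = 0 \<Longrightarrow> junction_tile n (lf (a+1) b) (bt a (b+1)) (lf a b) (bt a b)"
  by (rule tile_cases[of b a]) auto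

lemma step_lf: "ctype a = 1 \<Longrightarrow> c2 (lf (a+1) b) = c2 (lf a b) + 1 \<and> 0 \<le> c2 (lf a b) \<and> c2 (lf a b) \<le> n"
  by (rule tile_cases[of b a]) (auto simp: interior_tile_def strip_tile_def)

lemma run_lf:
  assumes "0 \<le> d" "\<And>m. 0 \<le> m \<Longrightarrow> m < d \<Longrightarrow> ctype (a+m) = 1"
  shows "c2 (lf (a+d) b) = c2 (lf a b) + d"
  using assms
proof (induction d rule: int_ge_induct)
  case (step d)
  have "ctype (a+d) = 1" using step.hyps step.prems by simp
  then show ?case using step step_lf[of "a+d" b] by (simp add: add.assoc)
qed simp

text \<open>In interior columns the counter lies between 0 and \<open>n\<close> and grows by one per
  column, so \<open>n + 2\<close> of them in succession are impossible.\<close>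

lemma zero_col: "\<exists>m. 0 \<le> m \<and> m \<le> n + 1 \<and> ctype (a+m) = 0"
proof (rule ccontr)
  assume "\<not> ?thesis"
  then have *: "ctype (a+m) = 1" if "0 \<le> m" "m \<le> n+1" for m using that ctype_01 by blast
  have "c2 (lf (a+(n+1)) 0) = c2 (lf a 0) + (n+1)" using run_lf[of "n+1" a 0] * n1 by auto
  moreover have "c2 (lf (a+(n+1)) 0) \<le> n" using step_lf *[of "n+1"] n1 by simp
  moreover have "c2 (lf a 0) \<ge> 0" using step_lf *[of 0] n1 by simp
  ultimately show False by simp
qed

lemma ctype_transpose: "tiling.ctype (\<lambda>a b. lf b a) = rtype"
  by (intro ext) (simp only: tiling.ctype_def[OF tiling_transpose[OF tiling_axioms]] rtype_def)

lemma rtype_transpose: "tiling.rtype (\<lambda>a b. bt b a) = ctype"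
  by (intro ext) (simp only: tiling.rtype_def[OF tiling_transpose[OF tiling_axioms]] ctype_def)

lemma zero_row: "\<exists>m. 0 \<le> m \<and> m \<le> n + 1 \<and> rtype (b+m) = 0"
  using tiling.zero_col[OF tiling_transpose[OF tiling_axioms]] unfolding ctype_transpose .

lemma run_bt:
  assumes "0 \<le> d" "\<And>m. 0 \<le> m \<Longrightarrow> m < d \<Longrightarrow> rtype (b+m) = 1"
  shows "c2 (bt a (b+d)) = c2 (bt a b) + d"
  using tiling.run_lf[OF tiling_transpose[OF tiling_axioms], of d b a] assms
  unfolding ctype_transpose by blast

text \<open>If all rows had type 0, then every column left of a junction column would consist of
  yellow tiles only, so there would be no further junction column.\<close>

lemma interior_row: "\<exists>b. rtype b = 1"
proof (rule ccontr)
  assume "\<not> ?thesis"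
  then have r0: "rtype b = 0" for b using rtype_01 by blast
  \<comment> \<open>For stacked junctions, the entries \<open>(r,s)\<close> on top of one are the
    entries \<open>(l,k+n)\<close> at the bottom of the next, so
    \<open>s = k + n \<le> 1\<close>.\<close>
  have J: "n = 1 \<and> (\<exists>l. lf (a+1) b = (0,0,l)) \<and> c1 (lf a b) = 1" if "ctype a = 0" for a b
  proof -
    have *: "n = 1 \<and> c1 (lf a b) = 1 \<and> (\<exists>l. lf (a+1) (b+1) = (0,0,l))" for b
      using junction[OF r0 that, of b] junction[OF r0 that, of "b+1"] n1
      unfolding junction_tile_def by auto
    show ?thesis using *[of b] *[of "b-1"] by simp
  qed
  obtain a where a: "ctype a = 0" using zero_col by blast
  have *: "ctype (a-1-int m) = 1 \<and> (\<forall>b. c1 (lf (a-1-int m) b) = 1)" for m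
  proof (induction m)
    have step: "ctype (x-1) = 1 \<and> (\<forall>b. c1 (lf (x-1) b) = 1)" if x: "\<forall>b. c1 (lf x b) = 1" for x
    proof -
      have c: "ctype (x-1) = 1"
      proof (rule ccontr)
        assume "ctype (x-1) \<noteq> 1"
        then have "ctype (x-1) = 0" using ctype_01 by blast
        from J[OF this, of 0] x[rule_format, of 0] show False by auto
      qed
      have "c1 (lf (x-1) b) = 1" for b
      proof -
        have "c2 (bt (x-1) (b+1)) = n + 1"
          using strip[OF r0 c, of "b+1"] x[rule_format, of "b+1"] by (auto simp: strip_tile_def)
        then show ?thesis using strip[OF r0 c, of b] J[OF a, of 0] by (auto simp: strip_tile_def)
      qed
      with c show ?thesis by blast
    qed
    case 0
    show ?case using step[of a] J[OF a] by auto
    case (Suc m)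
    then show ?case using step[of "a-1-int m"] by (simp add: algebra_simps)
  qed
  obtain m where "0 \<le> m" "m \<le> n + 1" "ctype (a - 2 - n + m) = 0" using zero_col by blast
  with *[of "nat (1 + n - m)"] show False by (simp add: algebra_simps)
qed

lemma run_after_zero:
  assumes "1 \<le> m" "m \<le> d" "\<And>m. 0 < m \<Longrightarrow> m < d \<Longrightarrow> ctype (a+m) = 1"
  shows "c2 (lf (a+m) b) = c2 (lf (a+1) b) + m - 1"
  using run_lf[of "m-1" "a+1" b] assms by (simp add: add.assoc)

text \<open>In a junction row the counter starts at most at 1 and arrives at least at
  \<open>n\<close>, which gives \<open>d \<ge> n\<close>; from above such a row gives only
  \<open>d \<le> n + 2\<close>. In an interior row it starts at least at 1 and arrives at most at
  \<open>n + 1\<close>, which gives \<open>d \<le> n + 1\<close>.\<close>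

lemma gap:
  assumes "ctype a = 0" "ctype (a+d) = 0" "0 < d" and run: "\<And>m. 0 < m \<Longrightarrow> m < d \<Longrightarrow> ctype (a+m) = 1"
  shows "d = n \<or> d = n + 1"
proof -
  obtain b0 where b0: "rtype b0 = 0" using zero_row by blast
  obtain b1 where b1: "rtype b1 = 1" using interior_row by blast
  have r: "c2 (lf (a+d) b) = c2 (lf (a+1) b) + d - 1" for b
    using run_after_zero[of d d a b] assms by simp
  have "d \<ge> n"
    using r[of b0] junction[OF b0 assms(1)] junction[OF b0 assms(2)] by (auto simp: junction_tile_def)
  moreover have "d \<le> n + 1"
    using r[of b1] strip'[OF b1 assms(1)] strip'[OF b1 assms(2)] by (auto simp: strip_tile_def)
  ultimately show ?thesis by linarith
qed

end

subsection \<open>Blocks\<close>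

text \<open>This is \<open>V n\<close> without \<open>(0,0,n+1)\<close>, a label that no tile
  carries. Its word under \<open>tau\<close> cannot be the bottom word of a block: the last strip
  tile of the row would violate \<open>i \<le> n - 1 + m\<close>.\<close>

definition good :: "int \<Rightarrow> label \<Rightarrow> bool" where
  "good n v \<longleftrightarrow> 0 \<le> fst v \<and> fst v \<le> c1 v \<and> c1 v \<le> 1 \<and> c1 v \<le> c2 v \<and> c2 v \<le> n + 1 \<and> v \<noteq> (0,0,n+1)"

definition tau_at :: "int \<Rightarrow> label \<Rightarrow> int \<Rightarrow> label" where
  "tau_at n v m = (if m = 0 then (0, fst v - c1 v + 1, n + of_bool (fst v = c2 v))
     else (1, 1, n + of_bool (m \<ge> c2 v - fst v)))"

text \<open>The left label at position \<open>(p, q)\<close> of the block with left labels \<open>tau n u\<close> and bottom labels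
  \<open>tau n v\<close>; by symmetry the bottom label there is \<open>block_label n v u q p\<close>.\<close>

definition block_label :: "int \<Rightarrow> label \<Rightarrow> label \<Rightarrow> int \<Rightarrow> int \<Rightarrow> label" where
  "block_label n u v p q = (if p = 0 then tau_at n u q
     else if q = 0 then (0, of_bool (p > c2 v - fst v), fst v - c1 v + p)
     else (1, 1, of_bool (q > c2 u - fst u) + p))"

text \<open>\<open>f\<close> and \<open>g\<close> are the bottom and left labels along a junction row, starting at a junction.\<close>

definition codes :: "int \<Rightarrow> int \<Rightarrow> (int \<Rightarrow> label) \<Rightarrow> (int \<Rightarrow> label) \<Rightarrow> label \<Rightarrow> bool" where
  "codes n d f g v \<longleftrightarrow> good n v \<and> d = n + 1 - fst v \<and> (\<forall>m. 0 \<le> m \<longrightarrow> m < d \<longrightarrow> f m = tau_at n v m) \<and>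
    (\<forall>m. 1 \<le> m \<longrightarrow> m \<le> d \<longrightarrow> g m = (0, of_bool (m > c2 v - fst v), fst v - c1 v + m))"

lemma codesD:
  assumes "codes n d f g v"
  shows "good n v" "d = n + 1 - fst v" "0 \<le> m \<Longrightarrow> m < d \<Longrightarrow> f m = tau_at n v m"
    "1 \<le> m \<Longrightarrow> m \<le> d \<Longrightarrow> g m = (0, of_bool (m > c2 v - fst v), fst v - c1 v + m)"
  using assms unfolding codes_def by blast+

locale proper_tiling = tiling +
  assumes no_extra: "\<And>a b. \<not> extra n (lf a b) (bt a b)"

lemma threshold:
  fixes M :: "int \<Rightarrow> int"
  assumes "1 \<le> d" "\<And>m. 1 \<le> m \<Longrightarrow> m < d \<Longrightarrow> M m = 0 \<or> M m = 1"
    "\<And>m. 1 \<le> m \<Longrightarrow> m + 1 < d \<Longrightarrow> M m = 1 \<Longrightarrow> M (m+1) = 1"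
  shows "\<exists>p. 1 \<le> p \<and> p \<le> d \<and> (\<forall>m. 1 \<le> m \<longrightarrow> m < d \<longrightarrow> M m = of_bool (p \<le> m))"
  using assms
proof (induction d rule: int_ge_induct)
  case base
  show ?case by (intro exI[of _ 1]) auto
next
  case (step d)
  then obtain p where p: "1 \<le> p" "p \<le> d" "\<forall>m. 1 \<le> m \<longrightarrow> m < d \<longrightarrow> M m = of_bool (p \<le> m)" by auto
  show ?case
  proof (cases "M d = 1")
    case True
    have "M m = of_bool (p \<le> m)" if "1 \<le> m" "m < d + 1" for m
      using that p True by (cases "m = d") auto
    then show ?thesis using p by (intro exI[of _ p]) auto
  next
    case False
    then have "M d = 0" using step.prems(1)[of d] step.hyps by auto
    moreover have "p = d"
    proof (rule ccontr)
      assume "p \<noteq> d"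
      then have "M (d-1) = 1" using p by simp
      then show False using step.prems(2)[of "d-1"] p \<open>p \<noteq> d\<close> False by simp
    qed
    ultimately have "M m = of_bool (d + 1 \<le> m)" if "1 \<le> m" "m < d + 1" for m
      using that p by (cases "m = d") auto
    then show ?thesis using step.hyps by (intro exI[of _ "d+1"]) auto
  qed
qed

context proper_tiling
begin

text \<open>The labels between two junctions of a row are fixed by three numbers: the length, the
  second entry \<open>l\<close> at the first junction, and the place where the last entries of the
  bottom labels change from \<open>n\<close> to \<open>n + 1\<close>. They change at most once
  because a strip tile with \<open>c = 1\<close> and \<open>m' = 0\<close> is extra.\<close>

lemma decode:
  assumes "ctype a = 0" "ctype (a+d) = 0" "0 < d" and run: "\<And>m. 0 < m \<Longrightarrow> m < d \<Longrightarrow> ctype (a+m) = 1"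
    and b: "rtype b = 0"
  shows "\<exists>v. codes n d (\<lambda>m. bt (a+m) b) (\<lambda>m. lf (a+m) b) v"
proof -
  obtain k l where kl: "0 \<le> k" "k \<le> l" "l \<le> 1" "lf (a+1) b = (0,k,l)" "bt a b = (0,l,k+n)"
    using junction[OF b assms(1)] unfolding junction_tile_def by blast
  obtain r s where rs: "0 \<le> r" "r \<le> s" "s \<le> 1" "lf (a+d) b = (0,s,r+n)"
    using junction[OF b assms(2)] unfolding junction_tile_def by blast
  define M where "M m = c2 (bt (a+m) b) - n" for m
  have st: "(M m = 0 \<or> M m = 1) \<and> bt (a+m) b = (1,1,n+M m) \<and> lf (a+m+1) b = (0,M m,l+m) \<and>
     (c1 (lf (a+m) b) = 1 \<longrightarrow> M m = 1)" if m: "1 \<le> m" "m < d" for m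
  proof -
    have c: "ctype (a+m) = 1" using run m by simp
    obtain c i m' where *: "c = 0 \<or> c = 1" "m' = 0 \<or> m' = 1" "lf (a+m+1) b = (0,m',i+1)"
       "bt (a+m) b = (1,1,n+m')" "lf (a+m) b = (0,c,i)"
      using strip[OF b c] unfolding strip_tile_def by blast
    moreover have "c2 (lf (a+m) b) = l + m - 1"
      using run_after_zero[of m d a b] run m kl by simp
    moreover have "c = 1 \<longrightarrow> m' = 1" using no_extra[of "a+m" b] * by (auto simp: extra_def)
    ultimately show ?thesis by (auto simp: M_def)
  qed
  have "\<exists>p. 1 \<le> p \<and> p \<le> d \<and> (\<forall>m. 1 \<le> m \<longrightarrow> m < d \<longrightarrow> M m = of_bool (p \<le> m))"
  proof (rule threshold)
    fix m assume m: "1 \<le> m" "m + 1 < d" "M m = 1"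
    then show "M (m+1) = 1" using st[of m] st[of "m+1"] by (simp add: add.assoc)
  qed (use assms st in auto)
  then obtain p where p: "1 \<le> p" "p \<le> d" "\<And>m. 1 \<le> m \<Longrightarrow> m < d \<Longrightarrow> M m = of_bool (p \<le> m)" by blast
  have d: "d = n \<or> d = n + 1" using gap assms by blast
  define v0 where "v0 = n + 1 - d"
  \<comment> \<open>If the junction itself carries \<open>n + 1\<close>, then so do all later
    letters; the change then happens at position 0.\<close>
  have p1: "p = 1" if "k = 1" "d > 1"
  proof -
    have "M 1 = 1" using st[of 1] kl that by simp
    then show ?thesis using p(3)[of 1] p(1) that by (simp split: if_splits)
  qed
  have lfm: "lf (a+m) b = (0, if m = 1 then k else of_bool (p \<le> m-1), l+m-1)" if m: "1 \<le> m" "m \<le> d" for m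
    using st[of "m-1"] p(3)[of "m-1"] kl m by (cases "m = 1") (auto simp: algebra_simps)
  have r: "r = l - v0" using lfm[of d] rs(4) assms(3) by (auto simp: v0_def)
  \<comment> \<open>This inverts \<open>tau_at\<close>: the length is \<open>n + 1 - fst v\<close>,
    the second entry of letter 0 is \<open>fst v - c1 v + 1\<close>, and \<open>c2 v - fst v\<close>
    is the position of the first \<open>n + 1\<close>, or \<open>d\<close> if there is none.\<close>
  define v where "v = (v0, v0 + 1 - l, if k = 1 then v0 else v0 + p)"
  have kl01: "(k = 0 \<or> k = 1)" "k = 1 \<Longrightarrow> l = 1" using kl by auto
  have "good n v"
  proof -
    \<comment> \<open>For this \<open>v\<close> no letter carries \<open>n + 1\<close>, so the label
      arriving at the next junction has second entry \<open>s = 0\<close>, while its last entry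
      gives \<open>r = 1\<close>, against \<open>r \<le> s\<close>.\<close>
    have "v \<noteq> (0,0,n+1)"
    proof
      assume v: "v = (0,0,n+1)"
      then have "l = 1" "v0 = 0" "p = n + 1" using n1 by (auto simp: v_def split: if_splits)
      then have "r = 1" "d = n + 1" using r by (auto simp: v0_def)
      then show False using lfm[of d] rs n1 \<open>p = n + 1\<close> assms(3) by auto
    qed
    then show ?thesis using kl kl01 p(1,2) d rs r unfolding good_def by (auto simp: v_def v0_def)
  qed
  moreover have "d = n + 1 - fst v" by (simp add: v_def v0_def)
  moreover have "bt (a+m) b = tau_at n v m" if m: "0 \<le> m" "m < d" for m
  proof (cases "m = 0")
    case True
    then show ?thesis using kl kl01 p(1) by (auto simp: tau_at_def v_def)
  next
    case False
    then show ?thesis using st[of m] p(3)[of m] m p1 kl01 by (auto simp: tau_at_def v_def)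
  qed
  moreover have "lf (a+m) b = (0, of_bool (m > c2 v - fst v), fst v - c1 v + m)" if m: "1 \<le> m" "m \<le> d" for m
    using lfm[OF m] p(1) p1 m kl01 by (auto simp: v_def)
  ultimately show ?thesis unfolding codes_def by blast
qed

end

context tiling
begin

text \<open>Above the bottom row, each row leaves the junction column with a counter prescribed by
  the left word, and interior tiles merely increase it. Hence the two words determine all left
  labels; bottom labels follow by transposition.\<close>

lemma block_lf:
  assumes c: "ctype a = 0" and colrun: "\<And>m. 0 < m \<Longrightarrow> m < d \<Longrightarrow> ctype (a+m) = 1"
    and rowrun: "\<And>m. 0 < m \<Longrightarrow> m < h \<Longrightarrow> rtype (b+m) = 1"
    and bottom: "codes n d (\<lambda>m. bt (a+m) b) (\<lambda>m. lf (a+m) b) v"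
    and left: "codes n h (\<lambda>m. lf a (b+m)) (\<lambda>m. bt a (b+m)) u"
    and p: "0 \<le> p" "p \<le> d" and q: "0 \<le> q" "q < h"
  shows "lf (a+p) (b+q) = block_label n u v p q"
proof -
  consider "p = 0" | "p > 0" "q = 0" | "p > 0" "q > 0" using p q by linarith
  then show ?thesis
  proof cases
    case 1
    then show ?thesis using codesD(3)[OF left] q by (simp add: block_label_def)
  next
    case 2
    then show ?thesis using codesD(4)[OF bottom] p by (simp add: block_label_def)
  next
    case 3
    have r: "rtype (b+q) = 1" using rowrun q 3 by simp
    have first: "lf (a+1) (b+q) = (1,1,1 + of_bool (q > c2 u - fst u))"
      using strip'[OF r c] codesD(4)[OF left, of q] q 3 by (auto simp: strip_tile_def)
    have "c2 (lf (a+p) (b+q)) = of_bool (q > c2 u - fst u) + p"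
      using run_after_zero[of p d a "b+q"] colrun 3 p first by simp
    moreover have "\<exists>i. lf (a+p) (b+q) = (1,1,i)"
    proof (cases "p = 1")
      case False
      have "ctype (a+(p-1)) = 1" using colrun[of "p-1"] p 3 False by simp
      from interior[OF r this] show ?thesis by (auto simp: interior_tile_def)
    qed (use first in auto)
    ultimately show ?thesis using 3 by (auto simp: block_label_def)
  qed
qed

end

section \<open>Extra tiles do not occur in tilings of the plane\<close>

context tiling
begin

lemma prev_zero_row: "\<exists>h. 1 \<le> h \<and> rtype (b-h) = 0 \<and> (\<forall>m. 0 < m \<longrightarrow> m < h \<longrightarrow> rtype (b-h+m) = 1)"
proof -
  obtain m where m: "0 \<le> m" "m \<le> n + 1" "rtype (b-n-2+m) = 0" using zero_row by blast
  define P where "P k \<longleftrightarrow> rtype (b - 1 - int k) = 0" for k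
  have "P (nat (n + 1 - m))" using m by (simp add: P_def algebra_simps)
  then have P: "P (LEAST k. P k)" by (rule LeastI)
  define h where "h = 1 + int (LEAST k. P k)"
  have "rtype (b-h+m) = 1" if "0 < m" "m < h" for m
  proof -
    have "nat (h - 1 - m) < (LEAST k. P k)" using that by (simp add: h_def nat_less_iff)
    then have "\<not> P (nat (h - 1 - m))" by (rule not_less_Least)
    then show ?thesis using that rtype_01[of "b-h+m"] by (simp add: P_def algebra_simps)
  qed
  then show ?thesis using P by (intro exI[of _ h]) (auto simp: P_def h_def algebra_simps)
qed

lemma run_bt_after_zero:
  assumes "1 \<le> h" "\<And>m. 0 < m \<Longrightarrow> m < h \<Longrightarrow> rtype (b-h+m) = 1"
  shows "c2 (bt a b) = c2 (bt a (b-h+1)) + h - 1"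
  using run_bt[of "h-1" "b-h+1" a] assms by (simp add: add.assoc)

text \<open>An extra tile of the strip type would force another one in the previous junction row, one
  column closer to the junction column on its left.\<close>

lemma no_extra_strip:
  assumes "ctype (a - int d) = 0" "ctype a = 1" "rtype b = 0" "c1 (lf a b) = 1" "bt a b = (1,1,n)"
  shows False
  using assms
proof (induction d arbitrary: a b)
  case (Suc d)
  obtain h where h: "1 \<le> h" "rtype (b-h) = 0" "\<And>m. 0 < m \<Longrightarrow> m < h \<Longrightarrow> rtype (b-h+m) = 1"
    using prev_zero_row by blast
  note up = run_bt_after_zero[OF h(1,3)]
  obtain c where c: "c = 0 \<or> c = 1" "bt a (b-h+1) = (1,1,1+c)" "c1 (lf a (b-h)) = c"
    using strip[OF h(2) Suc.prems(2)] unfolding strip_tile_def by auto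
  have n: "n = c + h" using up[of a] c(2) Suc.prems(5) by simp
  consider "ctype (a-1) = 0" | "ctype (a-1) = 1" using ctype_01 by blast
  then show ?case
  proof cases
    case 1
    have "c2 (bt (a-1) b) = n + 1"
      using junction[OF Suc.prems(3) 1] Suc.prems(4) by (auto simp: junction_tile_def)
    moreover have "c2 (bt (a-1) (b-h+1)) \<le> 1"
      using junction[OF h(2) 1] by (auto simp: junction_tile_def)
    ultimately show False using up[of "a-1"] n c(1) by auto
  next
    case 2
    have "c2 (bt (a-1) b) = n + 1"
      using strip[OF Suc.prems(3) 2] Suc.prems(4) by (auto simp: strip_tile_def)
    moreover obtain c' m' where c': "c' = 0 \<or> c' = 1" "bt (a-1) (b-h+1) = (1,1,1+c')"
        "c1 (lf (a-1) (b-h)) = c'" "bt (a-1) (b-h) = (1,1,n+m')" "c1 (lf a (b-h)) = m'"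
      using strip[OF h(2) 2] unfolding strip_tile_def by auto
    \<comment> \<open>Over the same height \<open>h\<close> the counters run from
      \<open>1 + c\<close> to \<open>n\<close> in column \<open>a\<close> and from
      \<open>1 + c'\<close> to \<open>n + 1\<close> in column \<open>a - 1\<close>.\<close>
    ultimately have "c' = c + 1" using up[of "a-1"] n by auto
    then have "c1 (lf (a-1) (b-h)) = 1" "bt (a-1) (b-h) = (1,1,n)" using c c' by auto
    then show False using Suc.IH[of "a-1" "b-h"] Suc.prems(1) 2 h(2) by (simp add: algebra_simps)
  qed
qed simp

lemma no_extra_strip_tile: "\<not> (rtype b = 0 \<and> c1 (lf a b) = 1 \<and> bt a b = (1,1,n))"
proof
  assume *: "rtype b = 0 \<and> c1 (lf a b) = 1 \<and> bt a b = (1,1,n)"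
  then have c: "ctype a = 1" by (metis fst_bt fst_conv)
  obtain m where m: "0 \<le> m" "m \<le> n + 1" "ctype (a-n-1+m) = 0" using zero_col by blast
  have "a - n - 1 + m = a - int (nat (n + 1 - m))" using m by simp
  then show False using no_extra_strip[of a "nat (n + 1 - m)" b] m * c by (simp add: algebra_simps)
qed

lemma prev_zero_col: "\<exists>d. 1 \<le> d \<and> ctype (a-d) = 0 \<and> (\<forall>m. 0 < m \<longrightarrow> m < d \<longrightarrow> ctype (a-d+m) = 1)"
  using tiling.prev_zero_row[OF tiling_transpose[OF tiling_axioms]] unfolding rtype_transpose .

text \<open>Compares the counters of the row of the extra junction and of the row below it.\<close>

lemma no_extra_junction: "\<not> (lf a b = (0,1,n+1) \<and> bt a b = (0,0,n))"
proof
  assume *: "lf a b = (0,1,n+1) \<and> bt a b = (0,0,n)"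
  have r: "rtype b = 0" and c: "ctype a = 0" using fst_lf[of a b] fst_bt[of a b] * by simp_all
  consider "rtype (b-1) = 1" | "rtype (b-1) = 0" using rtype_01 by blast
  then show False
  proof cases
    case 1
    obtain d where d: "1 \<le> d" "ctype (a-d) = 0" "\<And>m. 0 < m \<Longrightarrow> m < d \<Longrightarrow> ctype (a-d+m) = 1"
      using prev_zero_col by blast
    note run = run_after_zero[of d d "a-d"]
    have "lf a (b-1) = (1,1,n)" using strip'[OF 1 c] * by (auto simp: strip_tile_def)
    moreover have "c2 (lf (a-d+1) (b-1)) \<ge> 1" using strip'[OF 1 d(2)] by (auto simp: strip_tile_def)
    moreover have "c2 (lf (a-d+1) b) \<le> 1" using junction[OF r d(2)] by (auto simp: junction_tile_def)
    ultimately show False using run[of b] run[of "b-1"] d * by simp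
  next
    case 2
    have 3: "n = 1" "lf a (b-1) = (0,1,1)" using junction[OF 2 c] * n1 by (auto simp: junction_tile_def)
    consider "ctype (a-1) = 1" | "ctype (a-1) = 0" using ctype_01 by blast
    then show False
    proof cases
      case 1
      have "bt (a-1) b = (1,1,2)" using strip[OF r 1] * 3 by (auto simp: strip_tile_def)
      then show False using strip[OF 2 1] 3 by (auto simp: strip_tile_def)
    next
      case 2
      then show False using junction[OF r 2] * n1 by (auto simp: junction_tile_def)
    qed
  qed
qed

text \<open>Every tiling of the plane by \<open>ext_tile\<close> is thus already one by
  \<open>T n\<close>; for a quotient only the shapes of the tiles remain to be verified.\<close>

lemma proper: "proper_tiling n lf bt"
proof
  fix a b
  note t = tiling_transpose[OF tiling_axioms]
  show "\<not> extra n (lf a b) (bt a b)"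
    using no_extra_strip_tile[of b a] no_extra_junction[of a b]
      tiling.no_extra_strip_tile[OF t, of a b] tiling.no_extra_junction[OF t, of a b]
    unfolding extra_def rtype_transpose by auto
qed

end

subsection \<open>The tile of a block\<close>

lemma of_bool_threshold:
  fixes s t d :: int
  assumes "\<And>q. 1 \<le> q \<Longrightarrow> q \<le> d \<Longrightarrow> s \<le> q \<longleftrightarrow> t \<le> q" "1 \<le> s" "s \<le> d + 1" "1 \<le> t" "t \<le> d + 1"
  shows "s = t"
  using assms(1)[of s] assms(1)[of t] assms(2-) by linarith

text \<open>The word of \<open>a\<close> is compared with the right side of the block letter by
  letter: letter 0 comes from the bottom row of the block, the others from the rows above. The top
  side is the same statement with the roles exchanged.\<close>

lemma block_side:
  assumes n: "n \<ge> 1" and g: "good n a" "good n u" "good n v" and au: "fst a = fst u"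
    and e: "\<And>q. 0 \<le> q \<Longrightarrow> q < n + 1 - fst u \<Longrightarrow> tau_at n a q = block_label n u v (n + 1 - fst v) q"
  shows "fst a - c1 a + 1 = of_bool (c2 v \<le> n)" "of_bool (fst a = c2 a) = 1 - c1 v"
    "\<And>q. 1 \<le> q \<Longrightarrow> q \<le> n - fst u \<Longrightarrow> of_bool (q \<ge> c2 a - fst a) = of_bool (q > c2 u - fst u) + 1 - fst v"
proof -
  have b: "fst u \<le> 1" "fst v \<le> 1" using g by (auto simp: good_def)
  have e0: "tau_at n a 0 = block_label n u v (n + 1 - fst v) 0" using e[of 0] b n by simp
  then show "fst a - c1 a + 1 = of_bool (c2 v \<le> n)" "of_bool (fst a = c2 a) = 1 - c1 v"
    using b n by (auto simp: tau_at_def block_label_def)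
  fix q assume "1 \<le> q" "q \<le> n - fst u"
  then show "of_bool (q \<ge> c2 a - fst a) = of_bool (q > c2 u - fst u) + 1 - fst v"
    using e[of q] b n by (auto simp: tau_at_def block_label_def)
qed

lemma quotient_strip:
  assumes n: "n \<ge> 1" and g: "good n a" "good n b" "good n u" "good n v"
    and au: "fst a = fst u" "fst b = fst v" and uv: "fst u = 0" "fst v = 1"
    and e: "\<And>q. 0 \<le> q \<Longrightarrow> q < n + 1 - fst u \<Longrightarrow> tau_at n a q = block_label n u v (n + 1 - fst v) q"
     "\<And>p. 0 \<le> p \<Longrightarrow> p < n + 1 - fst v \<Longrightarrow> tau_at n b p = block_label n v u (n + 1 - fst u) p"
  shows "strip_tile n a b u v"
proof -
  note A = block_side[OF n g(1,3,4) au(1) e(1)]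
  note B = block_side[OF n g(2,4,3) au(2) e(2)]
  obtain a1 a2 where a: "a = (0,a1,a2)" using au uv by (cases a) auto
  obtain b1 b2 where b: "b = (1,b1,b2)" using au uv by (cases b) auto
  obtain u1 u2 where u: "u = (0,u1,u2)" using uv by (cases u) auto
  obtain v1 v2 where v: "v = (1,v1,v2)" using uv by (cases v) auto
  have G: "0 \<le> a1" "a1 \<le> 1" "a1 \<le> a2" "a2 \<le> n+1" "\<not> (a1 = 0 \<and> a2 = n+1)" "b1 = 1" "1 \<le> b2" "b2 \<le> n+1"
    "0 \<le> u1" "u1 \<le> 1" "u1 \<le> u2" "v1 = 1" "1 \<le> v2" "v2 \<le> n+1"
    using g by (auto simp: good_def a b u v)
  have A1: "1 - a1 = of_bool (v2 \<le> n)" using A(1) by (simp add: a v)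
  have A2: "a2 \<noteq> 0" using A(2) G by (simp add: a v split: if_splits)
  have A3: "a2 \<le> q \<longleftrightarrow> u2 + 1 \<le> q" if "1 \<le> q" "q \<le> n" for q
    using A(3)[of q] that by (auto simp: a u v split: if_splits)
  have B1: "u2 \<le> n" using B(1) G by (simp add: b u split: if_splits)
  have B2: "of_bool (1 = b2) = 1 - u1" using B(2) by (simp add: b u)
  \<comment> \<open>As \<open>fst u = 0\<close>, one indicator equals another one plus 1, so the
    first is 1 and the second is 0.\<close>
  have B3: "b2 - 1 \<le> q \<and> q \<le> v2 - 1" if "1 \<le> q" "q \<le> n - 1" for q
    using B(3)[of q] that by (auto simp: b u v of_bool_def split: if_splits)
  have "a2 = u2 + 1" using of_bool_threshold[of n a2 "u2+1"] A3 A2 G B1 by auto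
  moreover have "v2 \<ge> n" using B3[of "n-1"] G n by (cases "n = 1") auto
  moreover have "b2 \<le> 2" using B3[of 1] G n by (cases "n = 1") auto
  moreover have "b2 = 1 + u1" using B2 \<open>b2 \<le> 2\<close> G by (auto simp: of_bool_def split: if_splits)
  moreover have "a1 = v2 - n" using A1 \<open>v2 \<ge> n\<close> G by (auto simp: of_bool_def split: if_splits)
  ultimately show ?thesis unfolding strip_tile_def a b u v using G
    by - (rule exI[of _ u1], rule exI[of _ u2], rule exI[of _ "v2 - n"], auto)
qed

text \<open>Letters 0 of the two sides fix the bits in \<open>a\<close> and \<open>b\<close>; the
  remaining letters compare thresholds, and equal thresholds mean that a counter grows by one. Extra
  tiles satisfy the same equations, so nothing stronger than \<open>ext_tile\<close> can follow
  here.\<close>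

lemma quotient_tile:
  assumes n: "n \<ge> 1" and g: "good n a" "good n b" "good n u" "good n v"
    and au: "fst a = fst u" "fst b = fst v"
    and e: "\<And>q. 0 \<le> q \<Longrightarrow> q < n + 1 - fst u \<Longrightarrow> tau_at n a q = block_label n u v (n + 1 - fst v) q"
     "\<And>p. 0 \<le> p \<Longrightarrow> p < n + 1 - fst v \<Longrightarrow> tau_at n b p = block_label n v u (n + 1 - fst u) p"
  shows "ext_tile n a b u v"
proof -
  note A = block_side[OF n g(1,3,4) au(1) e(1)]
  note B = block_side[OF n g(2,4,3) au(2) e(2)]
  have "fst u = 0 \<or> fst u = 1" "fst v = 0 \<or> fst v = 1" using g by (auto simp: good_def)
  then consider "fst u = 1" "fst v = 1" | "fst u = 0" "fst v = 1" | "fst u = 1" "fst v = 0"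
    | "fst u = 0" "fst v = 0" by blast
  then show ?thesis
  proof cases
    case 1
    obtain a1 a2 where a: "a = (1,a1,a2)" using au 1 by (cases a) auto
    obtain b1 b2 where b: "b = (1,b1,b2)" using au 1 by (cases b) auto
    obtain u1 u2 where u: "u = (1,u1,u2)" using 1 by (cases u) auto
    obtain v1 v2 where v: "v = (1,v1,v2)" using 1 by (cases v) auto
    have G: "a1 = 1" "1 \<le> a2" "a2 \<le> n+1" "b1 = 1" "1 \<le> b2" "b2 \<le> n+1"
      "u1 = 1" "1 \<le> u2" "v1 = 1" "1 \<le> v2"
      using g by (auto simp: good_def a b u v)
    have 2: "u2 \<le> n" "v2 \<le> n" "a2 \<noteq> 1" "b2 \<noteq> 1"
      using A(1,2) B(1,2) G by (auto simp: a b u v split: if_splits)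
    have A3: "a2 - 1 \<le> q \<longleftrightarrow> u2 \<le> q" if "1 \<le> q" "q \<le> n - 1" for q
      using A(3)[of q] that by (auto simp: a u v split: if_splits)
    have B3: "b2 - 1 \<le> q \<longleftrightarrow> v2 \<le> q" if "1 \<le> q" "q \<le> n - 1" for q
      using B(3)[of q] that by (auto simp: b u v split: if_splits)
    have "a2 - 1 = u2" using of_bool_threshold[of "n-1" "a2-1" u2] A3 2 G by auto
    moreover have "b2 - 1 = v2" using of_bool_threshold[of "n-1" "b2-1" v2] B3 2 G by auto
    ultimately show ?thesis using G 2 unfolding ext_tile_def interior_tile_def a b u v by auto
  next
    case 2
    then show ?thesis using quotient_strip[OF n g au _ _ e] unfolding ext_tile_def by blast
  next
    case 3
    then show ?thesis using quotient_strip[OF n g(2,1,4,3) au(2,1) _ _ e(2,1)] unfolding ext_tile_def by blast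
  next
    case 4
    obtain a1 a2 where a: "a = (0,a1,a2)" using au 4 by (cases a) auto
    obtain b1 b2 where b: "b = (0,b1,b2)" using au 4 by (cases b) auto
    obtain u1 u2 where u: "u = (0,u1,u2)" using 4 by (cases u) auto
    obtain v1 v2 where v: "v = (0,v1,v2)" using 4 by (cases v) auto
    have G: "0 \<le> a1" "a1 \<le> 1" "a1 \<le> a2" "0 \<le> b1" "b1 \<le> 1" "b1 \<le> b2"
      "0 \<le> u1" "u1 \<le> 1" "u2 \<le> n + 1" "0 \<le> v1" "v1 \<le> 1" "v2 \<le> n + 1"
      using g by (auto simp: good_def a b u v)
    have A1: "1 - a1 = of_bool (v2 \<le> n)" "1 - b1 = of_bool (u2 \<le> n)"
      using A(1) B(1) by (simp_all add: a b u v)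
    have A2: "of_bool (0 = a2) = 1 - v1" "of_bool (0 = b2) = 1 - u1"
      using A(2) B(2) by (simp_all add: a b u v)
    have A3: "a2 \<le> q \<and> q \<le> u2 \<and> b2 \<le> q \<and> q \<le> v2" if "1 \<le> q" "q \<le> n" for q
      using A(3)[of q] B(3)[of q] that by (auto simp: a b u v of_bool_def split: if_splits)
    have "u2 \<ge> n" "v2 \<ge> n" "a2 \<le> 1" "b2 \<le> 1" using A3[of 1] A3[of n] n by auto
    then have "a1 = v2 - n" "b1 = u2 - n" "a2 = v1" "b2 = u1"
      using A1 A2 G by (auto simp: of_bool_def split: if_splits)
    then have "junction_tile n a b u v" unfolding junction_tile_def a b u v using G
      by - (rule exI[of _ a1], rule exI[of _ a2], rule exI[of _ b1], rule exI[of _ b2], auto)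
    then show ?thesis unfolding ext_tile_def by blast
  qed
qed

subsection \<open>Desubstitution\<close>

lemma enumerate_zeros:
  fixes P :: "int \<Rightarrow> bool" and N :: int
  assumes ex: "\<And>a. \<exists>m. 0 \<le> m \<and> m \<le> N \<and> P (a+m)"
  obtains C where "\<And>i. P (C i)" "\<And>i::int. C i < C (i+1)"
    "\<And>i m. C i < m \<Longrightarrow> m < C (i+1) \<Longrightarrow> \<not> P m"
proof -
  have N: "N \<ge> 0" using ex[of 0] by linarith
  have next_ex: "\<exists>c. a < c \<and> P c \<and> (\<forall>m. a < m \<longrightarrow> m < c \<longrightarrow> \<not> P m)" for a
  proof -
    obtain m where m: "0 \<le> m" "P (a+1+m)" using ex by blast
    have m': "P (a + 1 + int (nat m))" using m by simp
    define k where "k = (LEAST k. P (a + 1 + int k))"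
    have "P (a + 1 + int k)" unfolding k_def by (rule LeastI[of "\<lambda>k. P (a+1+int k)", OF m'])
    moreover have "\<not> P x" if "a < x" "x < a + 1 + int k" for x
    proof -
      have "nat (x - a - 1) < k" using that by (simp add: nat_less_iff)
      then have "\<not> P (a + 1 + int (nat (x - a - 1)))" unfolding k_def by (rule not_less_Least)
      then show ?thesis using that by simp
    qed
    ultimately show ?thesis by (intro exI[of _ "a + 1 + int k"]) auto
  qed
  then obtain nxt where nxt: "\<And>a. a < nxt a" "\<And>a. P (nxt a)" "\<And>a m. a < m \<Longrightarrow> m < nxt a \<Longrightarrow> \<not> P m"
    by metis
  have prev_ex: "\<exists>c. c < a \<and> P c \<and> (\<forall>m. c < m \<longrightarrow> m < a \<longrightarrow> \<not> P m)" for a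
  proof -
    obtain m where m: "m \<le> N" "P (a-1-N+m)" using ex by blast
    have "a - 1 - int (nat (N - m)) = a - 1 - N + m" using m by simp
    then have m': "P (a - 1 - int (nat (N - m)))" by (simp only: m(2))
    define k where "k = (LEAST k. P (a - 1 - int k))"
    have "P (a - 1 - int k)" unfolding k_def by (rule LeastI[of "\<lambda>k. P (a-1-int k)", OF m'])
    moreover have "\<not> P x" if "x < a" "a - 1 - int k < x" for x
    proof -
      have "nat (a - 1 - x) < k" using that by (simp add: nat_less_iff)
      then have "\<not> P (a - 1 - int (nat (a - 1 - x)))" unfolding k_def by (rule not_less_Least)
      then show ?thesis using that by simp
    qed
    ultimately show ?thesis by (intro exI[of _ "a - 1 - int k"]) auto
  qed
  then obtain prv where prv: "\<And>a. prv a < a" "\<And>a. P (prv a)" "\<And>a m. prv a < m \<Longrightarrow> m < a \<Longrightarrow> \<not> P m"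
    by metis
  obtain c0 where c0: "P c0" using ex by blast
  define C where "C i = (if i \<ge> 0 then (nxt ^^ nat i) c0 else (prv ^^ nat (-i)) c0)" for i :: int
  have PC: "P (C i)" for i
    using nxt(2) prv(2) c0 by (cases "nat i"; cases "nat (-i)") (auto simp: C_def)
  have adj: "C i < C (i+1) \<and> (\<forall>m. C i < m \<longrightarrow> m < C (i+1) \<longrightarrow> \<not> P m)" for i
  proof (cases "i \<ge> 0")
    case True
    then have "C (i+1) = nxt (C i)" by (simp add: C_def nat_add_distrib)
    then show ?thesis using nxt by simp
  next
    case False
    then have "nat (-i) = Suc (nat (-(i+1)))" by simp
    then have "C i = prv (C (i+1))" using False by (cases "i = -1") (auto simp: C_def)
    then show ?thesis using prv by simp
  qed
  show thesis using that[of C] PC adj by blast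
qed

lemma proper_tiling_transpose:
  assumes "proper_tiling n lf bt"
  shows "proper_tiling n (\<lambda>a b. bt b a) (\<lambda>a b. lf b a)"
proof -
  interpret proper_tiling n lf bt by fact
  show ?thesis by (rule tiling.proper[OF tiling_transpose[OF tiling_axioms]])
qed

definition block :: "nat \<Rightarrow> tile \<Rightarrow> int \<Rightarrow> int \<Rightarrow> tile" where
  "block n t p q = (block_label (int n) (LEFT t) (BOTTOM t) (p+1) q, block_label (int n) (BOTTOM t) (LEFT t) (q+1) p,
     block_label (int n) (LEFT t) (BOTTOM t) p q, block_label (int n) (BOTTOM t) (LEFT t) q p)"

definition width :: "nat \<Rightarrow> tile \<Rightarrow> int" where "width n t = int n + 1 - fst (BOTTOM t)"
definition height :: "nat \<Rightarrow> tile \<Rightarrow> int" where "height n t = int n + 1 - fst (LEFT t)"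

text \<open>\<open>C i\<close> and \<open>R j\<close> are the coordinates of the block corners. The
  clause for \<open>C\<close> ranges over all \<open>j\<close> and so also records that the tiles of
  a column have images of equal width; likewise for \<open>R\<close> and heights.\<close>

definition desub :: "nat \<Rightarrow> config \<Rightarrow> config \<Rightarrow> (int \<Rightarrow> int) \<Rightarrow> (int \<Rightarrow> int) \<Rightarrow> bool" where
  "desub n x y C R \<longleftrightarrow> y \<in> Omega n \<and> (\<forall>i j. C (i+1) = C i + width n (y (i,j))) \<and>
     (\<forall>i j. R (j+1) = R j + height n (y (i,j))) \<and>
     (\<forall>i j p q. 0 \<le> p \<longrightarrow> p < width n (y (i,j)) \<longrightarrow> 0 \<le> q \<longrightarrow> q < height n (y (i,j)) \<longrightarrow>
        x (C i + p, R j + q) = block n (y (i,j)) p q)"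

lemma tile_eq: "t = (RIGHT t, TOP t, LEFT t, BOTTOM t)"
  by (simp add: RIGHT_def TOP_def LEFT_def BOTTOM_def)

lemma labels_simps [simp]:
  "RIGHT (a,b,c,d) = a" "TOP (a,b,c,d) = b" "LEFT (a,b,c,d) = c" "BOTTOM (a,b,c,d) = d"
  by (simp_all add: RIGHT_def TOP_def LEFT_def BOTTOM_def)

lemma Omega_tile:
  assumes "x \<in> Omega n"
  shows "x (a,b) = (LEFT (x (a+1,b)), BOTTOM (x (a,b+1)), LEFT (x (a,b)), BOTTOM (x (a,b)))"
  using tile_eq[of "x (a,b)"] assms by (simp add: Omega_def)

lemma Omega_proper_tiling:
  assumes "n \<ge> 1" "x \<in> Omega n"
  shows "proper_tiling (int n) (\<lambda>a b. LEFT (x (a,b))) (\<lambda>a b. BOTTOM (x (a,b)))"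
proof -
  have "x (a,b) \<in> T n" for a b using assms by (simp add: Omega_def)
  then have "(LEFT (x (a+1,b)), BOTTOM (x (a,b+1)), LEFT (x (a,b)), BOTTOM (x (a,b))) \<in> T n" for a b
    using Omega_tile[OF assms(2), of a b] by metis
  then show ?thesis using assms(1) unfolding T_iff[OF assms(1)]
    by unfold_locales auto
qed

lemma Omega_I:
  assumes "n \<ge> 1" "tiling (int n) lf bt"
  shows "(\<lambda>(a,b). (lf (a+1) b, bt a (b+1), lf a b, bt a b)) \<in> Omega n"
  using assms tiling.tile[OF assms(2)] proper_tiling.no_extra[OF tiling.proper[OF assms(2)]]
  by (simp add: Omega_def T_iff)

lemma desub_exists:
  assumes n: "n \<ge> 1" and x: "x \<in> Omega n"
  shows "\<exists>y C R. desub n x y C R"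
proof -
  define N where "N = int n"
  define lf where "lf a b = LEFT (x (a,b))" for a b
  define bt where "bt a b = BOTTOM (x (a,b))" for a b
  have pt: "proper_tiling N lf bt"
    using Omega_proper_tiling[OF n x] unfolding N_def lf_def bt_def .
  interpret proper_tiling N lf bt by fact
  note tr = proper_tiling_transpose[OF pt]
  note tr' = tiling_transpose[OF tiling_axioms]
  have xt: "x (a,b) = (lf (a+1) b, bt a (b+1), lf a b, bt a b)" for a b
    using Omega_tile[OF x] by (simp add: lf_def bt_def)
  obtain C where C: "\<And>i. ctype (C i) = 0" "\<And>i::int. C i < C (i+1)"
    "\<And>i m. C i < m \<Longrightarrow> m < C (i+1) \<Longrightarrow> \<not> ctype m = 0"
    using enumerate_zeros[of "N+1" "\<lambda>a. ctype a = 0"] zero_col by metis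
  obtain R where R: "\<And>i. rtype (R i) = 0" "\<And>i::int. R i < R (i+1)"
    "\<And>i m. R i < m \<Longrightarrow> m < R (i+1) \<Longrightarrow> \<not> rtype m = 0"
    using enumerate_zeros[of "N+1" "\<lambda>a. rtype a = 0"] zero_row by metis
  have Crun: "ctype (C i + m) = 1" if "0 < m" "m < C (i+1) - C i" for i m
    using C(3)[of i "C i + m"] ctype_01[of "C i + m"] that by simp
  have Rrun: "rtype (R i + m) = 1" if "0 < m" "m < R (i+1) - R i" for i m
    using R(3)[of i "R i + m"] rtype_01[of "R i + m"] that by simp
  define PV where "PV i j = codes N (C (i+1) - C i) (\<lambda>m. bt (C i+m) (R j)) (\<lambda>m. lf (C i+m) (R j))" for i j
  have "\<exists>v. PV i j v" for i j
    unfolding PV_def by (rule decode) (use C R Crun in auto)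
  then obtain v where "\<And>i j. PV i j (v i j)" by metis
  note v' = this[unfolded PV_def]
  define PU where "PU i j = codes N (R (j+1) - R j) (\<lambda>m. lf (C i) (R j+m)) (\<lambda>m. bt (C i) (R j+m))" for i j
  have "\<exists>u. PU i j u" for i j
    unfolding PU_def
    by (rule proper_tiling.decode[OF tr, unfolded ctype_transpose rtype_transpose]) (use C R Rrun in auto)
  then obtain u where "\<And>i j. PU i j (u i j)" by metis
  note u' = this[unfolded PU_def]
  note v = codesD(1)[OF v'] codesD(2)[OF v'] codesD(3)[OF v']
    and u = codesD(1)[OF u'] codesD(2)[OF u'] codesD(3)[OF u']
  have blf: "lf (C i + p) (R j + q) = block_label N (u i j) (v i j) p q"
    if "0 \<le> p" "p \<le> C (i+1) - C i" "0 \<le> q" "q < R (j+1) - R j" for i j p q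
    using that by (intro block_lf[where d = "C (i+1) - C i" and h = "R (j+1) - R j"] C u' v' Crun Rrun)
  have bbt: "bt (C i + p) (R j + q) = block_label N (v i j) (u i j) q p"
    if "0 \<le> q" "q \<le> R (j+1) - R j" "0 \<le> p" "p < C (i+1) - C i" for i j p q
    using that
    by (intro tiling.block_lf[OF tr', where d = "R (j+1) - R j" and h = "C (i+1) - C i", unfolded ctype_transpose rtype_transpose]
         R u' v' Crun Rrun)
  \<comment> \<open>The right side of block \<open>(i,j)\<close> is the left side of block
    \<open>(i+1,j)\<close>, hence the word of \<open>u (i+1) j\<close>; similarly at the
    top.\<close>
  have ext: "ext_tile N (u (i+1) j) (v i (j+1)) (u i j) (v i j)" for i j
  proof (rule quotient_tile)
    show "tau_at N (u (i+1) j) q = block_label N (u i j) (v i j) (N + 1 - fst (v i j)) q"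
      if "0 \<le> q" "q < N + 1 - fst (u i j)" for q
    proof -
      have 1: "C i + (N + 1 - fst (v i j)) = C (i+1)" using v(2)[of i j] by simp
      have q: "q < R (j+1) - R j" using that u(2)[of j i] by simp
      have "lf (C i + (N + 1 - fst (v i j))) (R j + q) = block_label N (u i j) (v i j) (N + 1 - fst (v i j)) q"
        by (rule blf) (use that(1) q C(2)[of i] v(2)[of i j] in auto)
      then show ?thesis unfolding 1 using u(3)[OF that(1) q, of "i+1"] by simp
    qed
    show "tau_at N (v i (j+1)) q = block_label N (v i j) (u i j) (N + 1 - fst (u i j)) q"
      if "0 \<le> q" "q < N + 1 - fst (v i j)" for q
    proof -
      have 1: "R j + (N + 1 - fst (u i j)) = R (j+1)" using u(2)[of j i] by simp
      have q: "q < C (i+1) - C i" using that v(2)[of i j] by simp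
      have "bt (C i + q) (R j + (N + 1 - fst (u i j))) = block_label N (v i j) (u i j) (N + 1 - fst (u i j)) q"
        by (rule bbt) (use that(1) q R(2)[of j] u(2)[of j i] in auto)
      then show ?thesis unfolding 1 using v(3)[OF that(1) q, of "j+1"] by simp
    qed
    show "fst (u (i+1) j) = fst (u i j)" using u(2)[of j i] u(2)[of j "i+1"] by simp
    show "fst (v i (j+1)) = fst (v i j)" using v(2)[of i j] v(2)[of i "j+1"] by simp
  qed (use n1 u v in auto)
  define y where "y = (\<lambda>(i,j). (u (i+1) j, v i (j+1), u i j, v i j))"
  have "y \<in> Omega n" unfolding y_def
    by (rule Omega_I[OF n]) (use ext n1 in \<open>unfold_locales, auto simp: N_def\<close>)
  moreover have yl: "LEFT (y (i,j)) = u i j" "BOTTOM (y (i,j)) = v i j" for i j by (simp_all add: y_def)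
  have w: "width n (y (i,j)) = C (i+1) - C i" "height n (y (i,j)) = R (j+1) - R j" for i j
    using v(2)[of i j] u(2)[of j i] by (simp_all add: width_def height_def yl N_def)
  moreover have "x (C i + p, R j + q) = block n (y (i,j)) p q"
    if "0 \<le> p" "p < width n (y (i,j))" "0 \<le> q" "q < height n (y (i,j))" for i j p q
    using blf[of p i q j] blf[of "p+1" i q j] bbt[of q j p i] bbt[of "q+1" j p i] that
    unfolding w by (simp add: xt block_def yl N_def add.assoc)
  ultimately have "desub n x y C R" unfolding desub_def by simp
  then show ?thesis by blast
qed

lemma Omega_fst:
  assumes "n \<ge> 1" "x \<in> Omega n"
  shows "fst (LEFT (x p)) = 0 \<or> fst (LEFT (x p)) = 1" "fst (BOTTOM (x p)) = 0 \<or> fst (BOTTOM (x p)) = 1"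
proof -
  interpret proper_tiling "int n" "\<lambda>a b. LEFT (x (a,b))" "\<lambda>a b. BOTTOM (x (a,b))"
    by (rule Omega_proper_tiling[OF assms])
  obtain a b where "p = (a,b)" by (cases p)
  then show "fst (LEFT (x p)) = 0 \<or> fst (LEFT (x p)) = 1" "fst (BOTTOM (x p)) = 0 \<or> fst (BOTTOM (x p)) = 1"
    using fst_lf[of a b] fst_bt[of a b] rtype_01[of b] ctype_01[of a] by auto
qed

lemma width_bounds:
  assumes "n \<ge> 1" "x \<in> Omega n"
  shows "int n \<le> width n (x p)" "width n (x p) \<le> int n + 1" "int n \<le> height n (x p)" "height n (x p) \<le> int n + 1"
  using Omega_fst[OF assms, of p] by (auto simp: width_def height_def)

lemma desub_mono:
  assumes "n \<ge> 1" "desub n x y C R"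
  shows "C i < C (i+1)" "R i < R (i+1)"
proof -
  have y: "y \<in> Omega n" using assms by (simp add: desub_def)
  have "C (i+1) = C i + width n (y (i,0))" "R (i+1) = R i + height n (y (0,i))"
    using assms(2) by (simp_all add: desub_def)
  then show "C i < C (i+1)" "R i < R (i+1)"
    using width_bounds[OF assms(1) y] assms(1) by (smt (verit) of_nat_1 of_nat_le_iff)+
qed

lemma locate_between:
  fixes C :: "int \<Rightarrow> int"
  assumes "0 \<le> w" "C i \<le> m" "m < C (i+w)"
  shows "\<exists>p. 0 \<le> p \<and> p < w \<and> C (i+p) \<le> m \<and> m < C (i+p+1)"
  using assms
proof (induction w rule: int_ge_induct)
  case (step w)
  show ?case
  proof (cases "m < C (i+w)")
    case True
    with step obtain p where "0 \<le> p \<and> p < w \<and> C (i+p) \<le> m \<and> m < C (i+p+1)" by blast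
    then show ?thesis by (intro exI[of _ p]) auto
  next
    case False
    then show ?thesis using step by (intro exI[of _ w]) (auto simp: add.assoc)
  qed
qed simp

lemma locate:
  fixes C :: "int \<Rightarrow> int"
  assumes "\<And>i. C i < C (i+1)"
  obtains i where "C i \<le> m" "m < C (i+1)"
proof -
  have up: "C (i + int k) \<ge> C i + int k" for i k
  proof (induction k)
    case (Suc k)
    then show ?case using assms[of "i + int k"] by (simp add: algebra_simps)
  qed simp
  define K where "K = nat (\<bar>m - C 0\<bar> + 1)"
  have "C (- int K) \<le> m" using up[of "- int K" K] by (simp add: K_def)
  moreover have "m < C (- int K + 2 * int K)" using up[of 0 K] by (simp add: K_def)
  ultimately show thesis using locate_between[of "2 * int K" C "- int K" m] that by auto
qed

section \<open>Patterns that occur in every configuration, and their images\<close>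

definition ubiq :: "nat \<Rightarrow> int \<Rightarrow> int \<Rightarrow> (int \<Rightarrow> int \<Rightarrow> tile) \<Rightarrow> bool" where
  "ubiq n w h f \<longleftrightarrow> (\<forall>x\<in>Omega n. \<exists>a b. \<forall>p q. 0 \<le> p \<longrightarrow> p < w \<longrightarrow> 0 \<le> q \<longrightarrow> q < h \<longrightarrow> x (a+p,b+q) = f p q)"

lemma ubiq_sub:
  assumes "ubiq n w h f" "0 \<le> a" "0 \<le> b" "a + w' \<le> w" "b + h' \<le> h"
    and "\<And>p q. 0 \<le> p \<Longrightarrow> p < w' \<Longrightarrow> 0 \<le> q \<Longrightarrow> q < h' \<Longrightarrow> g p q = f (a+p) (b+q)"
  shows "ubiq n w' h' g"
  unfolding ubiq_def
proof
  fix x assume "x \<in> Omega n"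
  then obtain c d where *: "\<forall>p q. 0 \<le> p \<longrightarrow> p < w \<longrightarrow> 0 \<le> q \<longrightarrow> q < h \<longrightarrow> x (c+p,d+q) = f p q"
    using assms(1) by (auto simp: ubiq_def)
  show "\<exists>c d. \<forall>p q. 0 \<le> p \<longrightarrow> p < w' \<longrightarrow> 0 \<le> q \<longrightarrow> q < h' \<longrightarrow> x (c+p,d+q) = g p q"
    using *[rule_format, of "a+_" "b+_"] assms(2-)
    by (intro exI[of _ "c+a"] exI[of _ "d+b"]) (auto simp: add.assoc)
qed

definition flip :: "config \<Rightarrow> config" where "flip x = (\<lambda>(a,b). hat (x (b,a)))"

lemma hat_labels [simp]:
  "RIGHT (hat t) = TOP t" "TOP (hat t) = RIGHT t" "LEFT (hat t) = BOTTOM t" "BOTTOM (hat t) = LEFT t"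
  "hat (hat t) = t"
  by (cases t; simp add: hat_def)+

lemma flip_Omega: "n \<ge> 1 \<Longrightarrow> x \<in> Omega n \<Longrightarrow> flip x \<in> Omega n"
  by (simp add: Omega_def flip_def hat_in_T)

text \<open>Any other configuration has a preimage of its own, which contains the same window. The
  block sizes there depend only on the tiles of the window, so both images agree relative to their
  lower left corners.\<close>

lemma ubiq_lift:
  assumes n: "n \<ge> 1" and d: "desub n x y C R" and w: "0 < w" "0 < h"
    and u: "ubiq n w h (\<lambda>p q. y (i+p,j+q))"
  shows "ubiq n (C (i+w) - C i) (R (j+h) - R j) (\<lambda>p q. x (C i + p, R j + q))"
  unfolding ubiq_def
proof
  fix x' assume "x' \<in> Omega n"
  then obtain y' C' R' where d': "desub n x' y' C' R'" using desub_exists[OF n] by blast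
  then have y': "y' \<in> Omega n" by (simp add: desub_def)
  obtain i' j' where e: "\<And>p q. 0 \<le> p \<Longrightarrow> p < w \<Longrightarrow> 0 \<le> q \<Longrightarrow> q < h \<Longrightarrow> y' (i'+p,j'+q) = y (i+p,j+q)"
    using u y' unfolding ubiq_def by blast
  have C1: "C (i+1) = C i + width n (y (i,j))" "R (j+1) = R j + height n (y (i,j))" for i j
    using d by (auto simp: desub_def)
  have C1': "C' (i+1) = C' i + width n (y' (i,j))" "R' (j+1) = R' j + height n (y' (i,j))" for i j
    using d' by (auto simp: desub_def)
  have CC: "C' (i'+p) - C' i' = C (i+p) - C i" if "0 \<le> p" "p \<le> w" for p
    using that
  proof (induction p rule: int_ge_induct)
    case (step p)
    then show ?case using C1(1)[of "i+p" j] C1'(1)[of "i'+p" j'] e[of p 0] w by (simp add: add.assoc)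
  qed simp
  have RR: "R' (j'+p) - R' j' = R (j+p) - R j" if "0 \<le> p" "p \<le> h" for p
    using that
  proof (induction p rule: int_ge_induct)
    case (step p)
    then show ?case using C1(2)[of "j+p" i] C1'(2)[of "j'+p" i'] e[of 0 p] w by (simp add: add.assoc)
  qed simp
  have "x' (C' i' + P, R' j' + Q) = x (C i + P, R j + Q)"
    if P: "0 \<le> P" "P < C (i+w) - C i" "0 \<le> Q" "Q < R (j+h) - R j" for P Q
  proof -
    obtain p where p: "0 \<le> p" "p < w" "C (i+p) \<le> C i + P" "C i + P < C (i+p+1)"
      using locate_between[of w C i "C i + P"] P w by auto
    obtain q where q: "0 \<le> q" "q < h" "R (j+q) \<le> R j + Q" "R j + Q < R (j+q+1)"
      using locate_between[of h R j "R j + Q"] P w by auto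
    define p' q' where "p' = C i + P - C (i+p)" and "q' = R j + Q - R (j+q)"
    have b: "0 \<le> p'" "0 \<le> q'" "p' < width n (y (i+p,j+q))" "q' < height n (y (i+p,j+q))"
      using p q C1(1)[of "i+p" "j+q"] C1(2)[of "j+q" "i+p"] by (auto simp: p'_def q'_def)
    have "x (C (i+p) + p', R (j+q) + q') = block n (y (i+p,j+q)) p' q'"
      using d b unfolding desub_def by blast
    moreover have "x' (C' (i'+p) + p', R' (j'+q) + q') = block n (y' (i'+p,j'+q)) p' q'"
      using d' b e[OF p(1,2) q(1,2)] unfolding desub_def by metis
    ultimately show ?thesis using e[OF p(1,2) q(1,2)] CC[of p] RR[of q] p q
      by (simp add: p'_def q'_def algebra_simps)
  qed
  then show "\<exists>a b. \<forall>p q. 0 \<le> p \<longrightarrow> p < C (i+w) - C i \<longrightarrow> 0 \<le> q \<longrightarrow> q < R (j+h) - R j \<longrightarrow>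
     x' (a+p,b+q) = x (C i + p, R j + q)" by blast
qed

section \<open>Images of tiles of \<open>T n\<close> are valid blocks\<close>

lemma strip_sides:
  assumes "n \<ge> 1" "strip_tile n a b u v" "\<not> extra n u v"
  shows "good n a \<and> good n b \<and> good n u \<and> good n v" "fst u = 0" "fst v = 1" "c2 v \<ge> n"
    "\<not> extra n (tau_at n u 0) (tau_at n v 0)"
    "0 \<le> q \<Longrightarrow> q < n + 1 - fst u \<Longrightarrow> block_label n u v (n + 1 - fst v) q = tau_at n a q"
    "0 \<le> p \<Longrightarrow> p < n + 1 - fst v \<Longrightarrow> block_label n v u (n + 1 - fst u) p = tau_at n b p"
proof -
  obtain c i m where *: "c = 0 \<or> c = 1" "m = 0 \<or> m = 1" "c \<le> i" "i \<le> n - 1 + m"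
     "a = (0,m,i+1)" "b = (1,1,1+c)" "u = (0,c,i)" "v = (1,1,n+m)" using assms(2) unfolding strip_tile_def by blast
  have cm: "c = 1 \<longrightarrow> m = 1" using assms(3) * by (auto simp: extra_def)
  show "good n a \<and> good n b \<and> good n u \<and> good n v" using * assms(1) cm by (auto simp: good_def)
  show "fst u = 0" "fst v = 1" "c2 v \<ge> n" using * by auto
  show "\<not> extra n (tau_at n u 0) (tau_at n v 0)" using * cm assms(1) by (auto simp: extra_def tau_at_def)
  show "0 \<le> q \<Longrightarrow> q < n + 1 - fst u \<Longrightarrow> block_label n u v (n + 1 - fst v) q = tau_at n a q"
    using * assms(1) by (auto simp: block_label_def tau_at_def)
  show "0 \<le> p \<Longrightarrow> p < n + 1 - fst v \<Longrightarrow> block_label n v u (n + 1 - fst u) p = tau_at n b p"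
    using * assms(1) cm by (auto simp: block_label_def tau_at_def)
qed

lemma junction_sides:
  assumes "n \<ge> 1" "junction_tile n a b u v" "\<not> extra n u v"
  shows "good n a \<and> good n b \<and> good n u \<and> good n v" "c2 u \<ge> n" "c2 v \<ge> n"
    "\<not> extra n (tau_at n u 0) (tau_at n v 0)"
    "0 \<le> q \<Longrightarrow> q < n + 1 - fst u \<Longrightarrow> block_label n u v (n + 1 - fst v) q = tau_at n a q"
proof -
  obtain k l r s where *: "0 \<le> k" "k \<le> l" "l \<le> 1" "0 \<le> r" "r \<le> s" "s \<le> 1"
     "a = (0,k,l)" "b = (0,r,s)" "u = (0,s,r+n)" "v = (0,l,k+n)" using assms(2) unfolding junction_tile_def by blast
  show "good n a \<and> good n b \<and> good n u \<and> good n v" using * assms(1) by (auto simp: good_def)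
  show "c2 u \<ge> n" "c2 v \<ge> n" using * by auto
  show "\<not> extra n (tau_at n u 0) (tau_at n v 0)" using * assms(1) by (auto simp: extra_def tau_at_def)
  show "0 \<le> q \<Longrightarrow> q < n + 1 - fst u \<Longrightarrow> block_label n u v (n + 1 - fst v) q = tau_at n a q"
    using bit_le_cases[OF *(1-3)] * assms(1) by (auto simp: block_label_def tau_at_def)
qed

lemma junction_tile_sym: "junction_tile n a b u v \<longleftrightarrow> junction_tile n b a v u"
  unfolding junction_tile_def by blast

lemma T_sides_aux:
  assumes n: "n \<ge> 1" and t: "(a,b,u,v) \<in> T n"
  defines "N \<equiv> int n"
  shows "fst a = fst u \<and> fst b = fst v \<and> (good N a \<and> good N b \<and> good N u \<and> good N v) \<and> (fst v = 0 \<longrightarrow> c2 u \<ge> N) \<and> (fst u = 0 \<longrightarrow> c2 v \<ge> N) \<and>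
    \<not> extra N (tau_at N u 0) (tau_at N v 0) \<and>
    (\<forall>q. 0 \<le> q \<longrightarrow> q < N + 1 - fst u \<longrightarrow> block_label N u v (N + 1 - fst v) q = tau_at N a q) \<and>
    (\<forall>p. 0 \<le> p \<longrightarrow> p < N + 1 - fst v \<longrightarrow> block_label N v u (N + 1 - fst u) p = tau_at N b p)"
proof -
  have N: "N \<ge> 1" using n by (simp add: N_def)
  have e: "ext_tile N a b u v" "\<not> extra N u v" using t T_iff[OF n] by (auto simp: N_def)
  note f = ext_tile_fst[OF e(1)]
  show ?thesis using e(1) unfolding ext_tile_def
  proof (elim disjE)
    assume "interior_tile N a b u v"
    then obtain i j where "1 \<le> i" "i \<le> N" "1 \<le> j" "j \<le> N"
      "a = (1,1,i+1)" "b = (1,1,j+1)" "u = (1,1,i)" "v = (1,1,j)" unfolding interior_tile_def by blast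
    then show ?thesis using N by (auto simp: good_def extra_def tau_at_def block_label_def)
  next
    assume s: "strip_tile N a b u v"
    show ?thesis using f strip_sides[OF N s e(2)] by simp
  next
    assume s: "strip_tile N b a v u"
    have e': "\<not> extra N v u" using e(2) extra_sym by blast
    show ?thesis using f strip_sides[OF N s e'] extra_sym[of N "tau_at N u 0"] by simp
  next
    assume s: "junction_tile N a b u v"
    have e': "\<not> extra N v u" using e(2) extra_sym by blast
    have s': "junction_tile N b a v u" using s junction_tile_sym by blast
    show ?thesis using f junction_sides[OF N s e(2)] junction_sides(5)[OF N s' e'] by simp
  qed
qed

text \<open>Converse of \<open>quotient_tile\<close> on \<open>T n\<close>. The two bounds on
  \<open>c2\<close> keep the counters in range inside blocks of full width or height.\<close>

lemma T_sides:
  assumes n: "n \<ge> 1" and t: "(a,b,u,v) \<in> T n"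
  shows "good (int n) a \<and> good (int n) b \<and> good (int n) u \<and> good (int n) v" "fst a = fst u" "fst b = fst v"
    "fst v = 0 \<Longrightarrow> c2 u \<ge> int n" "fst u = 0 \<Longrightarrow> c2 v \<ge> int n"
    "\<not> extra (int n) (tau_at (int n) u 0) (tau_at (int n) v 0)"
    "\<And>q. 0 \<le> q \<Longrightarrow> q < int n + 1 - fst u \<Longrightarrow> block_label (int n) u v (int n + 1 - fst v) q = tau_at (int n) a q"
    "\<And>p. 0 \<le> p \<Longrightarrow> p < int n + 1 - fst v \<Longrightarrow> block_label (int n) v u (int n + 1 - fst u) p = tau_at (int n) b p"
  using T_sides_aux[OF n t] by blast+

text \<open>Letters 0 of the two words are read as junction data: \<open>k\<close> and
  \<open>r\<close> tell whether they carry \<open>n + 1\<close>, and \<open>l\<close> and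
  \<open>s\<close> are their second entries.\<close>

lemma block_corner:
  assumes "n \<ge> 1" "good n u" "good n v"
  shows "junction_tile n (block_label n u v 1 0) (block_label n v u 1 0) (tau_at n u 0) (tau_at n v 0)"
proof -
  obtain u0 u1 u2 where u: "u = (u0,u1,u2)" by (cases u)
  obtain v0 v1 v2 where v: "v = (v0,v1,v2)" by (cases v)
  show ?thesis using assms unfolding junction_tile_def
    by - (rule exI[of _ "of_bool (v0 = v2)"], rule exI[of _ "v0 - v1 + 1"],
       rule exI[of _ "of_bool (u0 = u2)"], rule exI[of _ "u0 - u1 + 1"],
       auto simp: good_def block_label_def tau_at_def u v of_bool_def)
qed

text \<open>The bits \<open>c\<close> and \<open>m\<close> compare \<open>p\<close> with the same
  threshold, strictly and weakly; so \<open>c = 1\<close> forces \<open>m = 1\<close> and no extra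
  tile arises. The bound on \<open>i\<close> at \<open>p = n\<close> rests on the exclusion of
  \<open>(0,0,n+1)\<close> in \<open>good\<close>.\<close>

lemma block_bottom_row:
  assumes "n \<ge> 1" "good n u" "good n v" "1 \<le> p" "p \<le> n - fst v"
  shows "strip_tile n (block_label n u v (p+1) 0) (block_label n v u 1 p) (block_label n u v p 0) (block_label n v u 0 p)"
    "\<not> extra n (block_label n u v p 0) (block_label n v u 0 p)"
proof -
  obtain v0 v1 v2 where v: "v = (v0,v1,v2)" by (cases v)
  show "strip_tile n (block_label n u v (p+1) 0) (block_label n v u 1 p) (block_label n u v p 0) (block_label n v u 0 p)"
    using assms unfolding strip_tile_def
    by - (rule exI[of _ "of_bool (p > v2 - v0)"], rule exI[of _ "v0 - v1 + p"],
       rule exI[of _ "of_bool (p \<ge> v2 - v0)"], auto simp: good_def block_label_def tau_at_def v of_bool_def)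
  show "\<not> extra n (block_label n u v p 0) (block_label n v u 0 p)"
    using assms by (auto simp: extra_def block_label_def tau_at_def v of_bool_def split: if_splits)
qed

lemma block_T:
  assumes n: "n \<ge> 1" and t: "t \<in> T n" and p: "0 \<le> p" "p < width n t" and q: "0 \<le> q" "q < height n t"
  shows "block n t p q \<in> T n"
proof -
  define N where "N = int n"
  have N: "N \<ge> 1" using n by (simp add: N_def)
  obtain a b u v where t': "t = (a,b,u,v)" by (cases t)
  note s = T_sides[OF n t[unfolded t'], folded N_def]
  have w: "p \<le> N - fst v" "q \<le> N - fst u" using p q by (simp_all add: t' width_def height_def N_def)
  have "ext_tile N (block_label N u v (p+1) q) (block_label N v u (q+1) p) (block_label N u v p q) (block_label N v u q p)
     \<and> \<not> extra N (block_label N u v p q) (block_label N v u q p)"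
  proof -
    consider "p = 0" "q = 0" | "p > 0" "q = 0" | "p = 0" "q > 0" | "p > 0" "q > 0" using p q by linarith
    then show ?thesis
    proof cases
      case 1
      then show ?thesis using block_corner[OF N, of u v] s(1,6)
        by (auto simp: ext_tile_def block_label_def)
    next
      case 2
      then show ?thesis using block_bottom_row[OF N, of u v p] s(1) w by (simp add: ext_tile_def)
    next
      case 3
      then show ?thesis using block_bottom_row[OF N, of v u q] s(1) w by (simp add: ext_tile_def extra_sym)
    next
      case 4
      have "fst u = 0 \<or> fst u = 1" "fst v = 0 \<or> fst v = 1" using s(1) by (auto simp: good_def)
      \<comment> \<open>The first sum could exceed \<open>N\<close> only for \<open>p = N\<close>,
        which requires \<open>fst v = 0\<close>; then \<open>c2 u \<ge> N\<close> makes the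
        indicator vanish. The second sum is symmetric.\<close>
      then have "of_bool (q > c2 u - fst u) + p \<le> N" "of_bool (p > c2 v - fst v) + q \<le> N"
        using s(4,5) w by (auto simp: of_bool_def)
      then have "interior_tile N (block_label N u v (p+1) q) (block_label N v u (q+1) p) (block_label N u v p q) (block_label N v u q p)"
        using 4 unfolding interior_tile_def
        by - (rule exI[of _ "of_bool (q > c2 u - fst u) + p"], rule exI[of _ "of_bool (p > c2 v - fst v) + q"],
          auto simp: block_label_def)
      then show ?thesis using interior_not_extra unfolding ext_tile_def by blast
    qed
  qed
  then show ?thesis unfolding block_def T_iff[OF n] by (simp add: t' N_def)
qed

lemma block_right:
  assumes "n \<ge> 1" "t \<in> T n" "0 \<le> q" "q < height n t"
  shows "RIGHT (block n t (width n t - 1) q) = tau_at (int n) (RIGHT t) q"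
  using T_sides(7)[OF assms(1), of "RIGHT t" "TOP t" "LEFT t" "BOTTOM t" q] assms(2-) tile_eq[of t]
  by (simp add: block_def width_def height_def algebra_simps)

lemma block_top:
  assumes "n \<ge> 1" "t \<in> T n" "0 \<le> p" "p < width n t"
  shows "TOP (block n t p (height n t - 1)) = tau_at (int n) (TOP t) p"
  using T_sides(8)[OF assms(1), of "RIGHT t" "TOP t" "LEFT t" "BOTTOM t" p] assms(2-) tile_eq[of t]
  by (simp add: block_def width_def height_def algebra_simps)

lemma block_left: "LEFT (block n t 0 q) = tau_at (int n) (LEFT t) q"
  by (simp add: block_def block_label_def)

lemma block_bottom: "BOTTOM (block n t p 0) = tau_at (int n) (BOTTOM t) p"
  by (simp add: block_def block_label_def)

lemma block_hat: "block n (hat t) p q = hat (block n t q p)"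
  by (simp add: block_def hat_def[of "(_,_)"])

lemma width_hat [simp]: "width n (hat t) = height n t" "height n (hat t) = width n t"
  by (simp_all add: width_def height_def)

subsection \<open>Every tile occurs in every configuration\<close>

definition ub :: "nat \<Rightarrow> tile \<Rightarrow> bool" where
  "ub n t \<longleftrightarrow> (\<forall>x\<in>Omega n. \<exists>p. x p = t)"

lemma ub_block:
  assumes n: "n \<ge> 1" and u: "ub n t" and p: "0 \<le> p" "p < width n t" "0 \<le> q" "q < height n t"
  shows "ub n (block n t p q)"
  unfolding ub_def
proof
  fix x assume "x \<in> Omega n"
  then obtain y C R where d: "desub n x y C R" using desub_exists[OF n] by blast
  then obtain i j where "y (i,j) = t" using u unfolding ub_def desub_def by (metis surj_pair)
  then have "x (C i + p, R j + q) = block n t p q" using d p unfolding desub_def by blast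
  then show "\<exists>p'. x p' = block n t p q" by blast
qed

lemma ub_hat:
  assumes "n \<ge> 1" "ub n t" shows "ub n (hat t)"
  unfolding ub_def
proof
  fix x assume "x \<in> Omega n"
  from flip_Omega[OF assms(1) this] obtain a b where "flip x (a,b) = t"
    using assms(2) unfolding ub_def by (metis surj_pair)
  then show "\<exists>p. x p = hat t" by (intro exI[of _ "(b,a)"]) (auto simp: flip_def)
qed

definition itile :: "int \<Rightarrow> int \<Rightarrow> tile" where "itile i j = ((1,1,i+1),(1,1,j+1),(1,1,i),(1,1,j))"
definition stile :: "nat \<Rightarrow> int \<Rightarrow> int \<Rightarrow> int \<Rightarrow> tile" where
  "stile n c i m = ((0,m,i+1),(1,1,1+c),(0,c,i),(1,1,int n+m))"
definition jtile :: "nat \<Rightarrow> int \<Rightarrow> int \<Rightarrow> int \<Rightarrow> int \<Rightarrow> tile" where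
  "jtile n k l r s = ((0,k,l),(0,r,s),(0,s,r+int n),(0,l,k+int n))"

lemmas tile_simps = itile_def stile_def jtile_def block_def block_label_def tau_at_def width_def height_def hat_def

text \<open>Every configuration has a preimage with a junction tile. The image of the latter has
  side \<open>n + 1\<close>, and since its left and bottom labels have last entry at least
  \<open>n\<close>, no counter is shifted: position \<open>(i,j)\<close> holds
  \<open>itile i j\<close>.\<close>

lemma ub_itile:
  assumes n: "n \<ge> 1" and i: "1 \<le> i" "i \<le> int n" "1 \<le> j" "j \<le> int n"
  shows "ub n (itile i j)"
  unfolding ub_def
proof
  fix x assume "x \<in> Omega n"
  then obtain y C R where d: "desub n x y C R" using desub_exists[OF n] by blast
  then have y: "y \<in> Omega n" by (simp add: desub_def)
  interpret proper_tiling "int n" "\<lambda>a b. LEFT (y (a,b))" "\<lambda>a b. BOTTOM (y (a,b))"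
    by (rule Omega_proper_tiling[OF n y])
  obtain a where a: "ctype a = 0" using zero_col by blast
  obtain b where b: "rtype b = 0" using zero_row by blast
  have "junction_tile (int n) (LEFT (y (a+1,b))) (BOTTOM (y (a,b+1))) (LEFT (y (a,b))) (BOTTOM (y (a,b)))"
    by (rule junction[OF b a])
  then obtain k l r s where *: "0 \<le> k" "0 \<le> r" "y (a,b) = jtile n k l r s"
    unfolding junction_tile_def jtile_def using Omega_tile[OF y, of a b] by metis
  have "i < width n (y (a,b))" "j < height n (y (a,b))" using i by (simp_all add: * tile_simps)
  then have "x (C a + i, R b + j) = block n (y (a,b)) i j"
    using d i unfolding desub_def by simp
  also have "\<dots> = itile i j" using * i by (auto simp: tile_simps)
  finally show "\<exists>p. x p = itile i j" by blast
qed

text \<open>\<open>itile 1 1\<close> gives \<open>jtile n 1 1 1 1\<close>, which gives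
  \<open>jtile n 0 0 0 0\<close> and the \<open>Bt\<close> tiles, whose reflections give the
  \<open>Yt\<close> tiles; then come the \<open>Gt\<close> tiles and, as corners of images and their
  reflections, the other junctions.\<close>

lemma ub_T:
  assumes n: "n \<ge> 1" and t: "t \<in> T n"
  shows "ub n t"
proof -
  note B = ub_block[OF n]
  have J1111: "ub n (jtile n 1 1 1 1)" using B[OF ub_itile[OF n, of 1 1], of 0 0] n by (simp add: tile_simps add.commute)
  have J0000: "ub n (jtile n 0 0 0 0)" using B[OF J1111, of 0 0] n by (simp add: tile_simps add.commute)
  have b: "ub n (stile n 0 i 0)" if "0 \<le> i" "i \<le> int n - 1" for i
    using B[OF J1111, of "i+1" 0] n that by (simp add: tile_simps add.commute)
  note b' = ub_hat[OF n b]
  have y: "ub n (stile n 1 i 1)" if "1 \<le> i" "i \<le> int n" for i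
    using B[OF b'[of 0], of i 0] n that by (simp add: tile_simps add.commute)
  note y' = ub_hat[OF n y]
  have g: "ub n (stile n 0 i 1)" if "0 \<le> i" "i \<le> int n" for i
  proof -
    have "i = 0 \<or> 1 \<le> i \<and> i < int n \<or> i = int n" using that by linarith
    then consider "i = 0" | "1 \<le> i" "i < int n" | "i = int n" by blast
    then show ?thesis
    proof cases
      case 1 then show ?thesis using B[OF y'[of 1], of 1 0] n by (simp add: tile_simps add.commute)
    next
      case 2 then show ?thesis using B[OF b'[of i], of i 0] n by (simp add: tile_simps add.commute)
    next
      case 3 then show ?thesis using B[OF J0000, of i 0] n by (simp add: tile_simps add.commute)
    qed
  qed
  have J0100: "ub n (jtile n 0 1 0 0)" using B[OF y[of 1], of 0 0] n by (simp add: tile_simps add.commute)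
  have J0101: "ub n (jtile n 0 1 0 1)" using B[OF g[of n], of 0 0] n by (simp add: tile_simps add.commute)
  have J0111: "ub n (jtile n 0 1 1 1)" using B[OF g[of 0], of 0 0] n by (simp add: tile_simps add.commute)
  have J0001: "ub n (jtile n 0 0 0 1)" using ub_hat[OF n J0100] by (simp add: tile_simps add.commute)
  have J1101: "ub n (jtile n 1 1 0 1)" using ub_hat[OF n J0111] by (simp add: tile_simps add.commute)
  have st: "ub n (a,b,u,v)" if s: "strip_tile (int n) a b u v" "\<not> extra (int n) u v" for a b u v
  proof -
    obtain c i m where *: "c = 0 \<or> c = 1" "m = 0 \<or> m = 1" "c \<le> i" "i \<le> int n - 1 + m"
     "a = (0,m,i+1)" "b = (1,1,1+c)" "u = (0,c,i)" "v = (1,1,int n+m)"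
      using s(1) unfolding strip_tile_def by metis
    have e: "(a,b,u,v) = stile n c i m" using * by (simp add: stile_def)
    have "c = 1 \<longrightarrow> m = 1" using s(2) * unfolding extra_def by force
    then consider "c = 0" "m = 0" | "c = 0" "m = 1" | "c = 1" "m = 1" using *(1,2) by blast
    then show ?thesis unfolding e
    proof cases
      case 1 then show "ub n (stile n c i m)" using b[of i] * by simp
    next
      case 2 then show "ub n (stile n c i m)" using g[of i] * by simp
    next
      case 3 then show "ub n (stile n c i m)" using y[of i] * by simp
    qed
  qed
  obtain a b u v where t': "t = (a,b,u,v)" by (cases t)
  have e: "ext_tile (int n) a b u v" "\<not> extra (int n) u v" using t T_iff[OF n] by (auto simp: t')
  show ?thesis using e(1) unfolding ext_tile_def
  proof (elim disjE)
    assume "interior_tile (int n) a b u v"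
    then obtain i j where "1 \<le> i" "i \<le> int n" "1 \<le> j" "j \<le> int n" "t = itile i j"
      unfolding interior_tile_def itile_def t' by blast
    then show ?thesis using ub_itile[OF n] by simp
  next
    assume "strip_tile (int n) a b u v"
    then show ?thesis using st e t' by blast
  next
    assume "strip_tile (int n) b a v u"
    then show ?thesis using ub_hat[OF n st[of b a v u]] e extra_sym by (simp add: hat_def t')
  next
    assume "junction_tile (int n) a b u v"
    then obtain k l r s where *: "0 \<le> k" "k \<le> l" "l \<le> 1" "0 \<le> r" "r \<le> s" "s \<le> 1"
      "t = jtile n k l r s" unfolding junction_tile_def jtile_def t' by blast
    have ne: "\<not> (k = 0 \<and> l = 0 \<and> r = 1 \<and> s = 1)" "\<not> (k = 1 \<and> l = 1 \<and> r = 0 \<and> s = 0)"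
      using e(2) *(7) by (auto simp: t' jtile_def extra_def)
    have "(k = 0 \<and> l = 0) \<or> (k = 0 \<and> l = 1) \<or> (k = 1 \<and> l = 1)" using *(1-3) by linarith
    moreover have "(r = 0 \<and> s = 0) \<or> (r = 0 \<and> s = 1) \<or> (r = 1 \<and> s = 1)" using *(4-6) by linarith
    ultimately show ?thesis unfolding *(7)
      using ne J0000 J0001 J0100 J0101 J0111 J1101 J1111 by (elim disjE conjE) simp_all
  qed
qed

section \<open>Determinism in both diagonal directions\<close>

lemma ext_tile_kind:
  assumes "ext_tile n a b u v"
  shows "fst u = 1 \<Longrightarrow> fst v = 1 \<Longrightarrow> interior_tile n a b u v"
    "fst u = 0 \<Longrightarrow> fst v = 1 \<Longrightarrow> strip_tile n a b u v"
    "fst u = 1 \<Longrightarrow> fst v = 0 \<Longrightarrow> strip_tile n b a v u"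
    "fst u = 0 \<Longrightarrow> fst v = 0 \<Longrightarrow> junction_tile n a b u v"
    "fst u = 0 \<or> fst u = 1" "fst v = 0 \<or> fst v = 1"
  using assms unfolding ext_tile_def by (auto dest: tile_fst)

text \<open>For given types of row and column, all parameters of the shape can be read off the left
  and bottom labels, and also off the right and top labels.\<close>

lemma ext_tile_determ:
  assumes e: "ext_tile n a b u v" "ext_tile n a' b' u' v'" and f: "fst u = fst u'" "fst v = fst v'"
  shows "u = u' \<and> v = v' \<longleftrightarrow> a = a' \<and> b = b'"
proof -
  note k = ext_tile_kind[OF e(1)] and k' = ext_tile_kind[OF e(2), folded f]
  consider "fst u = 1" "fst v = 1" | "fst u = 0" "fst v = 1" | "fst u = 1" "fst v = 0" | "fst u = 0" "fst v = 0"
    using k(5,6) by blast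
  then show ?thesis
  proof cases
    case 1 then show ?thesis using k(1)[OF 1] k'(1)[OF 1] unfolding interior_tile_def by (elim exE conjE) simp
  next
    case 2 then show ?thesis using k(2)[OF 2] k'(2)[OF 2] unfolding strip_tile_def by (elim exE conjE) auto
  next
    case 3 then show ?thesis using k(3)[OF 3] k'(3)[OF 3] unfolding strip_tile_def by (elim exE conjE) auto
  next
    case 4 then show ?thesis using k(4)[OF 4] k'(4)[OF 4] unfolding junction_tile_def by (elim exE conjE) auto
  qed
qed

lemma T_determ:
  assumes "n \<ge> 1" "s \<in> T n" "t \<in> T n"
  shows "LEFT s = LEFT t \<Longrightarrow> BOTTOM s = BOTTOM t \<Longrightarrow> s = t"
    "RIGHT s = RIGHT t \<Longrightarrow> TOP s = TOP t \<Longrightarrow> s = t"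
proof -
  obtain a b u v where s: "s = (a,b,u,v)" by (cases s)
  obtain a' b' u' v' where t: "t = (a',b',u',v')" by (cases t)
  note e = assms(2,3)[unfolded s t T_iff[OF assms(1)]]
  note d = ext_tile_determ[OF conjunct1[OF e(1)] conjunct1[OF e(2)]]
  show "LEFT s = LEFT t \<Longrightarrow> BOTTOM s = BOTTOM t \<Longrightarrow> s = t" using d by (simp add: s t)
  show "RIGHT s = RIGHT t \<Longrightarrow> TOP s = TOP t \<Longrightarrow> s = t"
    using d ext_tile_fst[OF conjunct1[OF e(1)]] ext_tile_fst[OF conjunct1[OF e(2)]] by (simp add: s t)
qed

subsection \<open>Dominoes and quads\<close>

definition ud :: "nat \<Rightarrow> tile \<Rightarrow> tile \<Rightarrow> bool" where
  "ud n s t \<longleftrightarrow> (\<forall>x\<in>Omega n. \<exists>a b. x (a,b) = s \<and> x (a+1,b) = t)"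

definition uq :: "nat \<Rightarrow> tile \<Rightarrow> tile \<Rightarrow> tile \<Rightarrow> tile \<Rightarrow> bool" where
  "uq n s t s' t' \<longleftrightarrow>
     (\<forall>x\<in>Omega n. \<exists>a b. x (a,b) = s \<and> x (a+1,b) = t \<and> x (a,b+1) = s' \<and> x (a+1,b+1) = t')"

text \<open>The tile at position \<open>(p, q)\<close> of the image of the pattern with bottom row \<open>s t\<close> and
  top row \<open>s' t'\<close>, as long as this position is at most one step outside of the block of \<open>s\<close>.\<close>

definition quad_image :: "nat \<Rightarrow> tile \<Rightarrow> tile \<Rightarrow> tile \<Rightarrow> tile \<Rightarrow> int \<Rightarrow> int \<Rightarrow> tile" where
  "quad_image n s t s' t' p q = block n
     (if p < width n s then if q < height n s then s else s' else if q < height n s then t else t')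
     (if p < width n s then p else 0) (if q < height n s then q else 0)"

lemma desub_block:
  "desub n x y C R \<Longrightarrow> 0 \<le> p \<Longrightarrow> p < width n (y (i,j)) \<Longrightarrow> 0 \<le> q \<Longrightarrow> q < height n (y (i,j)) \<Longrightarrow>
     x (C i + p, R j + q) = block n (y (i,j)) p q"
  unfolding desub_def by blast

lemma desub_C: "desub n x y C R \<Longrightarrow> C (i+1) = C i + width n (y (i,j))"
  unfolding desub_def by blast

lemma desub_R: "desub n x y C R \<Longrightarrow> R (j+1) = R j + height n (y (i,j))"
  unfolding desub_def by blast

abbreviation image_at :: "nat \<Rightarrow> config \<Rightarrow> int \<Rightarrow> int \<Rightarrow> int \<Rightarrow> int \<Rightarrow> tile" where
  "image_at n y i j \<equiv> quad_image n (y (i,j)) (y (i+1,j)) (y (i,j+1)) (y (i+1,j+1))"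

lemma desub_quad:
  assumes n: "n \<ge> 1" and d: "desub n x y C R"
    and p: "0 \<le> p" "p \<le> width n (y (i,j))" "0 \<le> q" "q \<le> height n (y (i,j))"
  shows "x (C i + p, R j + q) = image_at n y i j p q"
proof -
  define i' where "i' = (if p < width n (y (i,j)) then i else i+1)"
  define j' where "j' = (if q < height n (y (i,j)) then j else j+1)"
  define p' where "p' = (if p < width n (y (i,j)) then p else 0)"
  define q' where "q' = (if q < height n (y (i,j)) then q else 0)"
  have w: "width n (y (i,j')) = width n (y (i,j))" for j' using desub_C[OF d, of i] by (metis add_left_cancel)
  have h: "height n (y (i',j)) = height n (y (i,j))" for i' using desub_R[OF d, of j] by (metis add_left_cancel)
  have y: "y \<in> Omega n" using d by (simp add: desub_def)
  have "C i' + p' = C i + p" "R j' + q' = R j + q"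
    using p desub_C[OF d, of i j] desub_R[OF d, of j i] by (auto simp: i'_def p'_def j'_def q'_def)
  moreover have "p' < width n (y (i',j'))" "q' < height n (y (i',j'))"
    using width_bounds[OF n y, of "(i',j')"] w[of j'] h[of i'] n by (auto simp: p'_def q'_def i'_def j'_def)
  moreover have "0 \<le> p'" "0 \<le> q'" using p by (auto simp: p'_def q'_def)
  ultimately have "x (C i + p, R j + q) = block n (y (i',j')) p' q'"
    using desub_block[OF d, of p' i' j' q'] by simp
  also have "\<dots> = image_at n y i j p q"
    by (auto simp: quad_image_def i'_def j'_def p'_def q'_def)
  finally show ?thesis .
qed

lemma window_image:
  assumes n: "n \<ge> 1" and x: "x \<in> Omega n"
  obtains y i j p q where "y \<in> Omega n" "0 \<le> p" "p < width n (y (i,j))" "0 \<le> q" "q < height n (y (i,j))"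
    "\<And>c d. 0 \<le> c \<Longrightarrow> c \<le> 1 \<Longrightarrow> 0 \<le> d \<Longrightarrow> d \<le> 1 \<Longrightarrow>
      x (a+c,b+d) = image_at n y i j (p+c) (q+d)"
proof -
  obtain y C R where d: "desub n x y C R" using desub_exists[OF n x] by blast
  have y: "y \<in> Omega n" using d by (simp add: desub_def)
  obtain i where i: "C i \<le> a" "a < C (i+1)" using locate[of C a] desub_mono[OF n d] by blast
  obtain j where j: "R j \<le> b" "b < R (j+1)" using locate[of R b] desub_mono[OF n d] by blast
  define p q where "p = a - C i" and "q = b - R j"
  have p: "0 \<le> p" "p < width n (y (i,j))" "0 \<le> q" "q < height n (y (i,j))"
    using i j desub_C[OF d, of i j] desub_R[OF d, of j i] by (auto simp: p_def q_def)
  show thesis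
  proof (rule that[OF y p])
    fix c d' :: int assume c: "0 \<le> c" "c \<le> 1" "0 \<le> d'" "d' \<le> 1"
    have e: "C i + (p + c) = a + c" "R j + (q + d') = b + d'" by (simp_all add: p_def q_def)
    show "x (a+c,b+d') = image_at n y i j (p+c) (q+d')"
      using desub_quad[OF n d, of "p+c" i j "q+d'"] c p unfolding e by simp
  qed
qed

lemma uq_image:
  assumes n: "n \<ge> 1" and u: "uq n s t s' t'" and p: "0 \<le> p" "p < width n s" "0 \<le> q" "q < height n s"
  shows "uq n (quad_image n s t s' t' p q) (quad_image n s t s' t' (p+1) q)
     (quad_image n s t s' t' p (q+1)) (quad_image n s t s' t' (p+1) (q+1))"
  unfolding uq_def
proof
  fix x assume "x \<in> Omega n"
  then obtain y C R where d: "desub n x y C R" using desub_exists[OF n] by blast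
  then obtain i j where y: "y (i,j) = s \<and> y (i+1,j) = t \<and> y (i,j+1) = s' \<and> y (i+1,j+1) = t'"
    using u unfolding uq_def desub_def by metis
  note q = desub_quad[OF n d, of _ i j, unfolded conjunct1[OF y] conjunct2[OF y, THEN conjunct1] conjunct2[OF y, THEN conjunct2, THEN conjunct1]
    conjunct2[OF y, THEN conjunct2, THEN conjunct2]]
  show "\<exists>a b. x (a,b) = quad_image n s t s' t' p q \<and> x (a+1,b) = quad_image n s t s' t' (p+1) q \<and>
     x (a,b+1) = quad_image n s t s' t' p (q+1) \<and> x (a+1,b+1) = quad_image n s t s' t' (p+1) (q+1)"
    using q[of p q] q[of "p+1" q] q[of p "q+1"] q[of "p+1" "q+1"] p
    by (intro exI[of _ "C i + p"] exI[of _ "R j + q"]) (simp add: add.assoc)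
qed

lemma uq_corner:
  assumes n: "n \<ge> 1" and u: "uq n s t s' t'" and s: "s \<in> T n"
  shows "uq n (block n s (width n s - 1) (height n s - 1)) (block n t 0 (height n s - 1))
     (block n s' (width n s - 1) 0) (block n t' 0 0)"
proof -
  have "0 < width n s" "0 < height n s"
    using T_sides(1)[OF n, of "RIGHT s" "TOP s" "LEFT s" "BOTTOM s"] s tile_eq[of s] n
    by (auto simp: good_def width_def height_def)
  then show ?thesis using uq_image[OF n u, of "width n s - 1" "height n s - 1"] by (simp add: quad_image_def)
qed

lemma T_width_pos:
  assumes "n \<ge> 1" "s \<in> T n"
  shows "int n \<le> width n s" "int n \<le> height n s"
  using T_sides(1)[OF assms(1), of "RIGHT s" "TOP s" "LEFT s" "BOTTOM s"] assms tile_eq[of s]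
  by (auto simp: good_def width_def height_def)

lemma ub_desub:
  assumes "n \<ge> 1" "ub n t" "x \<in> Omega n"
  obtains y C R i j where "desub n x y C R" "y (i,j) = t"
  using assms desub_exists[OF assms(1,3)] unfolding ub_def desub_def by (metis surj_pair)

lemma uq_interior:
  assumes n: "n \<ge> 1" and t: "t \<in> T n" and p: "0 \<le> p" "p + 1 < width n t" "0 \<le> q" "q + 1 < height n t"
  shows "uq n (block n t p q) (block n t (p+1) q) (block n t p (q+1)) (block n t (p+1) (q+1))"
  unfolding uq_def
proof
  fix x assume "x \<in> Omega n"
  then obtain y C R i j where d: "desub n x y C R" "y (i,j) = t" using ub_desub[OF n ub_T[OF n t]] by metis
  note q = desub_block[OF d(1), of _ i j, unfolded d(2)]
  show "\<exists>a b. x (a,b) = block n t p q \<and> x (a+1,b) = block n t (p+1) q \<and>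
     x (a,b+1) = block n t p (q+1) \<and> x (a+1,b+1) = block n t (p+1) (q+1)"
    using q[of p q] q[of "p+1" q] q[of p "q+1"] q[of "p+1" "q+1"] p
    by (intro exI[of _ "C i + p"] exI[of _ "R j + q"]) (simp add: add.assoc)
qed

lemma ud_interior:
  assumes n: "n \<ge> 1" and t: "t \<in> T n" and p: "0 \<le> p" "p + 1 < width n t" "0 \<le> q" "q < height n t"
  shows "ud n (block n t p q) (block n t (p+1) q)"
  unfolding ud_def
proof
  fix x assume "x \<in> Omega n"
  then obtain y C R i j where d: "desub n x y C R" "y (i,j) = t" using ub_desub[OF n ub_T[OF n t]] by metis
  note q = desub_block[OF d(1), of _ i j, unfolded d(2)]
  show "\<exists>a b. x (a,b) = block n t p q \<and> x (a+1,b) = block n t (p+1) q"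
    using q[of p q] q[of "p+1" q] p
    by (intro exI[of _ "C i + p"] exI[of _ "R j + q"]) (simp add: add.assoc)
qed

lemma ud_desub:
  assumes "n \<ge> 1" "ud n s t" "x \<in> Omega n"
  obtains y C R i j where "desub n x y C R" "y (i,j) = s" "y (i+1,j) = t"
  using assms desub_exists[OF assms(1,3)] unfolding ud_def desub_def by metis

lemma ud_edge:
  assumes n: "n \<ge> 1" and u: "ud n s t" and s: "s \<in> T n" and q: "0 \<le> q" "q < height n s"
  shows "ud n (block n s (width n s - 1) q) (block n t 0 q)"
  unfolding ud_def
proof
  fix x assume "x \<in> Omega n"
  then obtain y C R i j where d: "desub n x y C R" "y (i,j) = s" "y (i+1,j) = t" using ud_desub[OF n u] by metis
  note e = desub_quad[OF n d(1), of _ i j, unfolded d(2,3)]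
  show "\<exists>a b. x (a,b) = block n s (width n s - 1) q \<and> x (a+1,b) = block n t 0 q"
    using e[of "width n s - 1" q] e[of "width n s" q] q T_width_pos[OF n s] n
    by (intro exI[of _ "C i + (width n s - 1)"] exI[of _ "R j + q"]) (simp add: add.assoc quad_image_def)
qed

lemma uq_edge:
  assumes n: "n \<ge> 1" and u: "ud n s t" and s: "s \<in> T n" and q: "0 \<le> q" "q + 1 < height n s"
  shows "uq n (block n s (width n s - 1) q) (block n t 0 q) (block n s (width n s - 1) (q+1)) (block n t 0 (q+1))"
  unfolding uq_def
proof
  fix x assume "x \<in> Omega n"
  then obtain y C R i j where d: "desub n x y C R" "y (i,j) = s" "y (i+1,j) = t" using ud_desub[OF n u] by metis
  note e = desub_quad[OF n d(1), of _ i j, unfolded d(2,3)]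
  show "\<exists>a b. x (a,b) = block n s (width n s - 1) q \<and> x (a+1,b) = block n t 0 q \<and>
    x (a,b+1) = block n s (width n s - 1) (q+1) \<and> x (a+1,b+1) = block n t 0 (q+1)"
    using e[of "width n s - 1" q] e[of "width n s" q] e[of "width n s - 1" "q+1"] e[of "width n s" "q+1"]
      q T_width_pos[OF n s] n
    by (intro exI[of _ "C i + (width n s - 1)"] exI[of _ "R j + q"]) (simp add: add.assoc quad_image_def)
qed

lemma uq_flip:
  assumes "n \<ge> 1" "uq n s t s' t'"
  shows "uq n (hat s) (hat s') (hat t) (hat t')"
  unfolding uq_def
proof
  fix x assume "x \<in> Omega n"
  from flip_Omega[OF assms(1) this] obtain a b where
    "flip x (a,b) = s" "flip x (a+1,b) = t" "flip x (a,b+1) = s'" "flip x (a+1,b+1) = t'"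
    using assms(2) unfolding uq_def by blast
  then show "\<exists>a b. x (a,b) = hat s \<and> x (a+1,b) = hat s' \<and> x (a,b+1) = hat t \<and> x (a+1,b+1) = hat t'"
    by (intro exI[of _ b] exI[of _ a]) (auto simp: flip_def)
qed

subsection \<open>Horizontal dominoes\<close>

text \<open>The parameters of a domino on which the tiles along the vertical boundary inside its image depend.\<close>

definition dclass :: "nat \<Rightarrow> tile \<Rightarrow> tile \<Rightarrow> label \<Rightarrow> int \<Rightarrow> label \<Rightarrow> bool" where
  "dclass n s t a f l \<longleftrightarrow> s \<in> T n \<and> t \<in> T n \<and> RIGHT s = a \<and> LEFT t = a \<and>
     f = of_bool (c2 (BOTTOM s) \<le> int n - 1) \<and> l = tau_at (int n) (BOTTOM t) 0"

text \<open>Together with \<open>next_l\<close>, the parameters of the boundary domino at height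
  \<open>q\<close> of the image. At \<open>q = 0\<close> the bottom label of its left tile has last
  entry at least \<open>n\<close>, so the indicator is reset to 0.\<close>

definition next_f :: "nat \<Rightarrow> int \<Rightarrow> int \<Rightarrow> int" where
  "next_f n f q = (if q = 0 then 0 else of_bool (f + q \<le> int n - 1))"

definition next_l :: "nat \<Rightarrow> label \<Rightarrow> label \<Rightarrow> int \<Rightarrow> label" where
  "next_l n a l q = (if q = 0 then tau_at (int n) l 0
     else (0, 1 - of_bool (q > c2 a - fst a), int n + of_bool (q = c1 a - fst a)))"

lemma T_rows:
  assumes "n \<ge> 1" "s \<in> T n"
  shows "fst (RIGHT s) = fst (LEFT s)" "fst (TOP s) = fst (BOTTOM s)" "good (int n) (RIGHT s)" "good (int n) (TOP s)"
    "good (int n) (LEFT s)" "good (int n) (BOTTOM s)"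
  using T_sides[OF assms(1), of "RIGHT s" "TOP s" "LEFT s" "BOTTOM s"] assms(2) tile_eq[of s] by auto

lemma dclass_edge_tiles:
  assumes n: "n \<ge> 2" and c: "dclass n s t a f l" and q: "0 \<le> q" "q < int n + 1 - fst a"
  defines "e \<equiv> block n s (width n s - 1) q" and "e' \<equiv> block n t 0 q"
  shows "e \<in> T n" "e' \<in> T n" "RIGHT e = tau_at (int n) a q" "LEFT e' = tau_at (int n) a q"
    "TOP e = (1, 1, f + q + 1)" "if q = 0 then c2 (BOTTOM e) \<ge> int n else BOTTOM e = (1, 1, f + q)"
    "BOTTOM e' = (if q = 0 then l else (0, of_bool (q > c2 a - fst a), fst a - c1 a + q))"
proof -
  have n1: "n \<ge> 1" using n by simp
  have s: "s \<in> T n" "t \<in> T n" "RIGHT s = a" "LEFT t = a" using c by (auto simp: dclass_def)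
  have h: "height n s = int n + 1 - fst a" "height n t = int n + 1 - fst a"
    using T_rows(1)[OF n1 s(1)] s by (simp_all add: height_def)
  have w: "width n s \<ge> 2" "width n t \<ge> 2" using T_width_pos(1)[OF n1 s(1)] T_width_pos(1)[OF n1 s(2)] n by linarith+
  show "e \<in> T n" "e' \<in> T n" unfolding e_def e'_def
    using block_T[OF n1 s(1), of "width n s - 1" q] block_T[OF n1 s(2), of 0 q] q h w by auto
  show "RIGHT e = tau_at (int n) a q" unfolding e_def using block_right[OF n1 s(1) q(1)] q h s by simp
  show "LEFT e' = tau_at (int n) a q" unfolding e'_def block_left s(4) ..
  have f: "f = of_bool (c2 (BOTTOM s) \<le> int n - 1)" using c by (simp add: dclass_def)
  have g: "good (int n) (BOTTOM s)" using T_rows[OF n1 s(1)] by blast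
  show "TOP e = (1, 1, f + q + 1)" using w q f by (auto simp: e_def block_def block_label_def width_def)
  show "if q = 0 then c2 (BOTTOM e) \<ge> int n else BOTTOM e = (1, 1, f + q)"
    using w q f by (auto simp: e_def block_def block_label_def width_def tau_at_def)
  show "BOTTOM e' = (if q = 0 then l else (0, of_bool (q > c2 a - fst a), fst a - c1 a + q))"
    using c q s by (auto simp: e'_def block_def block_label_def dclass_def)
qed

text \<open>The class of a boundary domino of the image is a function of the class one level higher
  and of \<open>q\<close>, so that domino classes form a transition system.\<close>

lemma dclass_edge:
  assumes n: "n \<ge> 2" and c: "dclass n s t a f l" and q: "0 \<le> q" "q < int n + 1 - fst a"
  shows "dclass n (block n s (width n s - 1) q) (block n t 0 q) (tau_at (int n) a q) (next_f n f q) (next_l n a l q)"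
proof -
  note e = dclass_edge_tiles[OF assms]
  have f: "next_f n f q = of_bool (c2 (BOTTOM (block n s (width n s - 1) q)) \<le> int n - 1)"
  proof (cases "q = 0")
    case True
    then show ?thesis using e(6) c by (auto simp: next_f_def dclass_def)
  next
    case False
    then show ?thesis using e(6) by (simp add: next_f_def)
  qed
  have l: "next_l n a l q = tau_at (int n) (BOTTOM (block n t 0 q)) 0"
    using q e(7) by (cases "q = 0") (auto simp: next_l_def tau_at_def)
  show ?thesis using e(1-4) f l by (simp add: dclass_def)
qed

text \<open>The left tile is recovered from its right and top labels, the right tile from its left
  and bottom labels, and the class fixes these four.\<close>

lemma dclass_determ:
  assumes n: "n \<ge> 2" and c: "dclass n s t a f l" "dclass n s' t' a f l" and q: "0 \<le> q" "q < int n + 1 - fst a"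
  shows "block n s (width n s - 1) q = block n s' (width n s' - 1) q" "block n t 0 q = block n t' 0 q"
proof -
  have n1: "n \<ge> 1" using n by simp
  note e = dclass_edge_tiles[OF n c(1) q] and e' = dclass_edge_tiles[OF n c(2) q]
  show "block n s (width n s - 1) q = block n s' (width n s' - 1) q"
    using T_determ(2)[OF n1 e(1) e'(1)] e(3,5) e'(3,5) by simp
  show "block n t 0 q = block n t' 0 q"
    using T_determ(1)[OF n1 e(2) e'(2)] e(4,7) e'(4,7) by simp
qed

lemma jtile_T:
  assumes "n \<ge> 1" shows "jtile n 0 0 0 0 \<in> T n" "jtile n 1 1 1 1 \<in> T n"
  using assms by (auto simp: T_iff ext_tile_def jtile_def extra_def junction_tile_def)

lemma itile_T:
  assumes "n \<ge> 1" "1 \<le> i" "i \<le> int n" "1 \<le> j" "j \<le> int n" shows "itile i j \<in> T n"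
  using assms by (auto simp: T_iff ext_tile_def itile_def extra_def interior_tile_def)

definition uclass :: "nat \<Rightarrow> label \<Rightarrow> int \<Rightarrow> label \<Rightarrow> bool" where
  "uclass n a f l \<longleftrightarrow> (\<exists>s t. ud n s t \<and> dclass n s t a f l)"

lemma uclass_step:
  assumes "n \<ge> 2" "uclass n a f l" "0 \<le> q" "q < int n + 1 - fst a"
  shows "uclass n (tau_at (int n) a q) (next_f n f q) (next_l n a l q)"
proof -
  obtain s t where st: "ud n s t" "dclass n s t a f l" using assms(2) by (auto simp: uclass_def)
  have "s \<in> T n" "height n s = int n + 1 - fst a"
    using st(2) T_rows(1)[of n s] assms(1) by (auto simp: dclass_def height_def)
  then have "ud n (block n s (width n s - 1) q) (block n t 0 q)"
    using ud_edge[of n s t q] st assms by simp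
  then show ?thesis using dclass_edge[OF assms(1) st(2) assms(3,4)] unfolding uclass_def by blast
qed

text \<open>A list that contains every class after two boundary steps (the first one leads into
  \<open>boundary_class\<close>) and is short enough for each member to be realised by a domino
  occurring everywhere.\<close>

definition deep_class :: "nat \<Rightarrow> label \<Rightarrow> int \<Rightarrow> label \<Rightarrow> bool" where
  "deep_class n a f l \<longleftrightarrow> a = (1,1,int n) \<and> f = 1 \<and> l = (0,1,int n+1) \<or>
     (a = (1,1,int n) \<or> a = (1,1,int n+1)) \<and> (f = 0 \<or> f = 1) \<and> l = (0,1,int n) \<or>
     (a = (0,0,int n) \<or> a = (0,1,int n)) \<and> f = 0 \<and> (l = (0,0,int n) \<or> l = (0,1,int n))"

text \<open>The seeds are dominoes inside the images of \<open>jtile n 0 0 0 0\<close> and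
  \<open>jtile n 1 1 1 1\<close>; the other classes are reached by transitions.\<close>

lemma deep_class_uclass:
  assumes n: "n \<ge> 2" and d: "deep_class n a f l"
  shows "uclass n a f l"
proof -
  have n1: "n \<ge> 1" using n by simp
  define N where "N = int n"
  have N: "N \<ge> 2" using n by (simp add: N_def)
  note step = uclass_step[OF n, folded N_def]
  note jT = jtile_T[OF n1] and iT = itile_T[OF n1, folded N_def]
  have ww: "uclass n (1,1,N) (of_bool (j \<le> N - 1)) (tau_at N (1,1,j) 0)" if "1 \<le> j" "j \<le> N" for j
    unfolding uclass_def
  proof (intro exI conjI)
    show "ud n (itile (N-1) j) (itile N j)"
      using ud_interior[OF n1 jT(1), of "N-1" j] that N by (auto simp: tile_simps N_def)
    show "dclass n (itile (N-1) j) (itile N j) (1,1,N) (of_bool (j \<le> N - 1)) (tau_at N (1,1,j) 0)"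
      using iT[of "N-1" j] iT[of N j] that N by (auto simp: dclass_def itile_def N_def)
  qed
  have k1: "uclass n (1,1,N) 0 (0,1,N)" using ww[of N] N by (simp add: tau_at_def)
  have k2: "uclass n (1,1,N) 1 (0,1,N+1)" using ww[of 1] N by (simp add: tau_at_def)
  have k3: "uclass n (1,1,N+1) 1 (0,1,N)"
    using step[OF k1, of "N-1"] N by (simp add: tau_at_def next_f_def next_l_def N_def)
  have k4: "uclass n (1,1,N+1) 0 (0,1,N)"
    using step[OF k2, of "N-1"] N by (simp add: tau_at_def next_f_def next_l_def N_def)
  have k5: "uclass n (1,1,N) 1 (0,1,N)"
    using step[OF k4, of 1] N by (simp add: tau_at_def next_f_def next_l_def N_def)
  have k6: "uclass n (0,1,N) 0 (0,0,N)"
    using step[OF k1, of 0] N by (simp add: tau_at_def next_f_def next_l_def N_def)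
  have k7: "uclass n (0,0,N) 0 (0,1,N)"
    using step[OF k6, of 0] N by (simp add: tau_at_def next_f_def next_l_def N_def)
  \<comment> \<open>The label \<open>(1,1,1)\<close> has threshold 0, so position 1 is past it and
    \<open>l\<close> becomes \<open>(0,0,N)\<close>, the input for \<open>k8\<close>. The value
    \<open>f'\<close> obtained on the way is forgotten at the next position 0.\<close>
  have hw: "uclass n (1,1,1) 1 (0,1,N+1)"
    unfolding uclass_def
  proof (intro exI conjI)
    show "ud n (block n (jtile n 1 1 1 1) 0 1) (itile 1 1)"
      using ud_interior[OF n1 jT(2), of 0 1] N by (auto simp: tile_simps N_def)
    show "dclass n (block n (jtile n 1 1 1 1) 0 1) (itile 1 1) (1,1,1) 1 (0,1,N+1)"
      using block_T[OF n1 jT(2), of 0 1] iT[of 1 1] N by (auto simp: dclass_def tile_simps N_def)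
  qed
  obtain f' where f': "uclass n (1,1,N+1) f' (0,0,N)"
    using step[OF hw, of 1] N by (simp add: tau_at_def next_f_def next_l_def N_def)
  have k8: "uclass n (0,1,N) 0 (0,1,N)"
    using step[OF f', of 0] N by (simp add: tau_at_def next_f_def next_l_def N_def)
  have k9: "uclass n (0,0,N) 0 (0,0,N)"
    using step[OF k8, of 0] N by (simp add: tau_at_def next_f_def next_l_def N_def)
  show ?thesis using d k1 k2 k3 k4 k5 k6 k7 k8 k9 unfolding deep_class_def N_def[symmetric]
    by (elim disjE conjE) simp_all
qed

text \<open>The shared label of a boundary domino is a letter of a word of \<open>tau\<close>, which
  explains the two cases: a letter at a positive position, or letter 0, where moreover
  \<open>f = 0\<close>.\<close>

definition boundary_class :: "nat \<Rightarrow> label \<Rightarrow> int \<Rightarrow> label \<Rightarrow> bool" where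
  "boundary_class n a f l \<longleftrightarrow> (f = 0 \<or> f = 1) \<and>
     ((\<exists>m k i. (m = 0 \<or> m = 1) \<and> a = (1,1,int n+m) \<and> (k = 0 \<or> k = 1) \<and> (i = 0 \<or> i = 1) \<and> l = (0,i,int n+k)) \<or>
      (\<exists>c m i. (c = 0 \<or> c = 1) \<and> (m = 0 \<or> m = 1) \<and> (m = 1 \<longrightarrow> c = 1) \<and> a = (0,c,int n+m) \<and> f = 0 \<and>
         (i = 0 \<or> i = 1) \<and> l = (0,i,int n)))"

lemma boundary_class_step:
  assumes n: "n \<ge> 2" and c: "dclass n s t a f l" and q: "0 \<le> q" "q < int n + 1 - fst a"
  shows "boundary_class n (tau_at (int n) a q) (next_f n f q) (next_l n a l q)"
proof -
  have n1: "n \<ge> 1" using n by simp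
  have s: "s \<in> T n" "t \<in> T n" "RIGHT s = a" "LEFT t = a" "l = tau_at (int n) (BOTTOM t) 0"
    using c by (auto simp: dclass_def)
  have g: "good (int n) a" "good (int n) (BOTTOM t)" using T_rows[OF n1 s(1)] T_rows[OF n1 s(2)] s by auto
  have f: "next_f n f q = 0 \<or> next_f n f q = 1" by (auto simp: next_f_def)
  show ?thesis
  proof (cases "q = 0")
    case True
    have "\<exists>i k. (i = 0 \<or> i = 1) \<and> (k = 0 \<or> k = 1) \<and> l = (0, i, int n + k)" using g(2) unfolding s(5) tau_at_def good_def
      by (intro exI[of _ "fst (BOTTOM t) - c1 (BOTTOM t) + 1"] exI[of _ "of_bool (fst (BOTTOM t) = c2 (BOTTOM t))"]) auto
    then obtain i k where i: "i = 0 \<or> i = 1" "k = 0 \<or> k = 1" "l = (0,i,int n+k)" by blast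
    have nl: "next_l n a l q = (0, 1 - i, int n)" using i n True by (auto simp: next_l_def tau_at_def)
    have "\<exists>c m. (c = 0 \<or> c = 1) \<and> (m = 0 \<or> m = 1) \<and> (m = 1 \<longrightarrow> c = 1) \<and> tau_at (int n) a q = (0,c,int n+m)"
      using g(1) unfolding tau_at_def good_def
      by (intro exI[of _ "fst a - c1 a + 1"] exI[of _ "of_bool (fst a = c2 a)"]) (auto simp: True)
    then obtain c m where "(c = 0 \<or> c = 1) \<and> (m = 0 \<or> m = 1) \<and> (m = 1 \<longrightarrow> c = 1) \<and> tau_at (int n) a q = (0,c,int n+m)"
      by blast
    moreover have "1 - i = 0 \<or> 1 - i = 1" using i by auto
    moreover have "next_f n f q = 0" by (simp add: True next_f_def)
    ultimately show ?thesis using nl unfolding boundary_class_def by blast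
  next
    case False
    then show ?thesis using f unfolding boundary_class_def
      by - (rule conjI, assumption, rule disjI1, rule exI[of _ "of_bool (q \<ge> c2 a - fst a)"],
        rule exI[of _ "of_bool (q = c1 a - fst a)"], rule exI[of _ "1 - of_bool (q > c2 a - fst a)"],
        simp add: tau_at_def next_l_def)
  qed
qed

lemma deep_class_step:
  assumes n: "n \<ge> 2" and b: "boundary_class n a f l" and q: "0 \<le> q" "q < int n + 1 - fst a"
  shows "deep_class n (tau_at (int n) a q) (next_f n f q) (next_l n a l q)"
  using b[unfolded boundary_class_def] n q
  by (elim conjE disjE exE) (auto simp: deep_class_def tau_at_def next_f_def next_l_def)

lemma domino_cases:
  assumes n: "n \<ge> 1" and x: "x \<in> Omega n"
  obtains "ud n (x (a,b)) (x (a+1,b))"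
  | y i j q where "y \<in> Omega n" "0 \<le> q" "q < height n (y (i,j))"
     "x (a,b) = block n (y (i,j)) (width n (y (i,j)) - 1) q" "x (a+1,b) = block n (y (i+1,j)) 0 q"
proof (rule window_image[OF n x, where a = a and b = b])
  fix y i j p q assume y: "y \<in> Omega n" and p: "0 \<le> p" "p < width n (y (i,j))" "0 \<le> q" "q < height n (y (i,j))"
    and e: "\<And>c d. 0 \<le> c \<Longrightarrow> c \<le> 1 \<Longrightarrow> 0 \<le> d \<Longrightarrow> d \<le> 1 \<Longrightarrow> x (a+c,b+d) = image_at n y i j (p+c) (q+d)"
  note e = e[of 0 0, simplified] e[of 1 0, simplified]
  have yT: "y (i,j) \<in> T n" using y by (simp add: Omega_def)
  show thesis
  proof (cases "p + 1 < width n (y (i,j))")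
    case True
    then show thesis using that(1) ud_interior[OF n yT, of p q] p e by (simp add: quad_image_def)
  next
    case False
    then have "p = width n (y (i,j)) - 1" using p by simp
    then show thesis using that(2)[OF y p(3,4)] e p by (simp add: quad_image_def)
  qed
qed

lemma Omega_dclass:
  assumes "y \<in> Omega n"
  obtains f l where "dclass n (y (i,j)) (y (i+1,j)) (RIGHT (y (i,j))) f l"
  using assms by (auto simp: dclass_def Omega_def)

text \<open>Three successive preimages are taken. If the domino lies on a boundary at each level,
  its class in the first preimage is deep, so a domino occurring everywhere has the same class and,
  by \<open>dclass_determ\<close>, the same boundary tiles in its image.\<close>

lemma ud_Omega:
  assumes n: "n \<ge> 2" and x: "x \<in> Omega n"
  shows "ud n (x (a,b)) (x (a+1,b))"
proof -
  have n1: "n \<ge> 1" using n by simp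
  have h: "height n (y p) = int n + 1 - fst (RIGHT (y p))" if "y \<in> Omega n" for y p
    using T_rows(1)[OF n1, of "y p"] that by (cases p) (auto simp: Omega_def height_def)
  have t: "y p \<in> T n" if "y \<in> Omega n" for y p using that by (cases p) (simp add: Omega_def)
  show ?thesis
  proof (rule domino_cases[OF n1 x, of a b])
    fix y i j q assume y: "y \<in> Omega n" and q: "0 \<le> q" "q < height n (y (i,j))"
      and e: "x (a,b) = block n (y (i,j)) (width n (y (i,j)) - 1) q" "x (a+1,b) = block n (y (i+1,j)) 0 q"
    have "ud n (y (i,j)) (y (i+1,j)) \<or>
      (\<exists>s t f l. ud n s t \<and> dclass n s t (RIGHT (y (i,j))) f l \<and> dclass n (y (i,j)) (y (i+1,j)) (RIGHT (y (i,j))) f l)"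
    proof (rule domino_cases[OF n1 y, of i j])
      fix y1 i1 j1 q1 assume y1: "y1 \<in> Omega n" and q1: "0 \<le> q1" "q1 < height n (y1 (i1,j1))"
        and e1: "y (i,j) = block n (y1 (i1,j1)) (width n (y1 (i1,j1)) - 1) q1" "y (i+1,j) = block n (y1 (i1+1,j1)) 0 q1"
      show ?thesis
      proof (rule domino_cases[OF n1 y1, of i1 j1])
        assume "ud n (y1 (i1,j1)) (y1 (i1+1,j1))"
        then show ?thesis using ud_edge[OF n1 _ t[OF y1] q1] e1 by simp
      next
        fix y2 i2 j2 q2 assume y2: "y2 \<in> Omega n" and q2: "0 \<le> q2" "q2 < height n (y2 (i2,j2))"
          and e2: "y1 (i1,j1) = block n (y2 (i2,j2)) (width n (y2 (i2,j2)) - 1) q2" "y1 (i1+1,j1) = block n (y2 (i2+1,j2)) 0 q2"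
        obtain f2 l2 where c2: "dclass n (y2 (i2,j2)) (y2 (i2+1,j2)) (RIGHT (y2 (i2,j2))) f2 l2"
          using Omega_dclass[OF y2] by blast
        note q2' = q2(1) q2(2)[unfolded h[OF y2]]
        note c1 = dclass_edge[OF n c2 q2', folded e2] and b1 = boundary_class_step[OF n c2 q2']
        have r1: "RIGHT (y1 (i1,j1)) = tau_at (int n) (RIGHT (y2 (i2,j2))) q2" using c1 by (simp add: dclass_def)
        note q1' = q1(1) q1(2)[unfolded h[OF y1] r1]
        note c0 = dclass_edge[OF n c1 q1', folded e1] and b0 = deep_class_step[OF n b1 q1']
        have "RIGHT (y (i,j)) = tau_at (int n) (RIGHT (y1 (i1,j1))) q1" using c0 r1 by (simp add: dclass_def)
        then show ?thesis using c0 deep_class_uclass[OF n b0] r1 unfolding uclass_def by metis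
      qed
    qed simp
    then show ?thesis
    proof (elim disjE exE conjE)
      assume "ud n (y (i,j)) (y (i+1,j))"
      then show ?thesis using ud_edge[OF n1 _ t[OF y] q] e by simp
    next
      fix s t' f l assume st: "ud n s t'" "dclass n s t' (RIGHT (y (i,j))) f l" "dclass n (y (i,j)) (y (i+1,j)) (RIGHT (y (i,j))) f l"
      have s: "s \<in> T n" "height n s = height n (y (i,j))"
        using st(2) T_rows(1)[OF n1, of s] h[OF y] by (auto simp: dclass_def height_def)
      have "ud n (block n s (width n s - 1) q) (block n t' 0 q)"
        using ud_edge[OF n1 st(1) s(1) q(1)] q s by simp
      then show ?thesis using dclass_determ[OF n st(2,3) q(1)] q h[OF y] e by simp
    qed
  qed
qed

section \<open>Two by two windows for \<open>n \<ge> 2\<close>\<close>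

definition uwindow :: "nat \<Rightarrow> config \<Rightarrow> int \<Rightarrow> int \<Rightarrow> bool" where
  "uwindow n x a b \<longleftrightarrow> uq n (x (a,b)) (x (a+1,b)) (x (a,b+1)) (x (a+1,b+1))"

lemma Omega_T: "y \<in> Omega n \<Longrightarrow> y p \<in> T n"
  by (cases p) (simp add: Omega_def)

lemma Omega_adj:
  assumes "y \<in> Omega n"
  shows "RIGHT (y (i,j)) = LEFT (y (i+1,j))" "TOP (y (i,j)) = BOTTOM (y (i,j+1))"
  using assms unfolding Omega_def by blast+

text \<open>Windows across a single boundary follow from \<open>ud_Omega\<close>, for horizontal
  boundaries after \<open>flip\<close>; only windows around a common corner of four images
  remain.\<close>

lemma window_cases:
  assumes n: "n \<ge> 2" and x: "x \<in> Omega n"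
  obtains "uwindow n x a b"
  | y i j where "y \<in> Omega n"
    "x (a,b) = block n (y (i,j)) (width n (y (i,j)) - 1) (height n (y (i,j)) - 1)"
    "x (a+1,b) = block n (y (i+1,j)) 0 (height n (y (i,j)) - 1)"
    "x (a,b+1) = block n (y (i,j+1)) (width n (y (i,j)) - 1) 0"
    "x (a+1,b+1) = block n (y (i+1,j+1)) 0 0"
proof -
  have n1: "n \<ge> 1" using n by simp
  show thesis
  proof (rule window_image[OF n1 x, where a = a and b = b])
    fix y i j p q assume y: "y \<in> Omega n" and p: "0 \<le> p" "p < width n (y (i,j))" "0 \<le> q" "q < height n (y (i,j))"
      and e: "\<And>c d. 0 \<le> c \<Longrightarrow> c \<le> 1 \<Longrightarrow> 0 \<le> d \<Longrightarrow> d \<le> 1 \<Longrightarrow>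
        x (a+c,b+d) = image_at n y i j (p+c) (q+d)"
    note e = e[of 0 0, simplified] e[of 1 0, simplified] e[of 0 1, simplified] e[of 1 1, simplified]
    note yT = Omega_T[OF y]
    let ?w = "width n (y (i,j))" and ?h = "height n (y (i,j))"
    have h1: "height n (y (i+1,j)) = ?h"
      using Omega_adj(1)[OF y, of i j] T_rows(1)[OF n1 yT, of "(i,j)"] by (simp add: height_def)
    consider "p + 1 < ?w" "q + 1 < ?h" | "p + 1 = ?w" "q + 1 < ?h" | "p + 1 < ?w" "q + 1 = ?h" | "p + 1 = ?w" "q + 1 = ?h"
      using p by linarith
    then show thesis
    proof cases
      case 1
      then have "uwindow n x a b" using uq_interior[OF n1 yT, of p "(i,j)" q] p by (simp add: uwindow_def e quad_image_def)
      then show thesis by (rule that(1))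
    next
      case 2
      then have p': "p = ?w - 1" by simp
      have "uq n (block n (y (i,j)) (?w - 1) q) (block n (y (i+1,j)) 0 q)
        (block n (y (i,j)) (?w - 1) (q+1)) (block n (y (i+1,j)) 0 (q+1))"
        using uq_edge[OF n1 ud_Omega[OF n y, of i j] yT p(3) 2(2)] .
      then have "uwindow n x a b" using 2 p by (simp add: uwindow_def e quad_image_def p')
      then show thesis by (rule that(1))
    next
      case 3
      then have q': "q = ?h - 1" by simp
      have f: "flip y \<in> Omega n" "flip y (j,i) = hat (y (i,j))" "flip y (j+1,i) = hat (y (i,j+1))"
        using flip_Omega[OF n1 y] by (simp_all add: flip_def)
      have "ud n (hat (y (i,j))) (hat (y (i,j+1)))" using ud_Omega[OF n f(1), of j i] f by simp
      from uq_flip[OF n1 uq_edge[OF n1 this hat_in_T[OF n1 yT] p(1)]]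
      have "uq n (block n (y (i,j)) p (?h - 1)) (block n (y (i,j)) (p+1) (?h - 1))
        (block n (y (i,j+1)) p 0) (block n (y (i,j+1)) (p+1) 0)"
        using 3 by (simp add: block_hat)
      then have "uwindow n x a b" using 3 p by (simp add: uwindow_def e quad_image_def q')
      then show thesis by (rule that(1))
    next
      case 4
      then have pq: "p = ?w - 1" "q = ?h - 1" by simp_all
      show thesis by (rule that(2)[OF y]) (use 4 p in \<open>simp_all add: e quad_image_def pq\<close>)
    qed
  qed
qed

text \<open>The parameters of a quad on which the four tiles around the central corner of its image depend.\<close>

definition qclass :: "nat \<Rightarrow> tile \<Rightarrow> tile \<Rightarrow> tile \<Rightarrow> tile \<Rightarrow> label \<Rightarrow> label \<Rightarrow> label \<Rightarrow> label \<Rightarrow> bool" where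
  "qclass n s t s' t' a b l l' \<longleftrightarrow> s \<in> T n \<and> t \<in> T n \<and> s' \<in> T n \<and> t' \<in> T n \<and> RIGHT s = a \<and> LEFT t = a \<and>
     TOP s = b \<and> BOTTOM s' = b \<and> RIGHT s' = LEFT t' \<and> TOP t = BOTTOM t' \<and>
     l = tau_at (int n) (RIGHT s') 0 \<and> l' = tau_at (int n) (TOP t) 0"

lemma qclass_corner_tiles:
  assumes n: "n \<ge> 2" and c: "qclass n s t s' t' a b l l'"
  defines "w \<equiv> width n s" and "h \<equiv> height n s"
  shows "RIGHT (block n s (w-1) (h-1)) = tau_at (int n) a (int n - fst a)"
    "TOP (block n s (w-1) (h-1)) = tau_at (int n) b (int n - fst b)"
    "LEFT (block n t 0 (h-1)) = tau_at (int n) a (int n - fst a)"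
    "BOTTOM (block n t 0 (h-1)) = (0, of_bool (int n > c2 a), int n - c1 a)"
    "TOP (block n t 0 (h-1)) = l'"
    "BOTTOM (block n s' (w-1) 0) = tau_at (int n) b (int n - fst b)"
    "LEFT (block n s' (w-1) 0) = (0, of_bool (int n > c2 b), int n - c1 b)"
    "RIGHT (block n s' (w-1) 0) = l"
    "LEFT (block n t' 0 0) = l" "BOTTOM (block n t' 0 0) = l'"
    "block n s (w-1) (h-1) \<in> T n" "block n t 0 (h-1) \<in> T n" "block n s' (w-1) 0 \<in> T n" "block n t' 0 0 \<in> T n"
proof -
  have n1: "n \<ge> 1" using n by simp
  have s: "s \<in> T n" "t \<in> T n" "s' \<in> T n" "t' \<in> T n" "RIGHT s = a" "LEFT t = a" "TOP s = b" "BOTTOM s' = b"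
    "RIGHT s' = LEFT t'" "TOP t = BOTTOM t'" "l = tau_at (int n) (RIGHT s') 0" "l' = tau_at (int n) (TOP t) 0"
    using c by (auto simp: qclass_def)
  have wh: "h = int n + 1 - fst a" "height n t = h" "w = int n + 1 - fst b" "width n s' = w"
    using T_rows[OF n1 s(1)] s by (simp_all add: h_def w_def height_def width_def)
  have pos: "w \<ge> 2" "h \<ge> 2" "width n t \<ge> 1" "height n s' \<ge> 1" "width n t' \<ge> 1" "height n t' \<ge> 1"
    using T_width_pos[OF n1 s(1)] T_width_pos[OF n1 s(2)] T_width_pos[OF n1 s(3)] T_width_pos[OF n1 s(4)] n
    unfolding w_def h_def by linarith+
  have h1: "h - 1 = int n - fst a" "w - 1 = int n - fst b" using wh by simp_all
  show "RIGHT (block n s (w-1) (h-1)) = tau_at (int n) a (int n - fst a)"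
    using block_right[OF n1 s(1), of "h-1"] pos h1 s by (simp add: w_def h_def)
  show "TOP (block n s (w-1) (h-1)) = tau_at (int n) b (int n - fst b)"
    using block_top[OF n1 s(1), of "w-1"] pos h1 s by (simp add: w_def h_def)
  show "LEFT (block n t 0 (h-1)) = tau_at (int n) a (int n - fst a)" by (simp add: block_left s h1)
  show "BOTTOM (block n t 0 (h-1)) = (0, of_bool (int n > c2 a), int n - c1 a)"
    using pos h1 by (simp add: block_def block_label_def s)
  show "TOP (block n t 0 (h-1)) = l'"
    using block_top[OF n1 s(2), of 0] pos wh s by simp
  show "BOTTOM (block n s' (w-1) 0) = tau_at (int n) b (int n - fst b)" by (simp add: block_bottom s h1)
  show "LEFT (block n s' (w-1) 0) = (0, of_bool (int n > c2 b), int n - c1 b)"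
    using pos h1 by (simp add: block_def block_label_def s)
  show "RIGHT (block n s' (w-1) 0) = l"
    using block_right[OF n1 s(3), of 0] pos wh s by simp
  show "LEFT (block n t' 0 0) = l" "BOTTOM (block n t' 0 0) = l'"
    by (simp_all add: block_left block_bottom s)
  show "block n s (w-1) (h-1) \<in> T n" "block n t 0 (h-1) \<in> T n" "block n s' (w-1) 0 \<in> T n" "block n t' 0 0 \<in> T n"
    using block_T[OF n1 s(1), of "w-1" "h-1"] block_T[OF n1 s(2), of 0 "h-1"] block_T[OF n1 s(3), of "w-1" 0]
      block_T[OF n1 s(4), of 0 0] pos wh by (auto simp: w_def h_def)
qed

lemma qclass_determ:
  assumes n: "n \<ge> 2" and c: "qclass n s t s' t' a b l l'" "qclass n u v u' v' a b l l'"
  shows "block n s (width n s - 1) (height n s - 1) = block n u (width n u - 1) (height n u - 1)"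
    "block n t 0 (height n s - 1) = block n v 0 (height n u - 1)"
    "block n s' (width n s - 1) 0 = block n u' (width n u - 1) 0"
    "block n t' 0 0 = block n v' 0 0"
proof -
  have n1: "n \<ge> 1" using n by simp
  note e = qclass_corner_tiles[OF n c(1)] and e' = qclass_corner_tiles[OF n c(2)]
  show "block n s (width n s - 1) (height n s - 1) = block n u (width n u - 1) (height n u - 1)"
    using T_determ(2)[OF n1 e(11) e'(11)] e(1,2) e'(1,2) by simp
  show "block n t 0 (height n s - 1) = block n v 0 (height n u - 1)"
    using T_determ(1)[OF n1 e(12) e'(12)] e(3,4) e'(3,4) by simp
  show "block n s' (width n s - 1) 0 = block n u' (width n u - 1) 0"
    using T_determ(1)[OF n1 e(13) e'(13)] e(6,7) e'(6,7) by simp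
  show "block n t' 0 0 = block n v' 0 0"
    using T_determ(1)[OF n1 e(14) e'(14)] e(9,10) e'(9,10) by simp
qed

text \<open>After one step the quad around a corner consists of an interior tile, two strip tiles
  and a junction. The strip tiles tie \<open>l\<close> to \<open>b\<close> and \<open>l'\<close> to
  \<open>a\<close>, so that only two bits remain.\<close>

definition corner_class :: "nat \<Rightarrow> tile \<Rightarrow> tile \<Rightarrow> tile \<Rightarrow> tile \<Rightarrow> int \<Rightarrow> int \<Rightarrow> bool" where
  "corner_class n s t s' t' m m' \<longleftrightarrow>
     qclass n s t s' t' (1,1,int n+m) (1,1,int n+m') (0,1-m',int n) (0,1-m,int n)"

lemma qclass_corner:
  assumes n: "n \<ge> 2" and c: "qclass n s t s' t' a b l l'"
  shows "qclass n (block n s (width n s - 1) (height n s - 1)) (block n t 0 (height n s - 1))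
     (block n s' (width n s - 1) 0) (block n t' 0 0)
     (tau_at (int n) a (int n - fst a)) (tau_at (int n) b (int n - fst b)) (tau_at (int n) l 0) (tau_at (int n) l' 0)"
  using qclass_corner_tiles[OF n c] unfolding qclass_def by simp

lemma strip_T:
  assumes "n \<ge> 1" "t \<in> T n" "fst (LEFT t) = 0" "fst (BOTTOM t) = 1"
  shows "\<exists>m. (m = 0 \<or> m = 1) \<and> BOTTOM t = (1,1,int n+m) \<and> tau_at (int n) (RIGHT t) 0 = (0,1-m,int n)"
proof -
  obtain a b u v where t: "t = (a,b,u,v)" by (cases t)
  have "strip_tile (int n) a b u v" using ext_tile_kind(2)[of "int n" a b u v] assms T_iff[OF assms(1)] by (simp add: t)
  then obtain c i m where "m = 0 \<or> m = 1" "c = 0 \<or> c = 1" "c \<le> i" "a = (0,m,i+1)" "v = (1,1,int n+m)"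
    unfolding strip_tile_def by blast
  then show ?thesis by (intro exI[of _ m]) (auto simp: t tau_at_def)
qed

lemma corner_class_exists:
  assumes n: "n \<ge> 1" and q: "qclass n s t s' t' a b l l'"
    and f: "fst (BOTTOM s') = 1" "fst (LEFT s') = 0" "fst (LEFT t) = 1" "fst (BOTTOM t) = 0"
  shows "\<exists>m m'. (m = 0 \<or> m = 1) \<and> (m' = 0 \<or> m' = 1) \<and> corner_class n s t s' t' m m'"
proof -
  have T: "s' \<in> T n" "hat t \<in> T n" using q hat_in_T[OF n] by (auto simp: qclass_def)
  obtain m' where m': "m' = 0 \<or> m' = 1" "BOTTOM s' = (1,1,int n+m')" "tau_at (int n) (RIGHT s') 0 = (0,1-m',int n)"
    using strip_T[OF n T(1)] f by auto
  obtain m where m: "m = 0 \<or> m = 1" "LEFT t = (1,1,int n+m)" "tau_at (int n) (TOP t) 0 = (0,1-m,int n)"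
    using strip_T[OF n T(2)] f by auto
  have "corner_class n s t s' t' m m'" using q m m' unfolding corner_class_def qclass_def by auto
  then show ?thesis using m(1) m'(1) by blast
qed

text \<open>Both bits flip because the last letter of the word of \<open>(1,1,int n+m)\<close> is
  \<open>(1,1,int n+(1-m))\<close>, as \<open>n \<ge> 2\<close>.\<close>

lemma corner_class_step:
  assumes n: "n \<ge> 2" and m: "m = 0 \<or> m = 1" "m' = 0 \<or> m' = 1"
    and u: "\<exists>s t s' t'. uq n s t s' t' \<and> corner_class n s t s' t' m m'"
  shows "\<exists>s t s' t'. uq n s t s' t' \<and> corner_class n s t s' t' (1-m) (1-m')"
proof -
  obtain s t s' t' where st: "uq n s t s' t'" "corner_class n s t s' t' m m'" using u by blast
  have "tau_at (int n) (1,1,int n+m) (int n - 1) = (1,1,int n+(1-m))"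
    if "m = 0 \<or> m = (1::int)" for m using that n by (auto simp: tau_at_def)
  note t1 = this[OF m(1)] this[OF m(2)]
  have t2: "tau_at (int n) (0,1-m,int n) 0 = (0,1-(1-m),int n)" for m using n by (simp add: tau_at_def)
  note c = st(2)[unfolded corner_class_def]
  have n1: "n \<ge> 1" using n by simp
  have "corner_class n (block n s (width n s - 1) (height n s - 1)) (block n t 0 (height n s - 1))
     (block n s' (width n s - 1) 0) (block n t' 0 0) (1-m) (1-m')"
    using qclass_corner[OF n c] unfolding fst_conv t1 t2 corner_class_def .
  moreover have "s \<in> T n" using c by (simp add: qclass_def)
  ultimately show ?thesis using uq_corner[OF n1 st(1)] by blast
qed

text \<open>Class \<open>(0,0)\<close> is found inside the image of \<open>jtile n 0 0 0 0\<close>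
  and class \<open>(1,0)\<close> on a vertical boundary between two images; flipping both bits gives
  the other two classes.\<close>

lemma corner_class_uq:
  assumes n: "n \<ge> 2" and m: "m = 0 \<or> m = 1" "m' = 0 \<or> m' = 1"
  shows "\<exists>s t s' t'. uq n s t s' t' \<and> corner_class n s t s' t' m m'"
proof -
  have n1: "n \<ge> 1" using n by simp
  note jT = jtile_T[OF n1]
  have bT: "stile n 0 0 0 \<in> T n" using n
    by (auto simp: T_iff[OF n1] ext_tile_def stile_def extra_def strip_tile_def)
  note iT = itile_T[OF n1]
  let ?N = "int n"
  have 00: "\<exists>s t s' t'. uq n s t s' t' \<and> corner_class n s t s' t' 0 0"
  proof (intro exI conjI)
    show "uq n (itile (?N-1) (?N-1)) (itile ?N (?N-1)) (itile (?N-1) ?N) (itile ?N ?N)"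
      using uq_interior[OF n1 jT(1), of "?N-1" "?N-1"] n by (auto simp: tile_simps)
    show "corner_class n (itile (?N-1) (?N-1)) (itile ?N (?N-1)) (itile (?N-1) ?N) (itile ?N ?N) 0 0"
      using iT[of "?N-1" "?N-1"] iT[of ?N "?N-1"] iT[of "?N-1" ?N] iT[of ?N ?N] n
      by (auto simp: corner_class_def qclass_def itile_def tau_at_def)
  qed
  have "ud n (jtile n 0 0 0 0) (stile n 0 0 0)"
    using ud_interior[OF n1 jT(2), of 0 0] n by (simp add: tile_simps add.commute)
  from uq_edge[OF n1 this jT(1), of "?N-1"]
  have u: "uq n (block n (jtile n 0 0 0 0) ?N (?N-1)) (block n (stile n 0 0 0) 0 (?N-1))
      (block n (jtile n 0 0 0 0) ?N ?N) (block n (stile n 0 0 0) 0 ?N)"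
    using n by (simp add: width_def height_def jtile_def)
  have "corner_class n (block n (jtile n 0 0 0 0) ?N (?N-1)) (block n (stile n 0 0 0) 0 (?N-1))
      (block n (jtile n 0 0 0 0) ?N ?N) (block n (stile n 0 0 0) 0 ?N) 1 0"
    using block_T[OF n1 jT(1), of ?N "?N-1"] block_T[OF n1 jT(1), of ?N ?N]
       block_T[OF n1 bT, of 0 "?N-1"] block_T[OF n1 bT, of 0 ?N] n
    unfolding corner_class_def qclass_def by (auto simp: tile_simps)
  with u have 10: "\<exists>s t s' t'. uq n s t s' t' \<and> corner_class n s t s' t' 1 0" by blast
  have 11: "\<exists>s t s' t'. uq n s t s' t' \<and> corner_class n s t s' t' 1 1"
    using corner_class_step[OF n _ _ 00] by simp
  have 01: "\<exists>s t s' t'. uq n s t s' t' \<and> corner_class n s t s' t' 0 1"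
    using corner_class_step[OF n _ _ 10] by simp
  show ?thesis using m 00 01 10 11 by (elim disjE) simp_all
qed

lemma Omega_qclass:
  assumes "y \<in> Omega n"
  obtains a b l l' where "qclass n (y (i,j)) (y (i+1,j)) (y (i,j+1)) (y (i+1,j+1)) a b l l'"
  using that assms unfolding qclass_def by (metis Omega_T Omega_adj)

text \<open>With two preimages: if the window is a corner at both levels, its quad in the first
  preimage has a \<open>corner_class\<close>, and a quad of this class that occurs everywhere has
  the same corner tiles in its image.\<close>

lemma uwindow_ge2:
  assumes n: "n \<ge> 2" and x: "x \<in> Omega n"
  shows "uwindow n x a b"
proof (rule window_cases[OF n x, of a b])
  have n1: "n \<ge> 1" using n by simp
  fix y i j assume y: "y \<in> Omega n"
    and e: "x (a,b) = block n (y (i,j)) (width n (y (i,j)) - 1) (height n (y (i,j)) - 1)"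
    "x (a+1,b) = block n (y (i+1,j)) 0 (height n (y (i,j)) - 1)"
    "x (a,b+1) = block n (y (i,j+1)) (width n (y (i,j)) - 1) 0"
    "x (a+1,b+1) = block n (y (i+1,j+1)) 0 0"
  show ?thesis
  proof (rule window_cases[OF n y, of i j])
    assume "uwindow n y i j"
    then show ?thesis using uq_corner[OF n1 _ Omega_T[OF y]] by (simp add: uwindow_def e)
  next
    fix y1 i1 j1 assume y1: "y1 \<in> Omega n"
    and e1: "y (i,j) = block n (y1 (i1,j1)) (width n (y1 (i1,j1)) - 1) (height n (y1 (i1,j1)) - 1)"
      "y (i+1,j) = block n (y1 (i1+1,j1)) 0 (height n (y1 (i1,j1)) - 1)"
      "y (i,j+1) = block n (y1 (i1,j1+1)) (width n (y1 (i1,j1)) - 1) 0"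
      "y (i+1,j+1) = block n (y1 (i1+1,j1+1)) 0 0"
    obtain c d l l' where q1: "qclass n (y1 (i1,j1)) (y1 (i1+1,j1)) (y1 (i1,j1+1)) (y1 (i1+1,j1+1)) c d l l'"
      using Omega_qclass[OF y1] by blast
    note t = qclass_corner_tiles[OF n q1, folded e1]
    obtain c' d' k k' where q: "qclass n (y (i,j)) (y (i+1,j)) (y (i,j+1)) (y (i+1,j+1)) c' d' k k'"
      using Omega_qclass[OF y] by blast
    have "fst c \<le> 1" "fst d \<le> 1" using q1 T_rows(3,4)[OF n1, of "y1 (i1,j1)"] by (auto simp: qclass_def good_def)
    then have "\<exists>m m'. (m = 0 \<or> m = 1) \<and> (m' = 0 \<or> m' = 1) \<and>
        corner_class n (y (i,j)) (y (i+1,j)) (y (i,j+1)) (y (i+1,j+1)) m m'"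
      using n by (intro corner_class_exists[OF n1 q]) (simp_all add: t tau_at_def)
    then obtain m m' where m: "m = 0 \<or> m = 1" "m' = 0 \<or> m' = 1"
        "corner_class n (y (i,j)) (y (i+1,j)) (y (i,j+1)) (y (i+1,j+1)) m m'" by blast
    obtain s t s' t' where st: "uq n s t s' t'" "corner_class n s t s' t' m m'"
      using corner_class_uq[OF n m(1,2)] by blast
    have "s \<in> T n" using st(2) by (simp add: corner_class_def qclass_def)
    then show ?thesis using uq_corner[OF n1 st(1)]
      by (simp add: uwindow_def e qclass_determ[OF n m(3)[unfolded corner_class_def] st(2)[unfolded corner_class_def]])
  qed
qed

subsection \<open>Quads for n = 1\<close>

text \<open>The tiles of \<open>T 1\<close> as constructors, so that adjacency and substitution can
  be evaluated. A prime stands for \<open>hat\<close>, the digits of \<open>J\<close> are the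
  parameters \<open>k l r s\<close> of \<open>jtile\<close>, and the digit of a strip tile is its
  \<open>i\<close>.\<close>

datatype tile1 = B0 | B0' | G0 | G0' | G1 | G1' | J0000 | J0001 | J0100 | J0101 | J0111 | J1101 | J1111 | W11 | Y1 | Y1'

fun tile_of :: "tile1 \<Rightarrow> tile" where
  "tile_of B0 = ((0,0,1),(1,1,1),(0,0,0),(1,1,1))"
| "tile_of B0' = ((1,1,1),(0,0,1),(1,1,1),(0,0,0))"
| "tile_of G0 = ((0,1,1),(1,1,1),(0,0,0),(1,1,2))"
| "tile_of G0' = ((1,1,1),(0,1,1),(1,1,2),(0,0,0))"
| "tile_of G1 = ((0,1,2),(1,1,1),(0,0,1),(1,1,2))"
| "tile_of G1' = ((1,1,1),(0,1,2),(1,1,2),(0,0,1))"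
| "tile_of J0000 = ((0,0,0),(0,0,0),(0,0,1),(0,0,1))"
| "tile_of J0001 = ((0,0,0),(0,0,1),(0,1,1),(0,0,1))"
| "tile_of J0100 = ((0,0,1),(0,0,0),(0,0,1),(0,1,1))"
| "tile_of J0101 = ((0,0,1),(0,0,1),(0,1,1),(0,1,1))"
| "tile_of J0111 = ((0,0,1),(0,1,1),(0,1,2),(0,1,1))"
| "tile_of J1101 = ((0,1,1),(0,0,1),(0,1,1),(0,1,2))"
| "tile_of J1111 = ((0,1,1),(0,1,1),(0,1,2),(0,1,2))"
| "tile_of W11 = ((1,1,2),(1,1,2),(1,1,1),(1,1,1))"
| "tile_of Y1 = ((0,1,2),(1,1,2),(0,1,1),(1,1,2))"
| "tile_of Y1' = ((1,1,2),(0,1,2),(1,1,2),(0,1,1))"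

fun block1 :: "tile1 \<Rightarrow> tile1 list list" where
  "block1 B0 = [[J1111,Y1']]"
| "block1 B0' = [[J1111],[Y1]]"
| "block1 G0 = [[J0111,Y1']]"
| "block1 G0' = [[J1101],[Y1]]"
| "block1 G1 = [[J0101,G1']]"
| "block1 G1' = [[J0101],[G1]]"
| "block1 J0000 = [[J0101,G1'],[G1,W11]]"
| "block1 J0001 = [[J0100,G0'],[G1,W11]]"
| "block1 J0100 = [[J0001,G1'],[G0,W11]]"
| "block1 J0101 = [[J0000,G0'],[G0,W11]]"
| "block1 J0111 = [[J0000,B0'],[G0,W11]]"
| "block1 J1101 = [[J0000,G0'],[B0,W11]]"
| "block1 J1111 = [[J0000,B0'],[B0,W11]]"
| "block1 W11 = [[J1111]]"
| "block1 Y1 = [[J0100,G0']]"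
| "block1 Y1' = [[J0001],[G0]]"

definition "tiles1 = [B0, B0', G0, G0', G1, G1', J0000, J0001, J0100, J0101, J0111, J1101, J1111, W11, Y1, Y1']"

text \<open>The remaining three tiles of the quads with lower left tile \<open>s\<close> that occur in images.\<close>

fun quads1 :: "tile1 \<Rightarrow> (tile1 \<times> tile1 \<times> tile1) list" where
  "quads1 B0 = [(J0000,W11,G0'), (J0100,W11,G0')]"
| "quads1 B0' = [(W11,J0000,G0), (W11,J0001,G0)]"
| "quads1 G0 = [(J0101,B0,J0000), (J0101,W11,G1'), (J1101,B0,J0000)]"
| "quads1 G0' = [(B0',J0101,J0000), (B0',J0111,J0000), (W11,J0101,G1)]"
| "quads1 G1 = [(J0111,W11,Y1'), (J1111,B0,J0100), (J1111,W11,Y1')]"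
| "quads1 G1' = [(B0',J1111,J0001), (W11,J1101,Y1), (W11,J1111,Y1)]"
| "quads1 J0000 = [(B0,B0',W11), (B0,G0',W11), (G0,B0',W11), (G0,G0',W11)]"
| "quads1 J0001 = [(G0,G1',W11), (G0,J0000,B0)]"
| "quads1 J0100 = [(G1,G0',W11), (J0000,G0',B0')]"
| "quads1 J0101 = [(G1,G1',W11), (G1,J0000,B0), (J0000,G1',B0')]"
| "quads1 J0111 = [(J0000,Y1',G0')]"
| "quads1 J1101 = [(Y1,J0000,G0)]"
| "quads1 J1111 = [(J0001,J0100,J0000), (J0001,J0101,J0000), (J0001,Y1',G1'), (J0101,J0100,J0000), (J0101,J0101,J0000), (J0101,J0111,J0000), (J0101,Y1',G1'), (J1101,J0101,J0000), (J1101,J0111,J0000), (Y1,J0100,G1), (Y1,J0101,G1)]"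
| "quads1 W11 = [(G0',G0,J0101), (G0',G1,J0111), (G1',G0,J1101), (G1',G1,J1111), (G1',Y1,J1111), (Y1',G1,J1111), (Y1',Y1,J1111)]"
| "quads1 Y1 = [(J1111,G0,J0101), (J1111,G1,J0111)]"
| "quads1 Y1' = [(G0',J1111,J0101), (G1',J1111,J1101)]"

text \<open>Starting with the quad in the block of \<open>J1111\<close>, the images of the following quads contain all quads
  listed in \<open>quads1\<close>; each of them occurs in the image of a previous one.\<close>

definition "parents1 = [(J0000,B0,B0',W11),
  (J0101,G1,G1',W11),
  (G1',W11,J1111,Y1),
  (G1,J1111,B0,J0100),
  (G0,J0101,W11,G1'),
  (J0111,J0000,Y1',G0'),
  (B0',W11,J0001,G0),
  (Y1',G0',J1111,J0101),
  (J0001,G0,J0000,B0),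
  (J0100,G1,G0',W11),
  (G0',W11,J0101,G1),
  (J1101,Y1,J0000,G0),
  (Y1,J1111,G1,J0111),
  (B0,J0100,W11,G0'),
  (W11,G1',G1,J1111),
  (J1111,J0101,J0101,J0000),
  (W11,Y1',G1,J1111),
  (B0',W11,J0000,G0),
  (Y1',G1',J1111,J1101),
  (Y1,J1111,G0,J0101),
  (W11,Y1',Y1,J1111),
  (W11,G1',G0,J1101),
  (W11,G0',G1,J0111),
  (W11,G0',G0,J0101),
  (B0,J0000,W11,G0'),
  (W11,G1',Y1,J1111)]"

definition hadj :: "tile1 \<Rightarrow> tile1 \<Rightarrow> bool" where "hadj s t \<longleftrightarrow> RIGHT (tile_of s) = LEFT (tile_of t)"
definition vadj :: "tile1 \<Rightarrow> tile1 \<Rightarrow> bool" where "vadj s t \<longleftrightarrow> TOP (tile_of s) = BOTTOM (tile_of t)"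

definition "width1 s = length (block1 s)"
definition "height1 s = length (hd (block1 s))"

type_synonym quad1 = "tile1 \<times> tile1 \<times> tile1 \<times> tile1"

definition qimage1 :: "tile1 \<Rightarrow> tile1 \<Rightarrow> tile1 \<Rightarrow> tile1 \<Rightarrow> nat \<Rightarrow> nat \<Rightarrow> tile1" where
  "qimage1 s t s' t' p q = (if p < width1 s then if q < height1 s then block1 s ! p ! q else block1 s' ! p ! 0
     else if q < height1 s then block1 t ! 0 ! q else block1 t' ! 0 ! 0)"

definition qimage_at :: "tile1 \<Rightarrow> tile1 \<Rightarrow> tile1 \<Rightarrow> tile1 \<Rightarrow> nat \<Rightarrow> nat \<Rightarrow> quad1" where
  "qimage_at s t s' t' p q = (qimage1 s t s' t' p q, qimage1 s t s' t' (Suc p) q,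
     qimage1 s t s' t' p (Suc q), qimage1 s t s' t' (Suc p) (Suc q))"

definition qimage_col :: "tile1 \<Rightarrow> tile1 \<Rightarrow> tile1 \<Rightarrow> tile1 \<Rightarrow> nat \<Rightarrow> quad1 list" where
  "qimage_col s t s' t' p = map (qimage_at s t s' t' p) [0..<height1 s]"

fun qimages :: "quad1 \<Rightarrow> quad1 list" where
  "qimages (s,t,s',t') = concat (map (qimage_col s t s' t') [0..<width1 s])"

fun quad_adj :: "quad1 \<Rightarrow> bool" where
  "quad_adj (s,t,s',t') \<longleftrightarrow> hadj s t \<and> vadj s s' \<and> hadj s' t' \<and> vadj t t'"

fun in_quads1 :: "quad1 \<Rightarrow> bool" where
  "in_quads1 (s,t,s',t') \<longleftrightarrow> List.member (quads1 s) (t,s',t')"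

text \<open>The two additional quads fit together locally, but disappear after one more substitution step.\<close>

definition in_quads2 :: "quad1 \<Rightarrow> bool" where
  "in_quads2 q \<longleftrightarrow> in_quads1 q \<or> q = (J1111,J1101,J0100,J0000) \<or> q = (J1111,J0001,J0111,J0000)"

fun chain1 :: "quad1 list \<Rightarrow> quad1 list \<Rightarrow> quad1 list option" where
  "chain1 seen [] = Some seen"
| "chain1 seen (q # qs) = (if List.member seen q \<and> quad_adj q then chain1 (qimages q @ seen) qs else None)"

definition below_ok :: "tile1 \<Rightarrow> tile1 \<Rightarrow> tile1 \<Rightarrow> tile1 \<Rightarrow> bool" where
  "below_ok s t a b \<longleftrightarrow> vadj b t \<and> hadj a b"
definition below_ex :: "tile1 \<Rightarrow> tile1 \<Rightarrow> tile1 \<Rightarrow> bool" where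
  "below_ex s t a \<longleftrightarrow> vadj a s \<and> list_ex (below_ok s t a) tiles1"
definition left_ok :: "tile1 \<Rightarrow> tile1 \<Rightarrow> tile1 \<Rightarrow> tile1 \<Rightarrow> bool" where
  "left_ok s s' a b \<longleftrightarrow> hadj b s' \<and> vadj a b"
definition left_ex :: "tile1 \<Rightarrow> tile1 \<Rightarrow> tile1 \<Rightarrow> bool" where
  "left_ex s s' a \<longleftrightarrow> hadj a s \<and> list_ex (left_ok s s' a) tiles1"

text \<open>All quads that can be continued to the left and below have their images in \<open>in_quads2\<close>. The check
  is split into named functions in order to avoid rewriting under binders.\<close>

definition check4 :: "tile1 \<Rightarrow> tile1 \<Rightarrow> tile1 \<Rightarrow> tile1 \<Rightarrow> bool" where
  "check4 s t s' t' \<longleftrightarrow> (if hadj s' t' \<and> vadj t t' then list_all in_quads2 (qimages (s,t,s',t')) else True)"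
definition check3 :: "tile1 \<Rightarrow> tile1 \<Rightarrow> tile1 \<Rightarrow> bool" where
  "check3 s t s' \<longleftrightarrow> (if vadj s s' \<and> list_ex (left_ex s s') tiles1 then list_all (check4 s t s') tiles1 else True)"
definition check2 :: "tile1 \<Rightarrow> tile1 \<Rightarrow> bool" where
  "check2 s t \<longleftrightarrow> (if hadj s t \<and> list_ex (below_ex s t) tiles1 then list_all (check3 s t) tiles1 else True)"
definition check1 :: "tile1 \<Rightarrow> bool" where
  "check1 s \<longleftrightarrow> list_all (check2 s) tiles1"

definition images_ok :: "tile1 \<Rightarrow> tile1 \<times> tile1 \<times> tile1 \<Rightarrow> bool" where
  "images_ok s q \<longleftrightarrow> list_all in_quads1 (qimages (s, q))"
definition all_images_ok :: "tile1 \<Rightarrow> bool" where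
  "all_images_ok s \<longleftrightarrow> list_all (images_ok s) (quads1 s)"

lemma check_quads1: "list_all check1 tiles1"
  by code_simp

lemma check_quads2:
  "list_all all_images_ok tiles1 \<and> list_all in_quads1 (qimages (J1111,J1101,J0100,J0000)) \<and>
   list_all in_quads1 (qimages (J1111,J0001,J0111,J0000))"
  by code_simp

definition is_seen where "is_seen seen s q \<longleftrightarrow> List.member seen (s,q)"
definition all_seen where "all_seen seen s \<longleftrightarrow> list_all (is_seen seen s) (quads1 s)"

text \<open>Success of the chain means that each parent is the seed or was met in the image of an
  earlier parent, so that occurrence in every configuration propagates from the seed.\<close>

lemma check_chain1:
  "case chain1 [(J0000,B0,B0',W11)] parents1 of None \<Rightarrow> False | Some L \<Rightarrow> list_all (all_seen L) tiles1"
  by code_simp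

section \<open>Transfer of the finite check to configurations\<close>

declare One_nat_def [simp del]

lemma tiles1_UNIV: "s \<in> set tiles1"
  by (cases s) (simp_all add: tiles1_def)

lemma width1: "width 1 (tile_of s) = int (width1 s)" "height 1 (tile_of s) = int (height1 s)"
  "0 < width1 s" "0 < height1 s"
  by (cases s; simp add: width_def height_def width1_def height1_def)+

lemma block1: "p < width1 s \<Longrightarrow> q < height1 s \<Longrightarrow> block 1 (tile_of s) (int p) (int q) = tile_of (block1 s ! p ! q)"
  by (cases s) (auto simp: width1_def height1_def less_Suc_eq tile_simps)

lemma T_tile_of:
  assumes "t \<in> T 1" obtains s where "t = tile_of s"
proof -
  obtain a b u v where t: "t = (a,b,u,v)" by (cases t)
  have e: "ext_tile 1 a b u v" "\<not> extra 1 u v" using assms T_iff[of 1] by (simp_all add: t)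
  have st: "\<exists>s. (a,b,u,v) = tile_of s \<and> (b,a,v,u) \<in> range tile_of" if s: "strip_tile 1 a b u v" "\<not> extra 1 u v" for a b u v
  proof -
    obtain c i m where *: "c = 0 \<or> c = 1" "m = 0 \<or> m = 1" "c \<le> i" "i \<le> 1 - 1 + m"
      "a = (0,m,i+1)" "b = (1,1,1+c)" "u = (0,c,i)" "v = (1,1,1+m)" using s(1) unfolding strip_tile_def by metis
    have "c = 1 \<longrightarrow> m = 1" using s(2) * by (auto simp: extra_def)
    then consider "c = 0" "m = 0" "i = 0" | "c = 0" "m = 1" "i = 0" | "c = 0" "m = 1" "i = 1" | "c = 1" "m = 1" "i = 1"
      using * by fastforce
    then show ?thesis
    proof cases
      case 1
      then have "(a,b,u,v) = tile_of B0" "(b,a,v,u) = tile_of B0'" using * by simp_all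
      then show ?thesis by blast
    next
      case 2
      then have "(a,b,u,v) = tile_of G0" "(b,a,v,u) = tile_of G0'" using * by simp_all
      then show ?thesis by blast
    next
      case 3
      then have "(a,b,u,v) = tile_of G1" "(b,a,v,u) = tile_of G1'" using * by simp_all
      then show ?thesis by blast
    next
      case 4
      then have "(a,b,u,v) = tile_of Y1" "(b,a,v,u) = tile_of Y1'" using * by simp_all
      then show ?thesis by blast
    qed
  qed
  have "t \<in> range tile_of" using e(1) unfolding ext_tile_def
  proof (elim disjE)
    assume "interior_tile 1 a b u v"
    then have "t = tile_of W11" by (auto simp: t interior_tile_def)
    then show ?thesis by blast
  next
    assume "strip_tile 1 a b u v" then show ?thesis using st[OF _ e(2)] t by blast
  next
    assume "strip_tile 1 b a v u" then show ?thesis using st[of b a v u] e(2) extra_sym t by blast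
  next
    assume "junction_tile 1 a b u v"
    then obtain k l r s where *: "0 \<le> k" "k \<le> l" "l \<le> 1" "0 \<le> r" "r \<le> s" "s \<le> 1"
      "a = (0,k,l)" "b = (0,r,s)" "u = (0,s,r+1)" "v = (0,l,k+1)" unfolding junction_tile_def by metis
    have "(k = 0 \<and> l = 0) \<or> (k = 0 \<and> l = 1) \<or> (k = 1 \<and> l = 1)" using *(1-3) by linarith
    moreover have "(r = 0 \<and> s = 0) \<or> (r = 0 \<and> s = 1) \<or> (r = 1 \<and> s = 1)" using *(4-6) by linarith
    ultimately have "t \<in> tile_of ` {J0000,J0001,J0100,J0101,J0111,J1101,J1111}"
      using e(2) * unfolding t by (elim disjE conjE) (simp_all add: extra_def)
    then show ?thesis by blast
  qed
  then show thesis using that by blast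
qed

definition uq1 :: "quad1 \<Rightarrow> bool" where
  "uq1 Q = (case Q of (s,t,s',t') \<Rightarrow> uq 1 (tile_of s) (tile_of t) (tile_of s') (tile_of t'))"

lemma fst_tile_of: "fst (RIGHT (tile_of s)) = fst (LEFT (tile_of s))" "fst (TOP (tile_of s)) = fst (BOTTOM (tile_of s))"
  by (cases s; simp)+

lemma qimage1:
  assumes "quad_adj (s,t,s',t')"
  shows "tile_of (qimage1 s t s' t' p q) =
    quad_image 1 (tile_of s) (tile_of t) (tile_of s') (tile_of t') (int p) (int q)"
proof -
  have "height 1 (tile_of t) = height 1 (tile_of s)" "width 1 (tile_of s') = width 1 (tile_of s)"
    using assms fst_tile_of[of s] by (simp_all add: hadj_def vadj_def height_def width_def)
  then have "height1 t = height1 s" "width1 s' = width1 s" by (simp_all add: width1)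
  then show ?thesis
    using block1[of p s q] block1[of p s' 0] block1[of 0 t q] block1[of 0 t' 0]
    by (simp add: qimage1_def quad_image_def width1)
qed

lemma uq1_qimages:
  assumes u: "uq1 Q" "quad_adj Q" and R: "R \<in> set (qimages Q)"
  shows "uq1 R"
proof -
  obtain s t s' t' where Q: "Q = (s,t,s',t')" by (cases Q)
  obtain p q where p: "p < width1 s" "q < height1 s" "R = qimage_at s t s' t' p q"
    using R by (auto simp: Q qimage_col_def)
  have "uq 1 (quad_image 1 (tile_of s) (tile_of t) (tile_of s') (tile_of t') (int p) (int q))
    (quad_image 1 (tile_of s) (tile_of t) (tile_of s') (tile_of t') (int p + 1) (int q))
    (quad_image 1 (tile_of s) (tile_of t) (tile_of s') (tile_of t') (int p) (int q + 1))
    (quad_image 1 (tile_of s) (tile_of t) (tile_of s') (tile_of t') (int p + 1) (int q + 1))"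
    using uq_image[of 1 "tile_of s" "tile_of t" "tile_of s'" "tile_of t'" "int p" "int q"] u(1) p
    by (simp add: uq1_def Q width1)
  then show ?thesis using qimage1[OF u(2)[unfolded Q]]
    by (simp add: p(3) qimage_at_def uq1_def add.commute)
qed

lemma chain1_uq1:
  assumes "chain1 seen qs = Some L" "\<forall>q\<in>set seen. uq1 q" "q \<in> set L"
  shows "uq1 q"
  using assms
proof (induction seen qs rule: chain1.induct)
  case (2 seen q' qs)
  then have "q' \<in> set seen" "quad_adj q'" "chain1 (qimages q' @ seen) qs = Some L"
    by (auto simp: List.member_iff split: if_splits)
  moreover have "\<forall>q\<in>set (qimages q' @ seen). uq1 q"
    using calculation 2 uq1_qimages[of q'] by (metis Un_iff set_append)
  ultimately show ?case using 2 by (simp add: List.member_iff)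
qed simp

lemma in_quads1_uq1:
  assumes "in_quads1 Q" shows "uq1 Q"
proof -
  obtain s q where Q: "Q = (s,q)" by (cases Q)
  have q: "q \<in> set (quads1 s)" using assms by (cases q) (simp add: Q List.member_iff)
  obtain L where L: "chain1 [(J0000,B0,B0',W11)] parents1 = Some L" "list_all (all_seen L) tiles1"
    using check_chain1 by (auto split: option.splits)
  have m: "(s,q) \<in> set L" using L(2) tiles1_UNIV[of s] q
    by (auto simp: list_all_iff all_seen_def is_seen_def List.member_iff)
  \<comment> \<open>These four tiles are the whole image of \<open>J1111\<close>.\<close>
  have u: "uq1 (J0000,B0,B0',W11)"
    using uq_interior[of 1 "jtile 1 1 1 1 1" 0 0]
    by (auto simp: uq1_def T_iff ext_tile_def extra_def junction_tile_def tile_simps)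
  have "\<forall>q\<in>set [(J0000,B0,B0',W11)]. uq1 q" using u by simp
  then show ?thesis unfolding Q by (rule chain1_uq1[OF L(1) _ m])
qed

definition tiles_of :: "quad1 \<Rightarrow> config \<Rightarrow> int \<Rightarrow> int \<Rightarrow> bool" where
  "tiles_of Q x a b = (case Q of (s,t,s',t') \<Rightarrow> x (a,b) = tile_of s \<and> x (a+1,b) = tile_of t \<and>
     x (a,b+1) = tile_of s' \<and> x (a+1,b+1) = tile_of t')"

lemma tiles_of_adj:
  assumes "tiles_of Q x a b" "x \<in> Omega 1"
  shows "quad_adj Q"
  using assms Omega_adj[OF assms(2), of a b] Omega_adj(1)[OF assms(2), of a "b+1"] Omega_adj(2)[OF assms(2), of "a+1" b]
  by (cases Q) (auto simp: tiles_of_def hadj_def vadj_def)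

lemma tiles_of_image:
  assumes x: "x \<in> Omega 1"
  obtains y i j where "y \<in> Omega 1" "\<And>Q. tiles_of Q y i j \<Longrightarrow> \<exists>R\<in>set (qimages Q). tiles_of R x a b"
proof -
  show thesis
  proof (rule window_image[OF order_refl x, where a = a and b = b])
    fix y i j p q assume y: "y \<in> Omega 1" and p: "0 \<le> p" "p < width 1 (y (i,j))" "0 \<le> q" "q < height 1 (y (i,j))"
      and e: "\<And>c d. 0 \<le> c \<Longrightarrow> c \<le> 1 \<Longrightarrow> 0 \<le> d \<Longrightarrow> d \<le> 1 \<Longrightarrow>
        x (a+c,b+d) = image_at 1 y i j (p+c) (q+d)"
    show thesis
    proof (rule that[OF y])
      fix Q assume Q: "tiles_of Q y i j"
      obtain s t s' t' where Q': "Q = (s,t,s',t')" by (cases Q)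
      note im = qimage1[OF tiles_of_adj[OF Q y, unfolded Q']]
      have yy: "y (i,j) = tile_of s" "y (i+1,j) = tile_of t" "y (i,j+1) = tile_of s'" "y (i+1,j+1) = tile_of t'"
        using Q by (simp_all add: tiles_of_def Q')
      have pq: "int (nat p) = p" "int (nat q) = q" "int (Suc (nat p)) = p + 1" "int (Suc (nat q)) = q + 1" using p by simp_all
      have lt: "nat p < width1 s" "nat q < height1 s" using p by (simp_all add: yy width1 nat_less_iff)
      have "tiles_of (qimage_at s t s' t' (nat p) (nat q)) x a b"
        using e[of 0 0] e[of 1 0] e[of 0 1] e[of 1 1] im[of "nat p" "nat q"] im[of "Suc (nat p)" "nat q"]
          im[of "nat p" "Suc (nat q)"] im[of "Suc (nat p)" "Suc (nat q)"]
        unfolding pq by (simp add: tiles_of_def qimage_at_def yy)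
      moreover have "qimage_at s t s' t' (nat p) (nat q) \<in> set (qimages Q)"
        using lt by (auto simp: Q' qimage_col_def intro!: bexI imageI)
      ultimately show "\<exists>R\<in>set (qimages Q). tiles_of R x a b" by blast
    qed
  qed
qed

text \<open>The quad sits in a configuration, so its neighbours to the left and below exist and
  supply the guards of \<open>check2\<close> and \<open>check3\<close>.\<close>

lemma tiles_of_images_quads2:
  assumes y: "y \<in> Omega 1"
  obtains Q where "tiles_of Q y i j" "\<forall>R\<in>set (qimages Q). in_quads2 R"
proof -
  have "\<exists>s. y p = tile_of s" for p using T_tile_of[OF Omega_T[OF y]] by metis
  then obtain z where z: "\<And>p. y p = tile_of (z p)" by metis
  have h: "hadj (z (i,j)) (z (i+1,j))" and v: "vadj (z (i,j)) (z (i,j+1))" for i j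
    using Omega_adj[OF y, of i j] by (simp_all add: hadj_def vadj_def z)
  let ?s = "z (i,j)" and ?t = "z (i+1,j)" and ?s' = "z (i,j+1)" and ?t' = "z (i+1,j+1)"
  have "below_ok ?s ?t (z (i,j-1)) (z (i+1,j-1))" using h[of i "j-1"] v[of "i+1" "j-1"] by (simp add: below_ok_def)
  then have "below_ex ?s ?t (z (i,j-1))" using v[of i "j-1"] tiles1_UNIV by (auto simp: below_ex_def list_ex_iff)
  then have 1: "list_ex (below_ex ?s ?t) tiles1" using tiles1_UNIV by (auto simp: list_ex_iff)
  have "left_ok ?s ?s' (z (i-1,j)) (z (i-1,j+1))" using h[of "i-1" "j+1"] v[of "i-1" j] by (simp add: left_ok_def)
  then have "left_ex ?s ?s' (z (i-1,j))" using h[of "i-1" j] tiles1_UNIV by (auto simp: left_ex_def list_ex_iff)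
  then have 2: "list_ex (left_ex ?s ?s') tiles1" using tiles1_UNIV by (auto simp: list_ex_iff)
  have "check1 ?s" using check_quads1 tiles1_UNIV by (simp add: list_all_iff)
  then have "check2 ?s ?t" using tiles1_UNIV by (simp add: list_all_iff check1_def)
  then have "check3 ?s ?t ?s'" using 1 h tiles1_UNIV by (simp add: list_all_iff check2_def)
  then have "check4 ?s ?t ?s' ?t'" using 2 v tiles1_UNIV by (simp add: list_all_iff check3_def)
  then have "\<forall>R\<in>set (qimages (?s,?t,?s',?t')). in_quads2 R"
    using h[of i "j+1"] v[of "i+1" j] unfolding check4_def by (simp only: list_all_iff simp_thms if_True)
  moreover have "tiles_of (?s,?t,?s',?t') y i j" by (simp add: tiles_of_def z)
  ultimately show thesis using that by blast
qed

lemma in_quads2_images: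
  assumes "in_quads2 Q" "R \<in> set (qimages Q)"
  shows "in_quads1 R"
proof -
  obtain s q where Q: "Q = (s,q)" by (cases Q)
  consider "in_quads1 Q" | "Q = (J1111,J1101,J0100,J0000)" | "Q = (J1111,J0001,J0111,J0000)"
    using assms(1) unfolding in_quads2_def by blast
  then show ?thesis
  proof cases
    case 1
    then have "q \<in> set (quads1 s)" by (cases q) (simp add: Q List.member_iff)
    moreover have "all_images_ok s" using check_quads2 tiles1_UNIV by (simp add: list_all_iff)
    ultimately show ?thesis using assms(2) Q unfolding all_images_ok_def images_ok_def list_all_iff by blast
  next
    case 2 then show ?thesis using check_quads2 assms(2) unfolding list_all_iff by blast
  next
    case 3 then show ?thesis using check_quads2 assms(2) unfolding list_all_iff by blast
  qed
qed

text \<open>Two preimages are used: one step leads from an arbitrary quad into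
  \<open>in_quads2\<close>, the next one into \<open>in_quads1\<close>, where every quad is known to
  occur everywhere.\<close>

lemma uwindow_1:
  assumes x: "x \<in> Omega 1"
  shows "uwindow 1 x a b"
proof -
  obtain y i j where y: "y \<in> Omega 1" "\<And>Q. tiles_of Q y i j \<Longrightarrow> \<exists>R\<in>set (qimages Q). tiles_of R x a b"
    using tiles_of_image[OF x] by metis
  obtain y' i' j' where y': "y' \<in> Omega 1" "\<And>Q. tiles_of Q y' i' j' \<Longrightarrow> \<exists>R\<in>set (qimages Q). tiles_of R y i j"
    using tiles_of_image[OF y(1)] by metis
  obtain Q where Q: "tiles_of Q y' i' j'" "\<forall>R\<in>set (qimages Q). in_quads2 R"
    using tiles_of_images_quads2[OF y'(1)] by metis
  obtain R where R: "in_quads2 R" "tiles_of R y i j" using y'(2)[OF Q(1)] Q(2) by blast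
  obtain S where S: "S \<in> set (qimages R)" "tiles_of S x a b" using y(2)[OF R(2)] by blast
  have "uq1 S" using in_quads1_uq1[OF in_quads2_images[OF R(1) S(1)]] .
  then show ?thesis using S(2) by (cases S) (simp add: uq1_def uwindow_def tiles_of_def)
qed

declare One_nat_def [simp]

lemma uwindow_Omega:
  assumes "n \<ge> 1" "x \<in> Omega n"
  shows "uwindow n x a b"
  using uwindow_1 uwindow_ge2 assms by (cases "n = 1") auto

subsection \<open>Every pattern occurs in every configuration\<close>

lemma strict_imp_mono_int:
  fixes C :: "int \<Rightarrow> int"
  assumes "\<And>i. C i < C (i+1)" "a \<le> b"
  shows "C a \<le> C b"
  using assms(2)
proof (induction b rule: int_ge_induct)
  case (step i)
  then show ?case using assms(1)[of i] by simp
qed simp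

text \<open>Every block begins with a junction column, whose gap exceeds \<open>k\<close>, and a
  block of junction type has at least one further column. So the bounds increase at each level even
  when other blocks have width one.\<close>

lemma gap_grow:
  fixes C D :: "int \<Rightarrow> int"
  assumes gap: "\<And>i. C (i+1) - C i \<ge> max 1 k" and P: "\<And>i. P i \<Longrightarrow> C (i+1) - C i \<ge> k + 1"
    and D: "\<And>i. D (i+1) = D i + W i" "\<And>i. W i \<ge> 1" "\<And>i. Q i \<Longrightarrow> W i \<ge> 2" and PD: "\<And>i. P (D i)"
  shows "C (D (i+1)) - C (D i) \<ge> k + 1" "C (D (i+1)) - C (D i) \<ge> 1" "Q i \<Longrightarrow> C (D (i+1)) - C (D i) \<ge> k + 2"
proof -
  have lt: "C i < C (i+1)" for i using gap[of i] by simp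
  note mono = strict_imp_mono_int[of C, OF lt]
  have 1: "C (D i + 1) \<le> C (D (i+1))" unfolding D(1) using D(2)[of i] by (intro mono) simp
  show "C (D (i+1)) - C (D i) \<ge> k + 1" using P[OF PD, of i] 1 by simp
  show "C (D (i+1)) - C (D i) \<ge> 1" using lt[of "D i"] 1 by simp
  assume "Q i"
  then have "C (D i + 1 + 1) \<le> C (D (i+1))" unfolding D(1) using D(3)[of i] by (intro mono) simp
  then show "C (D (i+1)) - C (D i) \<ge> k + 2" using P[OF PD, of i] gap[of "D i + 1"] by simp
qed

lemma Omega_types:
  assumes "n \<ge> 1" "y \<in> Omega n"
  shows "fst (BOTTOM (y (i,j))) = fst (BOTTOM (y (i,0)))" "fst (LEFT (y (i,j))) = fst (LEFT (y (0,j)))"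
proof -
  interpret proper_tiling "int n" "\<lambda>a b. LEFT (y (a,b))" "\<lambda>a b. BOTTOM (y (a,b))"
    by (rule Omega_proper_tiling[OF assms])
  show "fst (BOTTOM (y (i,j))) = fst (BOTTOM (y (i,0)))" using fst_bt by metis
  show "fst (LEFT (y (i,j))) = fst (LEFT (y (0,j)))" using fst_lf by metis
qed

text \<open>The gaps of junction columns and rows exceed the level, which drives the induction for \<open>n = 1\<close>: there
  the image of a column may be a single column.\<close>

definition level :: "nat \<Rightarrow> nat \<Rightarrow> config \<Rightarrow> config \<Rightarrow> (int \<Rightarrow> int) \<Rightarrow> (int \<Rightarrow> int) \<Rightarrow> bool" where
  "level n k x y C R \<longleftrightarrow> y \<in> Omega n \<and>
     (\<forall>i. C (i+1) - C i \<ge> max 1 (int k) \<and> (fst (BOTTOM (y (i,0))) = 0 \<longrightarrow> C (i+1) - C i \<ge> int k + 1)) \<and>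
     (\<forall>i. R (i+1) - R i \<ge> max 1 (int k) \<and> (fst (LEFT (y (0,i))) = 0 \<longrightarrow> R (i+1) - R i \<ge> int k + 1)) \<and>
     (\<forall>i j w h. 0 < w \<longrightarrow> 0 < h \<longrightarrow> ubiq n w h (\<lambda>p q. y (i+p,j+q)) \<longrightarrow>
       ubiq n (C (i+w) - C i) (R (j+h) - R j) (\<lambda>p q. x (C i + p, R j + q)))"

lemma level_exists:
  assumes n: "n \<ge> 1" and x: "x \<in> Omega n"
  shows "\<exists>y C R. level n k x y C R"
proof (induction k)
  case 0
  show ?case using x by (intro exI[of _ x] exI[of _ "\<lambda>i. i"]) (simp add: level_def)
next
  case (Suc k)
  then obtain y C R where l: "level n k x y C R" by blast
  have y: "y \<in> Omega n" using l by (simp add: level_def)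
  obtain y1 C1 R1 where d: "desub n y y1 C1 R1" using desub_exists[OF n y] by blast
  have y1: "y1 \<in> Omega n" using d by (simp add: desub_def)
  have lt: "C i < C (i+1)" "R i < R (i+1)" for i
  proof -
    have "C (i+1) - C i \<ge> max 1 (int k)" "R (i+1) - R i \<ge> max 1 (int k)" using l unfolding level_def by blast+
    then show "C i < C (i+1)" "R i < R (i+1)" by simp_all
  qed
  have w: "width n (y1 p) \<ge> 1" "height n (y1 p) \<ge> 1" for p using width_bounds[OF n y1, of p] n by simp_all
  have corner: "y (C1 i, R1 j) = block n (y1 (i,j)) 0 0" for i j
    using desub_block[OF d, of 0 i j 0] w[of "(i,j)"] by simp
  have c0: "fst (BOTTOM (y (C1 i, 0))) = 0" "fst (LEFT (y (0, R1 i))) = 0" for i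
  proof -
    have "fst (BOTTOM (y (C1 i, R1 0))) = 0" "fst (LEFT (y (C1 0, R1 i))) = 0"
      by (simp_all add: corner block_left block_bottom tau_at_def)
    then show "fst (BOTTOM (y (C1 i, 0))) = 0" "fst (LEFT (y (0, R1 i))) = 0"
      using Omega_types[OF n y] by metis+
  qed
  have gC: "C (i+1) - C i \<ge> max 1 (int k)" "fst (BOTTOM (y (i,0))) = 0 \<Longrightarrow> C (i+1) - C i \<ge> int k + 1"
    and gR: "R (i+1) - R i \<ge> max 1 (int k)" "fst (LEFT (y (0,i))) = 0 \<Longrightarrow> R (i+1) - R i \<ge> int k + 1" for i
    using l unfolding level_def by blast+
  have w2: "fst (BOTTOM (y1 (i,0))) = 0 \<Longrightarrow> width n (y1 (i,0)) \<ge> 2"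
    "fst (LEFT (y1 (0,i))) = 0 \<Longrightarrow> height n (y1 (0,i)) \<ge> 2" for i
    using n by (simp_all add: width_def height_def)
  note gapC = gap_grow[where k = "int k" and C = C and D = C1 and P = "\<lambda>i. fst (BOTTOM (y (i,0))) = 0"
    and Q = "\<lambda>i. fst (BOTTOM (y1 (i,0))) = 0" and W = "\<lambda>i. width n (y1 (i,0))", OF gC desub_C[OF d] w(1) w2(1) c0(1)]
  note gapR = gap_grow[where k = "int k" and C = R and D = R1 and P = "\<lambda>i. fst (LEFT (y (0,i))) = 0"
    and Q = "\<lambda>i. fst (LEFT (y1 (0,i))) = 0" and W = "\<lambda>i. height n (y1 (0,i))", OF gR desub_R[OF d] w(2) w2(2) c0(2)]
  have "ubiq n (C (C1 (i+w)) - C (C1 i)) (R (R1 (j+h)) - R (R1 j)) (\<lambda>p q. x (C (C1 i) + p, R (R1 j) + q))"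
    if w: "0 < w" "0 < h" and u: "ubiq n w h (\<lambda>p q. y1 (i+p,j+q))" for i j w h
  proof -
    have u1: "ubiq n (C1 (i+w) - C1 i) (R1 (j+h) - R1 j) (\<lambda>p q. y (C1 i + p, R1 j + q))"
      by (rule ubiq_lift[OF n d w u])
    have "C1 i < C1 (i+1)" "C1 (i+1) \<le> C1 (i+w)" "R1 j < R1 (j+1)" "R1 (j+1) \<le> R1 (j+h)"
      using desub_mono[OF n d] w by (auto intro: strict_imp_mono_int)
    then have p: "0 < C1 (i+w) - C1 i" "0 < R1 (j+h) - R1 j" by simp_all
    have "\<forall>i j w h. 0 < w \<longrightarrow> 0 < h \<longrightarrow> ubiq n w h (\<lambda>p q. y (i+p,j+q)) \<longrightarrow>
       ubiq n (C (i+w) - C i) (R (j+h) - R j) (\<lambda>p q. x (C i + p, R j + q))"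
      using l unfolding level_def by blast
    from this[rule_format, OF p u1] show ?thesis by simp
  qed
  moreover have "max 1 (int (Suc k)) \<le> C (C1 (i+1)) - C (C1 i) \<and>
      (fst (BOTTOM (y1 (i,0))) = 0 \<longrightarrow> int (Suc k) + 1 \<le> C (C1 (i+1)) - C (C1 i))" for i
    using gapC[of i] by auto
  moreover have "max 1 (int (Suc k)) \<le> R (R1 (i+1)) - R (R1 i) \<and>
      (fst (LEFT (y1 (0,i))) = 0 \<longrightarrow> int (Suc k) + 1 \<le> R (R1 (i+1)) - R (R1 i))" for i
    using gapR[of i] by auto
  ultimately have "level n (Suc k) x y1 (\<lambda>i. C (C1 i)) (\<lambda>i. R (R1 i))"
    using y1 unfolding level_def by blast
  then show ?case by blast
qed

lemma window_ubiq:
  assumes n: "n \<ge> 1" and x: "x \<in> Omega n"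
  shows "ubiq n (int w) (int h) (\<lambda>p q. x (a+p,b+q))"
proof -
  \<comment> \<open>With gaps of at least \<open>k\<close>, the window meets at most two consecutive
    blocks in each direction and so lies in the image of a two by two window.\<close>
  define k where "k = max w h"
  obtain y C R where l: "level n k x y C R" using level_exists[OF n x] by blast
  have y: "y \<in> Omega n" using l by (simp add: level_def)
  have gap: "C (i+1) - C i \<ge> max 1 (int k)" "R (i+1) - R i \<ge> max 1 (int k)" for i
    using l unfolding level_def by blast+
  have lt: "C i < C (i+1)" "R i < R (i+1)" for i using gap[of i] by simp_all
  obtain i where i: "C i \<le> a" "a < C (i+1)" using locate[of C a] lt by blast
  obtain j where j: "R j \<le> b" "b < R (j+1)" using locate[of R b] lt by blast
  have "ubiq n 2 2 (\<lambda>p q. y (i+p,j+q))"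
  proof -
    have two: "p = 0 \<or> p = 1" if "0 \<le> p" "p < 2" for p :: int using that by linarith
    show ?thesis using uwindow_Omega[OF n y, of i j] two unfolding uwindow_def uq_def ubiq_def
      by (metis add.right_neutral)
  qed
  then have u: "ubiq n (C (i+2) - C i) (R (j+2) - R j) (\<lambda>p q. x (C i + p, R j + q))"
    using l unfolding level_def by simp
  have "C (i+2) - C (i+1) \<ge> int k" "R (j+2) - R (j+1) \<ge> int k" using gap[of "i+1"] gap[of "j+1"] by (simp_all add: add.assoc)
  then show ?thesis
    by (intro ubiq_sub[OF u, of "a - C i" "b - R j"]) (use i j in \<open>auto simp: k_def algebra_simps\<close>)
qed

lemma window_occurs:
  assumes n: "n \<ge> 1" and x: "x \<in> Omega n" and y: "y \<in> Omega n"
  obtains p' where "\<And>c d. 0 \<le> c \<Longrightarrow> c < int w \<Longrightarrow> 0 \<le> d \<Longrightarrow> d < int h \<Longrightarrow>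
    y (fst p' + c, snd p' + d) = x (fst p + c, snd p + d)"
proof -
  obtain a b where "\<forall>c d. 0 \<le> c \<longrightarrow> c < int w \<longrightarrow> 0 \<le> d \<longrightarrow> d < int h \<longrightarrow> y (a+c,b+d) = x (fst p + c, snd p + d)"
    using window_ubiq[OF n x, of w h "fst p" "snd p"] y unfolding ubiq_def by blast
  then show thesis using that[of "(a,b)"] by simp
qed

subsection \<open>Minimality\<close>

text \<open>The topology on tiles is a product topology; discreteness comes from its finitely many
  discrete factors.\<close>

lemma open_tile: "open {t :: tile}"
proof -
  obtain a0 a1 a2 b0 b1 b2 c0 c1 c2 d0 d1 d2 where
    t: "t = ((a0,a1,a2),(b0,b1,b2),(c0,c1,c2),(d0,d1,d2))" by (metis surj_pair)
  have "{t} = ({a0}\<times>{a1}\<times>{a2})\<times>({b0}\<times>{b1}\<times>{b2})\<times>({c0}\<times>{c1}\<times>{c2})\<times>({d0}\<times>{d1}\<times>{d2})"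
    unfolding t by auto
  moreover have "open \<dots>" by (intro open_Times open_discrete)
  ultimately show ?thesis by (simp only:)
qed

lemma open_cylinder:
  fixes x :: config
  assumes "finite F"
  shows "open {z. \<forall>p\<in>F. z p = x p}"
  using product_topology_basis'[of F "\<lambda>p. {x p}" "\<lambda>p. p"] assms open_tile by simp

lemma open_contains_cylinder:
  fixes x :: config
  assumes "open U" "x \<in> U"
  obtains F where "finite F" "{z. \<forall>p\<in>F. z p = x p} \<subseteq> U"
proof -
  obtain X where X: "x \<in> (\<Pi>\<^sub>E i\<in>UNIV. X i)" "finite {i. X i \<noteq> UNIV}" "(\<Pi>\<^sub>E i\<in>UNIV. X i) \<subseteq> U"
    using product_topology_open_contains_basis[of "\<lambda>i. euclidean" UNIV U x] assms
    unfolding open_fun_def by auto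
  have "{z. \<forall>p\<in>{i. X i \<noteq> UNIV}. z p = x p} \<subseteq> (\<Pi>\<^sub>E i\<in>UNIV. X i)"
    using X(1) by (auto simp: PiE_iff) (metis UNIV_I)
  then show thesis using that[of "{i. X i \<noteq> UNIV}"] X by blast
qed

lemma finite_subset_square:
  fixes F :: "(int \<times> int) set"
  assumes "finite F"
  shows "\<exists>N::nat. \<forall>p\<in>F. \<bar>fst p\<bar> \<le> int N \<and> \<bar>snd p\<bar> \<le> int N"
  using assms
proof induction
  case (insert p F)
  then obtain N :: nat where "\<forall>p\<in>F. \<bar>fst p\<bar> \<le> int N \<and> \<bar>snd p\<bar> \<le> int N" by blast
  then show ?case
    by (intro exI[of _ "max N (nat (max \<bar>fst p\<bar> \<bar>snd p\<bar>))"]) (auto simp: le_max_iff_disj)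
qed simp

lemma minimal_Omega:
  assumes n: "n \<ge> 1"
  shows "minimal_shift (Omega n)"
  unfolding minimal_shift_def
proof (intro allI impI, elim conjE)
  fix Y assume Y: "Y \<subseteq> Omega n" "Y \<noteq> {}" "closed Y" "\<forall>k. \<forall>y\<in>Y. shift k y \<in> Y"
  have "x \<in> Y" if x: "x \<in> Omega n" for x
  proof (rule ccontr)
    assume "x \<notin> Y"
    then obtain F where F: "finite F" "{z. \<forall>p\<in>F. z p = x p} \<subseteq> - Y"
      using open_contains_cylinder[of "- Y" x] Y(3) by (auto simp: open_Compl)
    obtain N :: nat where N: "\<forall>p\<in>F. \<bar>fst p\<bar> \<le> int N \<and> \<bar>snd p\<bar> \<le> int N"
      using finite_subset_square[OF F(1)] by blast
    obtain y where y: "y \<in> Y" using Y(2) by blast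
    obtain p' where p': "\<And>c d. 0 \<le> c \<Longrightarrow> c < int (2*N+1) \<Longrightarrow> 0 \<le> d \<Longrightarrow> d < int (2*N+1) \<Longrightarrow>
        y (fst p' + c, snd p' + d) = x (- int N + c, - int N + d)"
      using window_occurs[OF n x, of y "2*N+1" "2*N+1" "(- int N, - int N)"] y Y(1) by auto
    \<comment> \<open>The shift moves the copy of the window to the origin, so \<open>z\<close>
      belongs to the cylinder around \<open>x\<close> that misses \<open>Y\<close>.\<close>
    define z where "z = shift (fst p' + int N, snd p' + int N) y"
    have "z p = x p" if "p \<in> F" for p
    proof -
      have b: "\<bar>fst p\<bar> \<le> int N" "\<bar>snd p\<bar> \<le> int N" using N that by blast+
      show ?thesis using p'[of "int N + fst p" "int N + snd p"] b
        by (simp add: z_def shift_def algebra_simps)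
    qed
    then have "z \<in> - Y" using F(2) by blast
    moreover have "z \<in> Y" using Y(4) y unfolding z_def by blast
    ultimately show False by blast
  qed
  then show "Y = Omega n" using Y(1) by blast
qed

subsection \<open>The substitution on finite patterns\<close>

abbreviation above_ok :: "tile \<Rightarrow> tile \<Rightarrow> bool" where "above_ok s t \<equiv> TOP s = BOTTOM t"
abbreviation beside_ok :: "tile list \<Rightarrow> tile list \<Rightarrow> bool" where "beside_ok c d \<equiv> map RIGHT c = map LEFT d"

lemma successively_beside_length:
  assumes "successively beside_ok P" "c \<in> set P"
  shows "length c = length (hd P)"
  using assms
proof (induction P)
  case (Cons d P)
  then show ?case by (cases P) (auto dest!: arg_cong[where f = length])
qed simp

lemma successively_conv_nth:
  "successively Q xs \<longleftrightarrow> (\<forall>i. Suc i < length xs \<longrightarrow> Q (xs ! i) (xs ! Suc i))"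
proof (induction xs)
  case (Cons x xs)
  show ?case unfolding successively_Cons Cons
    by (cases xs) (auto simp: nth_Cons less_Suc_eq_0_disj split: nat.splits)
qed simp

lemma valid_patD:
  assumes "valid_pat n P"
  shows "i < length P \<Longrightarrow> length (P ! i) = length (hd P)"
    "i < length P \<Longrightarrow> Suc j < length (P ! i) \<Longrightarrow> TOP (P ! i ! j) = BOTTOM (P ! i ! Suc j)"
    "Suc i < length P \<Longrightarrow> j < length (P ! i) \<Longrightarrow> RIGHT (P ! i ! j) = LEFT (P ! Suc i ! j)"
    "i < length P \<Longrightarrow> set (P ! i) \<subseteq> T n"
  using assms nth_mem[of i P] unfolding valid_pat_def by blast+

text \<open>The index-free form is compatible with \<open>concat\<close>, by which
  \<open>omega_pat\<close> glues images. Equal column lengths are absorbed into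
  \<open>beside_ok\<close>, an equality of lists.\<close>

lemma valid_pat_iff:
  "valid_pat n P \<longleftrightarrow> P \<noteq> [] \<and> hd P \<noteq> [] \<and> (\<forall>c\<in>set P. set c \<subseteq> T n \<and> successively above_ok c) \<and>
     successively beside_ok P"
  (is "_ \<longleftrightarrow> ?R")
proof
  assume v: "valid_pat n P"
  have "map RIGHT (P ! i) = map LEFT (P ! Suc i)" if "Suc i < length P" for i
  proof (rule nth_equalityI)
    show "length (map RIGHT (P ! i)) = length (map LEFT (P ! Suc i))"
      using valid_patD(1)[OF v, of i] valid_patD(1)[OF v, of "Suc i"] that by simp
    then show "map RIGHT (P ! i) ! j = map LEFT (P ! Suc i) ! j" if "j < length (map RIGHT (P ! i))" for j
      using valid_patD(3)[OF v, of i j] that \<open>Suc i < length P\<close> by simp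
  qed
  then have "successively beside_ok P" by (simp add: successively_conv_nth)
  moreover have "successively above_ok c" if c: "c \<in> set P" for c
  proof -
    obtain i where "i < length P" "c = P ! i" using c by (auto simp: in_set_conv_nth)
    then show ?thesis using v unfolding valid_pat_def successively_conv_nth by blast
  qed
  ultimately show ?R using v unfolding valid_pat_def by blast
next
  assume r: ?R
  note len = successively_beside_length[of P]
  have "RIGHT (P ! i ! j) = LEFT (P ! Suc i ! j)" if "Suc i < length P" "j < length (P ! i)" for i j
  proof -
    have e: "map RIGHT (P ! i) = map LEFT (P ! Suc i)" using r that by (auto simp: successively_conv_nth)
    then have "j < length (P ! Suc i)" using that(2) map_eq_imp_length_eq by metis
    then show ?thesis using arg_cong[OF e, of "\<lambda>l. l ! j"] that(2) by simp
  qed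
  moreover have "TOP (P ! i ! j) = BOTTOM (P ! i ! Suc j)" if "i < length P" "Suc j < length (P ! i)" for i j
    using r that unfolding successively_conv_nth by (metis nth_mem)
  ultimately show "valid_pat n P" using r len unfolding valid_pat_def by blast
qed

text \<open>Starting at the lower left corner, tiles are forced one after the other, by induction on
  \<open>i + j\<close>. This is the uniqueness behind the \<open>THE\<close> in
  \<open>omega\<close>.\<close>

lemma valid_pat_determ:
  assumes n: "n \<ge> 1" and P: "valid_pat n P" and Q: "valid_pat n Q"
    and l: "left_labels P = left_labels Q" and b: "bottom_labels P = bottom_labels Q"
  shows "P = Q"
proof -
  have lenP: "length P = length Q" using arg_cong[OF b, of length] by (simp add: bottom_labels_def)
  have lenh: "length (hd P) = length (hd Q)" using arg_cong[OF l, of length] by (simp add: left_labels_def)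
  have lc: "length (P ! i) = length (hd P)" "length (Q ! i) = length (hd P)" if "i < length P" for i
    using valid_patD(1)[OF P, of i] valid_patD(1)[OF Q, of i] that lenP lenh by simp_all
  have ne: "P \<noteq> []" "Q \<noteq> []" "hd P \<noteq> []" "hd Q \<noteq> []" using P Q by (auto simp: valid_pat_def)
  have eq: "P ! i ! j = Q ! i ! j" if "i < length P" "j < length (hd P)" for i j
    using that
  proof (induction "i + j" arbitrary: i j rule: less_induct)
    case less
    have "set (P ! i) \<subseteq> T n" "set (Q ! i) \<subseteq> T n"
      using valid_patD(4)[OF P, of i] valid_patD(4)[OF Q, of i] less.prems lenP by simp_all
    then have inT: "P ! i ! j \<in> T n" "Q ! i ! j \<in> T n" using less.prems lc[of i] by auto
    have "LEFT (P ! i ! j) = LEFT (Q ! i ! j)"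
    proof (cases i)
      case 0
      have "map LEFT (P ! 0) ! j = map LEFT (Q ! 0) ! j" using l ne by (simp add: left_labels_def hd_conv_nth)
      then show ?thesis using 0 less.prems lc[of 0] by simp
    next
      case (Suc i')
      then have "LEFT (P ! i ! j) = RIGHT (P ! i' ! j)" "LEFT (Q ! i ! j) = RIGHT (Q ! i' ! j)"
        using valid_patD(3)[OF P, of i' j] valid_patD(3)[OF Q, of i' j] less.prems lc[of i'] lenP by simp_all
      then show ?thesis using less.hyps[of i' j] less.prems Suc by simp
    qed
    moreover have "BOTTOM (P ! i ! j) = BOTTOM (Q ! i ! j)"
    proof (cases j)
      case 0
      have "map (\<lambda>c. BOTTOM (hd c)) P ! i = map (\<lambda>c. BOTTOM (hd c)) Q ! i" using b by (simp add: bottom_labels_def)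
      moreover have "P ! i \<noteq> []" "Q ! i \<noteq> []" using lc[of i] less.prems by auto
      ultimately show ?thesis using 0 less.prems lenP by (simp add: hd_conv_nth)
    next
      case (Suc j')
      then have "BOTTOM (P ! i ! j) = TOP (P ! i ! j')" "BOTTOM (Q ! i ! j) = TOP (Q ! i ! j')"
        using valid_patD(2)[OF P, of i j'] valid_patD(2)[OF Q, of i j'] less.prems lc[of i] lenP by simp_all
      then show ?thesis using less.hyps[of i j'] less.prems Suc by simp
    qed
    ultimately show ?case using T_determ(1)[OF n inT] by blast
  qed
  show ?thesis
  proof (rule nth_equalityI[OF lenP])
    fix i assume "i < length P"
    then show "P ! i = Q ! i" using lc[of i] eq by (intro nth_equalityI) auto
  qed
qed

definition block_pat :: "nat \<Rightarrow> tile \<Rightarrow> pattern" where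
  "block_pat n t = map (\<lambda>p. map (\<lambda>q. block n t (int p) (int q)) [0..<nat (height n t)]) [0..<nat (width n t)]"

lemma tau_eq:
  assumes "n \<ge> 1" "good (int n) v"
  shows "tau n v = map (\<lambda>p. tau_at (int n) v (int p)) [0..<nat (int n + 1 - fst v)]"
proof -
  obtain x y z where v: "v = (x,y,z)" by (cases v)
  show ?thesis
  proof (rule nth_equalityI)
    show "length (tau n v) = length (map (\<lambda>p. tau_at (int n) v (int p)) [0..<nat (int n + 1 - fst v)])"
      using assms by (auto simp: tau_def v good_def)
    fix i assume "i < length (tau n v)"
    then show "tau n v ! i = map (\<lambda>p. tau_at (int n) v (int p)) [0..<nat (int n + 1 - fst v)] ! i"
      using assms by (cases i) (auto simp: tau_def v good_def tau_at_def nth_append nat_less_iff split: if_splits)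
  qed
qed

lemma block_pat_valid:
  assumes n: "n \<ge> 1" and t: "t \<in> T n"
  shows "valid_pat n (block_pat n t)" "right_labels (block_pat n t) = tau n (RIGHT t)"
    "top_labels (block_pat n t) = tau n (TOP t)" "left_labels (block_pat n t) = tau n (LEFT t)"
    "bottom_labels (block_pat n t) = tau n (BOTTOM t)"
proof -
  have pos: "width n t \<ge> 1" "height n t \<ge> 1" using T_width_pos[OF n t] n by linarith+
  note g = T_rows[OF n t]
  have tau: "tau n (LEFT t) = map (\<lambda>q. tau_at (int n) (LEFT t) (int q)) [0..<nat (height n t)]"
    "tau n (RIGHT t) = map (\<lambda>q. tau_at (int n) (RIGHT t) (int q)) [0..<nat (height n t)]"
    "tau n (BOTTOM t) = map (\<lambda>q. tau_at (int n) (BOTTOM t) (int q)) [0..<nat (width n t)]"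
    "tau n (TOP t) = map (\<lambda>q. tau_at (int n) (TOP t) (int q)) [0..<nat (width n t)]"
    using tau_eq[OF n g(3)] tau_eq[OF n g(4)] tau_eq[OF n g(5)] tau_eq[OF n g(6)] g(1,2)
    by (simp_all add: width_def height_def)
  have hd: "hd (block_pat n t) = map (\<lambda>q. block n t 0 (int q)) [0..<nat (height n t)]"
    using pos by (simp add: block_pat_def hd_map upt_conv_Cons)
  have last: "last (block_pat n t) = map (\<lambda>q. block n t (width n t - 1) (int q)) [0..<nat (height n t)]"
    using pos by (simp add: block_pat_def last_map of_nat_diff)
  show "valid_pat n (block_pat n t)"
    unfolding valid_pat_def
  proof (intro conjI)
    show "block_pat n t \<noteq> []" "hd (block_pat n t) \<noteq> []" using pos hd by (simp_all add: block_pat_def)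
    show "\<forall>c\<in>set (block_pat n t). length c = length (hd (block_pat n t))" unfolding hd by (auto simp: block_pat_def)
    show "\<forall>c\<in>set (block_pat n t). set c \<subseteq> T n" using block_T[OF n t] by (auto simp: block_pat_def)
  qed (auto simp: block_pat_def block_def add.commute)
  show "right_labels (block_pat n t) = tau n (RIGHT t)"
    unfolding right_labels_def last tau using block_right[OF n t] by (auto simp: nat_less_iff)
  show "left_labels (block_pat n t) = tau n (LEFT t)"
    unfolding left_labels_def hd tau by (simp add: block_left comp_def)
  have hdc: "hd (map (\<lambda>q. block n t p (int q)) [0..<nat (height n t)]) = block n t p 0" for p
    using pos by (simp add: hd_map upt_conv_Cons)
  have lastc: "last (map (\<lambda>q. block n t p (int q)) [0..<nat (height n t)]) = block n t p (height n t - 1)" for p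
    using pos by (simp add: last_map of_nat_diff)
  show "bottom_labels (block_pat n t) = tau n (BOTTOM t)"
    unfolding bottom_labels_def tau block_pat_def by (simp add: comp_def hdc block_bottom)
  show "top_labels (block_pat n t) = tau n (TOP t)"
    unfolding top_labels_def tau block_pat_def using block_top[OF n t] by (simp add: comp_def lastc nat_less_iff)
qed

lemma omega_eq:
  assumes n: "n \<ge> 1" and t: "t \<in> T n"
  shows "omega n t = block_pat n t"
  unfolding omega_def
  by (rule the_equality) (use block_pat_valid[OF n t] valid_pat_determ[OF n] in auto)

lemma successively_concat:
  assumes "\<forall>xs\<in>set xss. xs \<noteq> [] \<and> successively Q xs" "successively (\<lambda>xs ys. Q (last xs) (hd ys)) xss"
  shows "successively Q (concat xss)"
  using assms
proof (induction xss)
  case (Cons xs xss)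
  then show ?case
    by (cases xss) (auto simp: successively_append_iff hd_append)
qed simp

lemma map_concat_map: "map f (concat (map g xs)) = concat (map (\<lambda>x. map f (g x)) xs)"
  by (induction xs) auto

definition column_image :: "nat \<Rightarrow> tile list \<Rightarrow> pattern" where
  "column_image n c = vstack (map (omega n) c)"

text \<open>The images along a column have equal width, since matching labels have equal first
  entries; so \<open>vstack\<close>, which takes the width from the first image, loses
  nothing.\<close>

lemma column_image:
  assumes n: "n \<ge> 1" and c: "c \<noteq> []" "set c \<subseteq> T n" "successively above_ok c"
  shows "valid_pat n (column_image n c)"
    "map LEFT (hd (column_image n c)) = concat (map (\<lambda>t. tau n (LEFT t)) c)"
    "map RIGHT (last (column_image n c)) = concat (map (\<lambda>t. tau n (RIGHT t)) c)"
    "bottom_labels (column_image n c) = tau n (BOTTOM (hd c))"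
proof -
  define w where "w = nat (width n (hd c))"
  have w: "nat (width n t) = w" if "t \<in> set c" for t
  proof -
    have "fst (BOTTOM t) = fst (BOTTOM (hd c))" using c(2,3) that
    proof (induction c)
      case (Cons s c)
      show ?case
      proof (cases "t = s \<or> c = []")
        case False
        then have "fst (BOTTOM t) = fst (BOTTOM (hd c))" "TOP s = BOTTOM (hd c)"
          using Cons by (auto simp: successively_Cons)
        then show ?thesis using T_rows(2)[OF n, of s] Cons.prems(1) by simp
      qed (use Cons in auto)
    qed simp
    then show ?thesis by (simp add: w_def width_def)
  qed
  have T: "t \<in> T n" if "t \<in> set c" for t using c(2) that by blast
  have w1: "w \<ge> 1" using T_width_pos(1)[OF n T, of "hd c"] c(1) n unfolding w_def by simp
  define b where "b t k = map (\<lambda>q. block n t (int k) (int q)) [0..<nat (height n t)]" for t k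
  have om: "omega n t = map (b t) [0..<w]" if "t \<in> set c" for t
    using omega_eq[OF n T[OF that]] w[OF that] by (simp add: block_pat_def b_def[abs_def])
  have hdc: "hd c \<in> set c" using c(1) by simp
  have lenhd: "length (hd (map (omega n) c)) = w" using om[OF hdc] c(1) by (simp add: hd_map)
  have ci: "column_image n c = map (\<lambda>k. concat (map (\<lambda>t. b t k) c)) [0..<w]"
    unfolding column_image_def vstack_def lenhd
  proof (rule map_cong[OF refl])
    fix k assume "k \<in> set [0..<w]"
    then have "omega n t ! k = b t k" if "t \<in> set c" for t using om[OF that] by simp
    then show "concat (map (\<lambda>Q. Q ! k) (map (omega n) c)) = concat (map (\<lambda>t. b t k) c)"
      by (simp add: comp_def cong: map_cong)
  qed
  have hpos: "height n t \<ge> 1" if "t \<in> set c" for t using T_width_pos(2)[OF n T[OF that]] n by simp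
  have wpos: "width n t \<ge> 1" "int w = width n t" if "t \<in> set c" for t
    using T_width_pos(1)[OF n T[OF that]] n w[OF that] by linarith+
  have bne: "b t k \<noteq> []" if "t \<in> set c" for t k using hpos[OF that] by (simp add: b_def)
  have bhd: "hd (b t k) = block n t (int k) 0" if "t \<in> set c" for t k
    using hpos[OF that] by (simp add: b_def hd_map upt_conv_Cons)
  have blast: "last (b t k) = block n t (int k) (height n t - 1)" if "t \<in> set c" for t k
    using hpos[OF that] by (simp add: b_def last_map of_nat_diff)
  have bLR: "map RIGHT (b t k) = map LEFT (b t (Suc k))" for t k by (simp add: b_def block_def add.commute)
  have bL: "map LEFT (b t 0) = tau n (LEFT t)" if "t \<in> set c" for t
    using tau_eq[OF n T_rows(5)[OF n T[OF that]]] by (simp add: b_def block_left height_def)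
  have bR: "map RIGHT (b t (w-1)) = tau n (RIGHT t)" if "t \<in> set c" for t
  proof -
    have i: "int (w - 1) = width n t - 1" using wpos[OF that] w1 by (simp add: of_nat_diff)
    have "map RIGHT (b t (w-1)) = map (\<lambda>q. tau_at (int n) (RIGHT t) (int q)) [0..<nat (height n t)]"
      unfolding b_def i using block_right[OF n T[OF that]] by (auto simp: nat_less_iff)
    then show ?thesis using tau_eq[OF n T_rows(3)[OF n T[OF that]]] T_rows(1)[OF n T[OF that]] by (simp add: height_def)
  qed
  show "valid_pat n (column_image n c)"
    unfolding valid_pat_iff
  proof (intro conjI)
    show "column_image n c \<noteq> []" using w1 by (simp add: ci)
    show "hd (column_image n c) \<noteq> []" using w1 bne[OF hdc] hdc by (simp add: ci hd_map upt_conv_Cons) blast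
    show "\<forall>d\<in>set (column_image n c). set d \<subseteq> T n \<and> successively above_ok d"
    proof
      fix d assume "d \<in> set (column_image n c)"
      then obtain k where k: "k < w" "d = concat (map (\<lambda>t. b t k) c)" by (auto simp: ci)
      have "set d \<subseteq> T n"
        using block_T[OF n T] wpos k by (fastforce simp: b_def nat_less_iff)
      moreover have "successively above_ok d" unfolding k(2)
      proof (rule successively_concat)
        show "\<forall>xs\<in>set (map (\<lambda>t. b t k) c). xs \<noteq> [] \<and> successively above_ok xs"
          using bne by (auto simp: successively_conv_nth b_def block_def add.commute)
        have "TOP (last (b s k)) = BOTTOM (hd (b t k))" if "s \<in> set c" "t \<in> set c" "above_ok s t" for s t
          using that k block_top[OF n T[OF that(1)], of "int k"] wpos[OF that(1)]
          by (simp add: bhd blast block_bottom)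
        then show "successively (\<lambda>xs ys. above_ok (last xs) (hd ys)) (map (\<lambda>t. b t k) c)"
          using c(3) unfolding successively_map by (rule successively_mono[rotated])
      qed
      ultimately show "set d \<subseteq> T n \<and> successively above_ok d" by blast
    qed
    show "successively beside_ok (column_image n c)"
      unfolding ci successively_conv_nth by (simp add: map_concat_map bLR)
  qed
  show "map LEFT (hd (column_image n c)) = concat (map (\<lambda>t. tau n (LEFT t)) c)"
    using w1 bL by (simp add: ci hd_map upt_conv_Cons map_concat_map cong: map_cong)
  show "map RIGHT (last (column_image n c)) = concat (map (\<lambda>t. tau n (RIGHT t)) c)"
    using w1 bR by (simp add: ci last_map map_concat_map cong: map_cong)
  have "hd (concat (map (\<lambda>t. b t k) c)) = hd (b (hd c) k)" for k
    using c(1) bne[OF hdc] by (cases c) auto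
  then show "bottom_labels (column_image n c) = tau n (BOTTOM (hd c))"
    using tau_eq[OF n T_rows(6)[OF n T[OF hdc]]] w[OF hdc] bhd[OF hdc]
    by (simp add: bottom_labels_def ci block_bottom comp_def width_def)
qed

text \<open>The bottom and left words are carried along because their lengths measure the
  pattern.\<close>

lemma omega_pat_valid:
  assumes n: "n \<ge> 1" and P: "valid_pat n P"
  shows "valid_pat n (omega_pat n P)"
    "bottom_labels (omega_pat n P) = concat (map (tau n) (bottom_labels P))"
    "left_labels (omega_pat n P) = concat (map (tau n) (left_labels P))"
proof -
  have op: "omega_pat n P = concat (map (column_image n) P)" by (simp add: omega_pat_def column_image_def[abs_def])
  have P': "P \<noteq> []" "hd P \<noteq> []" "successively beside_ok P" "\<And>c. c \<in> set P \<Longrightarrow> set c \<subseteq> T n \<and> successively above_ok c"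
    using P unfolding valid_pat_iff by auto
  have ne: "c \<noteq> []" if "c \<in> set P" for c
    using successively_beside_length[OF P'(3) that] P'(2) by auto
  note ci = column_image[OF n ne conjunct1[OF P'(4)] conjunct2[OF P'(4)]]
  have vi: "column_image n c \<noteq> []" "hd (column_image n c) \<noteq> []" "\<forall>d\<in>set (column_image n c). set d \<subseteq> T n \<and> successively above_ok d"
     "successively beside_ok (column_image n c)" if "c \<in> set P" for c
    using ci(1)[OF that that that] unfolding valid_pat_iff by auto
  have hdo: "hd (omega_pat n P) = hd (column_image n (hd P))"
    unfolding op using P'(1) vi(1)[of "hd P"] by (cases P) auto
  show "valid_pat n (omega_pat n P)" unfolding valid_pat_iff
  proof (intro conjI)
    show "omega_pat n P \<noteq> []" unfolding op using P'(1) vi(1)[of "hd P"] by (cases P) auto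
    show "hd (omega_pat n P) \<noteq> []" using hdo vi(2)[of "hd P"] P'(1) by simp
    show "\<forall>c\<in>set (omega_pat n P). set c \<subseteq> T n \<and> successively above_ok c" using vi(3) by (auto simp: op)
    show "successively beside_ok (omega_pat n P)" unfolding op
    proof (rule successively_concat)
      show "\<forall>xs\<in>set (map (column_image n) P). xs \<noteq> [] \<and> successively beside_ok xs" using vi by auto
      have "beside_ok (last (column_image n c)) (hd (column_image n d))"
        if "c \<in> set P" "d \<in> set P" "beside_ok c d" for c d
      proof -
        have "concat (map (\<lambda>t. tau n (RIGHT t)) c) = concat (map (tau n) (map RIGHT c))"
          "concat (map (\<lambda>t. tau n (LEFT t)) d) = concat (map (tau n) (map LEFT d))" by (simp_all add: comp_def)
        then show ?thesis using ci(3)[of c] ci(2)[of d] that by simp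
      qed
      then show "successively (\<lambda>xs ys. beside_ok (last xs) (hd ys)) (map (column_image n) P)"
        using P'(3) unfolding successively_map by (rule successively_mono[rotated])
    qed
  qed
  have "bottom_labels (concat (map (column_image n) P)) = concat (map (\<lambda>c. tau n (BOTTOM (hd c))) P)"
    using ci(4) by (simp add: bottom_labels_def map_concat_map cong: map_cong)
  then show "bottom_labels (omega_pat n P) = concat (map (tau n) (bottom_labels P))"
    by (simp add: op bottom_labels_def comp_def)
  show "left_labels (omega_pat n P) = concat (map (tau n) (left_labels P))"
    using ci(2)[of "hd P"] P'(1) by (simp add: left_labels_def hdo comp_def)
qed

lemma omega_power_valid:
  assumes "n \<ge> 1" "a \<in> T n"
  shows "valid_pat n ((omega_pat n ^^ m) [[a]])"
proof (induction m)
  case 0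
  show ?case using assms by (simp add: valid_pat_iff)
next
  case (Suc m)
  then show ?case using omega_pat_valid(1)[OF assms(1)] by simp
qed

section \<open>Growth of iterated images\<close>

lemma tau_length:
  assumes "n \<ge> 1" "good (int n) v"
  shows "length (tau n v) = length (filter (\<lambda>v. fst v = 0) [v]) + n"
    "length (filter (\<lambda>v. fst v = 0) (tau n v)) = 1"
proof -
  show "length (tau n v) = length (filter (\<lambda>v. fst v = 0) [v]) + n"
    using assms by (auto simp: tau_eq good_def)
  obtain x y z where "v = (x,y,z)" by (cases v)
  then show "length (filter (\<lambda>v. fst v = 0) (tau n v)) = 1" by (auto simp: tau_def)
qed

text \<open>Each word of \<open>tau\<close> contains exactly one letter with first entry 0, and such
  a letter has an image longer by one. If \<open>z m\<close> counts them, then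
  \<open>z (Suc m)\<close> is the length of \<open>w m\<close>, and \<open>w (Suc m)\<close> is
  longer than \<open>w m\<close> by at least \<open>z m\<close>: growth of Fibonacci type, also for
  \<open>n = 1\<close>.\<close>

lemma tau_word_growth:
  assumes n: "n \<ge> 1" and w: "\<And>m v. v \<in> set (w m) \<Longrightarrow> good (int n) v" "w 0 \<noteq> []"
    and step: "\<And>m. w (Suc m) = concat (map (tau n) (w m))"
  shows "m \<le> length (w m)"
proof -
  define z where "z m = length (filter (\<lambda>v. fst v = 0) (w m))" for m
  have A: "length (concat (map (tau n) u)) \<ge> length u + length (filter (\<lambda>v. fst v = 0) u)"
    if "\<forall>v\<in>set u. good (int n) v" for u
    using that
  proof (induction u)
    case (Cons v u)
    then show ?case using tau_length(1)[OF n, of v] n by simp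
  qed simp
  have B: "length (filter (\<lambda>v. fst v = 0) (concat (map (tau n) u))) = length u" if "\<forall>v\<in>set u. good (int n) v" for u
    using that
  proof (induction u)
    case (Cons v u)
    then show ?case using tau_length(2)[OF n, of v] by simp
  qed simp
  have "Suc m \<le> length (w (Suc m)) \<and> 1 \<le> z (Suc m)" for m
  proof (induction m)
    case 0
    have "length (w 0) \<ge> 1" using w(2) by (simp add: Suc_leI)
    then show ?case using A[of "w 0"] B[of "w 0"] w(1) by (simp add: step z_def)
  next
    case (Suc m)
    have "length (w (Suc (Suc m))) \<ge> length (w (Suc m)) + z (Suc m)"
      unfolding step[of "Suc m"] z_def by (rule A) (use w(1) in blast)
    moreover have "z (Suc (Suc m)) = length (w (Suc m))"
      unfolding step[of "Suc m"] z_def by (rule B) (use w(1) in blast)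
    ultimately show ?case using Suc by linarith
  qed
  then show ?thesis by (cases m) auto
qed

lemma omega_power_size:
  assumes n: "n \<ge> 1" and a: "a \<in> T n"
  shows "m \<le> length ((omega_pat n ^^ m) [[a]])" "m \<le> length (hd ((omega_pat n ^^ m) [[a]]))"
proof -
  note v = omega_power_valid[OF n a]
  have g: "good (int n) (LEFT t)" "good (int n) (BOTTOM t)" if "t \<in> T n" for t
    using T_rows[OF n that] by auto
  define b where "b m = bottom_labels ((omega_pat n ^^ m) [[a]])" for m
  define l where "l m = left_labels ((omega_pat n ^^ m) [[a]])" for m
  have "m \<le> length (b m)"
  proof (rule tau_word_growth[OF n])
    show "good (int n) x" if x: "x \<in> set (b m)" for m x
    proof -
      obtain c where "c \<in> set ((omega_pat n ^^ m) [[a]])" "x = BOTTOM (hd c)"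
        using x by (auto simp: b_def bottom_labels_def)
      moreover from this have "c \<noteq> []" "set c \<subseteq> T n" using v[of m] unfolding valid_pat_def by auto
      ultimately show ?thesis using g(2)[of "hd c"] hd_in_set[of c] by blast
    qed
  qed (use omega_pat_valid[OF n v] in \<open>simp_all add: b_def bottom_labels_def\<close>)
  then show "m \<le> length ((omega_pat n ^^ m) [[a]])" by (simp add: b_def bottom_labels_def)
  have "m \<le> length (l m)"
  proof (rule tau_word_growth[OF n])
    show "good (int n) x" if x: "x \<in> set (l m)" for m x
    proof -
      have "set (hd ((omega_pat n ^^ m) [[a]])) \<subseteq> T n" using v[of m] unfolding valid_pat_def by auto
      then show ?thesis using x g by (auto simp: l_def left_labels_def)
    qed
  qed (use omega_pat_valid[OF n v] in \<open>simp_all add: l_def left_labels_def\<close>)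
  then show "m \<le> length (hd ((omega_pat n ^^ m) [[a]]))" by (simp add: l_def left_labels_def)
qed

subsection \<open>The substitutive subshift\<close>

lemma X_omega_subset:
  assumes n: "n \<ge> 1" and x: "x \<in> X_omega n"
  shows "x \<in> Omega n"
proof -
  have "RIGHT (x (a,b)) = LEFT (x (a+1,b)) \<and> TOP (x (a,b)) = BOTTOM (x (a,b+1))" for a b
  proof -
    let ?Q = "subpattern x (a,b) 2 2"
    obtain t m where t: "t \<in> T n" "occurs_in ?Q ((omega_pat n ^^ m) [[t]])"
      using x unfolding X_omega_def by blast
    define P where "P = (omega_pat n ^^ m) [[t]]"
    have v: "valid_pat n P" using omega_power_valid[OF n t(1)] by (simp add: P_def)
    have Q: "length ?Q = 2" "\<And>i. i < 2 \<Longrightarrow> length (?Q ! i) = 2"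
      "\<And>i j. i < 2 \<Longrightarrow> j < 2 \<Longrightarrow> ?Q ! i ! j = x (a + int i, b + int j)" by (simp_all add: subpattern_def)
    obtain c d where c: "c + 2 \<le> length P"
      "\<And>i j. i < 2 \<Longrightarrow> j < 2 \<Longrightarrow> d + j < length (P ! (c + i)) \<and> x (a + int i, b + int j) = P ! (c + i) ! (d + j)"
      using t(2) Q unfolding occurs_in_def P_def[symmetric] by metis
    have "RIGHT (P ! c ! d) = LEFT (P ! Suc c ! d)" "TOP (P ! c ! d) = BOTTOM (P ! c ! Suc d)"
      using valid_patD(2,3)[OF v, of c d] c(1) c(2)[of 0 0] c(2)[of 0 1] by simp_all
    then show ?thesis using c(2)[of 0 0] c(2)[of 1 0] c(2)[of 0 1] by simp
  qed
  then show ?thesis using x by (simp add: Omega_def X_omega_def)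
qed

lemma occurs_subpattern_sub:
  assumes "occurs_in (subpattern x p w h) P"
    and "fst p \<le> fst p'" "fst p' + int w' \<le> fst p + int w" "snd p \<le> snd p'" "snd p' + int h' \<le> snd p + int h"
  shows "occurs_in (subpattern x p' w' h') P"
proof -
  obtain a b where ab: "a + w \<le> length P" "\<And>i j. i < w \<Longrightarrow> j < h \<Longrightarrow> b + j < length (P ! (a+i)) \<and>
     x (fst p + int i, snd p + int j) = P ! (a + i) ! (b + j)"
    using assms(1) by (auto simp: occurs_in_def subpattern_def)
  define c d where "c = nat (fst p' - fst p)" and "d = nat (snd p' - snd p)"
  have "a + c + w' \<le> length P" using ab(1) assms by (simp add: c_def)
  moreover have "b + d + j < length (P ! (a+c+i)) \<and>
     x (fst p' + int i, snd p' + int j) = P ! (a + c + i) ! (b + d + j)" if "i < w'" "j < h'" for i j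
  proof -
    have cd: "c + i < w" "d + j < h" using assms that by (simp_all add: c_def d_def)
    have e: "fst p + int (c + i) = fst p' + int i" "snd p + int (d + j) = snd p' + int j"
      using assms by (simp_all add: c_def d_def)
    show ?thesis using ab(2)[OF cd] unfolding e by (simp add: add.assoc)
  qed
  ultimately show ?thesis unfolding occurs_in_def
    by (intro exI[of _ "a+c"] exI[of _ "b+d"]) (auto simp: subpattern_def)
qed

section \<open>Nonemptiness of \<open>X_omega n\<close> by compactness\<close>

lemma finite_T: "finite (T n)"
proof -
  have 1: "Wt n \<subseteq> (\<lambda>(i,j). ((1,1,i+1),(1,1,j+1),(1,1,i),(1,1,j))) ` ({1..int n} \<times> {1..int n})"
    by (auto simp: Wt_def image_iff)
  have 2: "Bt n \<subseteq> (\<lambda>i. ((0,0,i+1),(1,1,1),(0,0,i),(1,1,int n))) ` {0..int n}"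
    "Gt n \<subseteq> (\<lambda>i. ((0,1,i+1),(1,1,1),(0,0,i),(1,1,int n+1))) ` {0..int n}"
    "Yt n \<subseteq> (\<lambda>i. ((0,1,i+1),(1,1,2),(0,1,i),(1,1,int n+1))) ` {0..int n}"
    by (auto simp: Bt_def Gt_def Yt_def)
  have 3: "Jt n \<subseteq> (\<lambda>(k,l,r,s). ((0,k,l),(0,r,s),(0,s,r+int n),(0,l,k+int n))) ` ({0..1}\<times>{0..1}\<times>{0..1}\<times>{0..1})"
    unfolding Jt_def by (auto simp: image_iff)
  show ?thesis unfolding T_def
    using finite_subset[OF 1] finite_subset[OF 2(1)] finite_subset[OF 2(2)] finite_subset[OF 2(3)] finite_subset[OF 3]
    by simp
qed

lemma compact_T_configs: "compact (\<Pi>\<^sub>E p\<in>(UNIV :: (int \<times> int) set). T n)"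
proof -
  have "compactin (product_topology (\<lambda>p. euclidean) (UNIV :: (int \<times> int) set)) (\<Pi>\<^sub>E p\<in>UNIV. T n)"
    unfolding compactin_PiE using finite_T[of n] by (simp add: finite_imp_compact)
  then show ?thesis by (simp add: euclidean_product_topology)
qed

text \<open>Centred squares are nested and exhaust the plane: the sets \<open>occurring n N\<close>
  decrease in \<open>N\<close>, and every rectangle lies in some square.\<close>

definition window :: "config \<Rightarrow> nat \<Rightarrow> pattern" where
  "window x N = subpattern x (- int N, - int N) (2 * N + 1) (2 * N + 1)"

definition occurring :: "nat \<Rightarrow> nat \<Rightarrow> config set" where
  "occurring n N = {x. \<exists>a\<in>T n. \<exists>m. occurs_in (window x N) ((omega_pat n ^^ m) [[a]])}"

lemma closed_occurring: "closed (occurring n N)"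
proof -
  define F where "F = {- int N..int N} \<times> {- int N..int N}"
  have F: "finite F" by (simp add: F_def)
  have eq: "window z N = window x N" if "\<forall>p\<in>F. z p = x p" for z x
    using that unfolding window_def subpattern_def F_def by (auto intro!: map_cong)
  have "open (- occurring n N)"
  proof (subst open_subopen, intro ballI)
    fix x assume x: "x \<in> - occurring n N"
    have "z \<in> occurring n N \<longleftrightarrow> x \<in> occurring n N" if "\<forall>p\<in>F. z p = x p" for z
      using eq[OF that] by (simp add: occurring_def)
    then have "{z. \<forall>p\<in>F. z p = x p} \<subseteq> - occurring n N" using x by blast
    then show "\<exists>U. open U \<and> x \<in> U \<and> U \<subseteq> - occurring n N"
      using open_cylinder[OF F, of x] by blast
  qed
  then show ?thesis by (simp add: closed_def)
qed

lemma occurring_antimono: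
  assumes "M \<le> N"
  shows "occurring n N \<subseteq> occurring n M"
proof
  fix x assume "x \<in> occurring n N"
  then obtain a m where am: "a \<in> T n" "occurs_in (window x N) ((omega_pat n ^^ m) [[a]])"
    by (auto simp: occurring_def)
  have "occurs_in (window x M) ((omega_pat n ^^ m) [[a]])" unfolding window_def
    by (rule occurs_subpattern_sub[OF am(2)[unfolded window_def]]) (use assms in auto)
  then show "x \<in> occurring n M" using am(1) by (auto simp: occurring_def)
qed

lemma occurring_nonempty:
  assumes n: "n \<ge> 1"
  shows "occurring n N \<inter> (\<Pi>\<^sub>E p\<in>UNIV. T n) \<noteq> {}"
proof -
  obtain t where t: "t \<in> T n"
    using T_iff[OF n, of "(1,1,2)" "(1,1,2)" "(1,1,1)" "(1,1,1)"] n
    by (auto simp: ext_tile_def interior_tile_def extra_def)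
  define P where "P = (omega_pat n ^^ (2 * N + 1)) [[t]]"
  have v: "valid_pat n P" unfolding P_def by (rule omega_power_valid[OF n t])
  have size: "2 * N + 1 \<le> length P" "2 * N + 1 \<le> length (hd P)"
    using omega_power_size[OF n t] unfolding P_def by blast+
  note len = valid_patD(1)[OF v]
  \<comment> \<open>The filling \<open>t\<close> outside the square may violate the matching rules:
    the compact space consists of all configurations over \<open>T n\<close>, valid or not.\<close>
  define x :: config where "x p = (if \<bar>fst p\<bar> \<le> int N \<and> \<bar>snd p\<bar> \<le> int N
     then P ! nat (fst p + int N) ! nat (snd p + int N) else t)" for p
  have "x p \<in> T n" for p
  proof (cases "\<bar>fst p\<bar> \<le> int N \<and> \<bar>snd p\<bar> \<le> int N")
    case True
    then have "nat (fst p + int N) < length P" "nat (snd p + int N) < length (hd P)" using size by linarith+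
    then have "P ! nat (fst p + int N) ! nat (snd p + int N) \<in> set (P ! nat (fst p + int N))"
      "set (P ! nat (fst p + int N)) \<subseteq> T n" using len valid_patD(4)[OF v] by simp_all
    then show ?thesis using True by (auto simp: x_def)
  next
    case False
    then show ?thesis using t by (auto simp: x_def)
  qed
  moreover have "occurs_in (window x N) P"
    unfolding occurs_in_def
  proof (intro exI[of _ 0] conjI allI impI)
    show "0 + length (window x N) \<le> length P" using size by (simp add: window_def subpattern_def del: upt_Suc)
    fix i j assume ij: "i < length (window x N)" "j < length (window x N ! i)"
    then have ij': "i < 2 * N + 1" "j < 2 * N + 1"
      by (simp_all add: window_def subpattern_def del: upt_Suc)
    then show "0 + j < length (P ! (0 + i))" using len size by simp
    have "\<bar>int i - int N\<bar> \<le> int N" "\<bar>int j - int N\<bar> \<le> int N" using ij' by linarith+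
    then show "window x N ! i ! j = P ! (0 + i) ! (0 + j)" using ij'
      by (simp add: window_def subpattern_def x_def del: upt_Suc)
  qed
  then have "x \<in> occurring n N" using t unfolding occurring_def P_def by blast
  ultimately show ?thesis by (auto simp: PiE_iff)
qed

lemma X_omega_nonempty:
  assumes n: "n \<ge> 1"
  shows "X_omega n \<noteq> {}"
proof -
  have "(\<Pi>\<^sub>E p\<in>UNIV. T n) \<inter> (\<Inter>N\<in>UNIV. occurring n N) \<noteq> {}"
  proof (rule compact_imp_fip_image[OF compact_T_configs])
    fix I :: "nat set" assume I: "finite I"
    have "occurring n (Max (insert 0 I)) \<subseteq> occurring n N" if "N \<in> I" for N
      by (rule occurring_antimono) (use I that in simp)
    then have "occurring n (Max (insert 0 I)) \<subseteq> (\<Inter>N\<in>I. occurring n N)" by blast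
    then show "(\<Pi>\<^sub>E p\<in>UNIV. T n) \<inter> (\<Inter>N\<in>I. occurring n N) \<noteq> {}"
      using occurring_nonempty[OF n, of "Max (insert 0 I)"] by blast
  qed (rule closed_occurring)
  then obtain x where x: "\<And>p. x p \<in> T n" "\<And>N. x \<in> occurring n N" by (auto simp: PiE_iff)
  have "\<exists>a\<in>T n. \<exists>m. occurs_in (subpattern x p w h) ((omega_pat n ^^ m) [[a]])" for p w h
  proof -
    define N where "N = nat \<bar>fst p\<bar> + nat \<bar>snd p\<bar> + w + h"
    obtain a m where am: "a \<in> T n" "occurs_in (window x N) ((omega_pat n ^^ m) [[a]])"
      using x(2)[of N] by (auto simp: occurring_def)
    have "occurs_in (subpattern x p w h) ((omega_pat n ^^ m) [[a]])"
      by (rule occurs_subpattern_sub[OF am(2)[unfolded window_def]]) (auto simp: N_def)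
    then show ?thesis using am(1) by blast
  qed
  then have "x \<in> X_omega n" using x(1) by (simp add: X_omega_def)
  then show ?thesis by blast
qed

theorem theoremD:
  fixes n :: nat
  assumes "n \<ge> 1"
  shows "minimal_shift (Omega n) \<and> Omega n = X_omega n"
proof
  show "minimal_shift (Omega n)" by (rule minimal_Omega[OF assms])
  obtain z where z: "z \<in> X_omega n" using X_omega_nonempty[OF assms] by blast
  have "x \<in> X_omega n" if x: "x \<in> Omega n" for x
  proof -
    have "\<exists>a\<in>T n. \<exists>m. occurs_in (subpattern x p w h) ((omega_pat n ^^ m) [[a]])" for p w h
    proof -
      obtain p' where "\<And>c d. 0 \<le> c \<Longrightarrow> c < int w \<Longrightarrow> 0 \<le> d \<Longrightarrow> d < int h \<Longrightarrow>
          z (fst p' + c, snd p' + d) = x (fst p + c, snd p + d)"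
        using window_occurs[OF assms x X_omega_subset[OF assms z], of w h p] by blast
      then have "subpattern x p w h = subpattern z p' w h" by (auto simp: subpattern_def)
      moreover have "\<exists>a\<in>T n. \<exists>m. occurs_in (subpattern z p' w h) ((omega_pat n ^^ m) [[a]])"
        using z unfolding X_omega_def by blast
      ultimately show ?thesis by simp
    qed
    then show ?thesis using Omega_T[OF x] by (simp add: X_omega_def)
  qed
  then show "Omega n = X_omega n" using X_omega_subset[OF assms] by blast
qed

end
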